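(* Assume $\mathrm{cf}(\kappa)=\omega$. The forcing $\mathbb{P}$ collapses $\kappa^\omega$ to $\mathfrak{h}$: if $G$ is $\mathbb{P}$-generic over $V$, then in $V[G]$ there is a surjection from $\mathfrak{h}$ (as computed in $V$) onto $\kappa^\omega$ (as computed in $V$).
   Context: $\kappa$ is a singular cardinal and $\langle \kappa_n:n<\omega\rangle$ is a strictly increasing sequence of regular cardinals with supremum $\kappa$ such that $\omega<\kappa_n<\kappa$ for all $n$. Standing assumption: $\mu^{\omega}<\kappa$ for every cardinal $\mu<\kappa$. Let $N$ be the set of finite sequences $t$ with $t(i)<\kappa_i$ for all $i\in\mathrm{dom}(t)$, and $X$ the set of functions $f$ on $\omega$ with $f(i)<\kappa_i$. A tree is a subset $T\subseteq N$ closed under initial segments; $[T]=\{f\in X: f\restriction n\in T\ \forall n\}$; $\mathrm{Succ}_T(t)$ is the set of one-point extensions of $t$ in $T$. A tree $T$ is perfect if it is nonempty, every $t\in T$ has an extension in $[T]$, and for every $n$ and $t\in T$ there is $t'\in T$ extending $t$ with $|\mathrm{Succ}_T(t')|\ge\kappa_n$. $\mathbb{P}$ is the set of perfect trees ordered by inclusion. $\mathfrak{h}$ (the distributivity number) is the least cardinal $\lambda$ such that the $(\lambda,\infty)$-distributive law fails for $\mathcal{P}(\omega)/\mathrm{Fin}$. *)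

theory Defs
  imports Main "HOL-Library.Sublist"
begin

unbundle cardinal_syntax

section \<open>Ordinals and cardinals\<close>

text \<open>
  A type of class wellorder serves as the ordinal given by its order type: its elements
  are the smaller ordinals, the ordinal \<open>a\<close> being the set of all \<open>x < a\<close>.
  The relations below are the associated well-orders in the format of the library of cardinals.
\<close>

definition whole_ord :: "'k::wellorder rel" where
  "whole_ord = {(x, y). x \<le> y}"

definition seg_ord :: "'k::wellorder \<Rightarrow> 'k rel" where
  "seg_ord a = {(x, y). x \<le> y \<and> y < a}"

lemma Field_whole_ord [simp]: "Field (whole_ord :: 'k::wellorder rel) = UNIV"
  by (auto simp: whole_ord_def Field_def)

lemma Field_seg_ord [simp]: "Field (seg_ord a) = {..<a}"
  by (auto simp: seg_ord_def Field_def)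

lemma Well_order_whole_ord: "Well_order (whole_ord :: 'k::wellorder rel)"
proof -
  have "(whole_ord :: 'k rel) - Id = {(x, y). x < y}"
    by (auto simp: whole_ord_def)
  then have "wf ((whole_ord :: 'k rel) - Id)"
    using wf by simp
  then show ?thesis
    unfolding well_order_on_def linear_order_on_def partial_order_on_def preorder_on_def
      refl_on_def trans_def antisym_def total_on_def Field_whole_ord
    by (auto simp: whole_ord_def)
qed

text \<open>Cofinality of a limit well-order; \<open>s\<close> is meant to be a cardinal.\<close>

definition has_cofinality :: "'a rel \<Rightarrow> 'b rel \<Rightarrow> bool" where
  "has_cofinality r s \<longleftrightarrow>
     (\<exists>C \<subseteq> Field r. cofinal C r \<and> |C| =o s) \<and>
     (\<forall>C \<subseteq> Field r. cofinal C r \<longrightarrow> s \<le>o |C| )"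


section \<open>The distributivity number\<close>

definition maximal_antichain :: "'b::boolean_algebra set \<Rightarrow> bool" where
  "maximal_antichain A \<longleftrightarrow>
     bot \<notin> A \<and> (\<forall>a\<in>A. \<forall>b\<in>A. a \<noteq> b \<longrightarrow> inf a b = bot) \<and>
     (\<forall>b. b \<noteq> bot \<longrightarrow> (\<exists>a\<in>A. inf a b \<noteq> bot))"

definition refines :: "'b::boolean_algebra set \<Rightarrow> 'b set \<Rightarrow> bool" where
  "refines A B \<longleftrightarrow> (\<forall>a\<in>A. \<exists>b\<in>B. a \<le> b)"

text \<open>
  The \<open>(\<lambda>,\<infinity>)\<close>-distributive law, where \<open>\<lambda>\<close> is the cardinality of the index set \<open>I\<close>:
  any \<open>\<lambda>\<close> maximal antichains, of whatever size, have a common refinement.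
\<close>

definition distributive_law :: "'b::boolean_algebra itself \<Rightarrow> 'i set \<Rightarrow> bool" where
  "distributive_law TYPE('b) I \<longleftrightarrow>
     (\<forall>W :: 'i \<Rightarrow> 'b set. (\<forall>i\<in>I. maximal_antichain (W i)) \<longrightarrow>
        (\<exists>R. maximal_antichain R \<and> (\<forall>i\<in>I. refines R (W i))))"

definition eq_mod_fin :: "nat set \<Rightarrow> nat set \<Rightarrow> bool" where
  "eq_mod_fin A B \<longleftrightarrow> finite ((A - B) \<union> (B - A))"

lemma equivp_eq_mod_fin: "equivp eq_mod_fin"
proof (rule equivpI)
  show "reflp eq_mod_fin" by (auto simp: reflp_def eq_mod_fin_def)
  show "symp eq_mod_fin" by (auto simp: symp_def eq_mod_fin_def Un_commute)
  show "transp eq_mod_fin"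
  proof (rule transpI)
    fix A B C assume "eq_mod_fin A B" "eq_mod_fin B C"
    then have "finite (((A - B) \<union> (B - A)) \<union> ((B - C) \<union> (C - B)))"
      by (simp add: eq_mod_fin_def)
    then show "eq_mod_fin A C"
      unfolding eq_mod_fin_def by (rule rev_finite_subset) auto
  qed
qed

text \<open>The Boolean algebra of subsets of \<open>\<omega>\<close> modulo the ideal of finite sets.\<close>

quotient_type pow_fin = "nat set" / eq_mod_fin
  by (rule equivp_eq_mod_fin)

instantiation pow_fin :: boolean_algebra
begin

lift_definition bot_pow_fin :: pow_fin is "{}" .
lift_definition top_pow_fin :: pow_fin is "UNIV" .

lift_definition inf_pow_fin :: "pow_fin \<Rightarrow> pow_fin \<Rightarrow> pow_fin" is "(\<inter>)"
  unfolding eq_mod_fin_def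
  by (rule finite_subset[rotated], rule finite_UnI, assumption, assumption) auto

lift_definition sup_pow_fin :: "pow_fin \<Rightarrow> pow_fin \<Rightarrow> pow_fin" is "(\<union>)"
  unfolding eq_mod_fin_def
  by (rule finite_subset[rotated], rule finite_UnI, assumption, assumption) auto

lift_definition uminus_pow_fin :: "pow_fin \<Rightarrow> pow_fin" is "uminus"
  unfolding eq_mod_fin_def by (rule finite_subset[rotated], assumption) auto

lift_definition minus_pow_fin :: "pow_fin \<Rightarrow> pow_fin \<Rightarrow> pow_fin" is "(-)"
  unfolding eq_mod_fin_def
  by (rule finite_subset[rotated], rule finite_UnI, assumption, assumption) auto

lift_definition less_eq_pow_fin :: "pow_fin \<Rightarrow> pow_fin \<Rightarrow> bool" is "\<lambda>A B. finite (A - B)"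
proof -
  fix A A' B B' :: "nat set"
  assume "eq_mod_fin A A'" "eq_mod_fin B B'"
  then have f: "finite ((A - A') \<union> (A' - A) \<union> (B - B') \<union> (B' - B))"
    by (simp add: eq_mod_fin_def)
  show "finite (A - B) = finite (A' - B')"
  proof
    assume "finite (A - B)"
    with f have "finite (((A - A') \<union> (A' - A) \<union> (B - B') \<union> (B' - B)) \<union> (A - B))" by blast
    then show "finite (A' - B')" by (rule rev_finite_subset) auto
  next
    assume "finite (A' - B')"
    with f have "finite (((A - A') \<union> (A' - A) \<union> (B - B') \<union> (B' - B)) \<union> (A' - B'))" by blast
    then show "finite (A - B)" by (rule rev_finite_subset) auto
  qed
qed

definition less_pow_fin :: "pow_fin \<Rightarrow> pow_fin \<Rightarrow> bool" where
  "less_pow_fin a b \<longleftrightarrow> a \<le> b \<and> \<not> b \<le> a"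

instance
proof
  fix x y z :: pow_fin
  show "x < y \<longleftrightarrow> x \<le> y \<and> \<not> y \<le> x" by (rule less_pow_fin_def)
  show "x \<le> x" by transfer simp
  show "x \<le> z" if "x \<le> y" "y \<le> z"
    using that
  proof transfer
    fix A B C :: "nat set" assume "finite (A - B)" "finite (B - C)"
    then have "finite ((A - B) \<union> (B - C))" by simp
    then show "finite (A - C)" by (rule rev_finite_subset) auto
  qed
  show "x = y" if "x \<le> y" "y \<le> x"
    using that by transfer (simp add: eq_mod_fin_def)
  show "inf x y \<le> x" by transfer (simp add: Diff_eq Int_ac)
  show "inf x y \<le> y" by transfer (simp add: Diff_eq Int_ac)
  show "x \<le> inf y z" if "x \<le> y" "x \<le> z"
    using that by transfer (simp add: Diff_Int)
  show "x \<le> sup x y" by transfer (simp add: Diff_eq)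
  show "y \<le> sup x y" by transfer (simp add: Diff_eq Int_ac)
  show "sup y z \<le> x" if "y \<le> x" "z \<le> x"
    using that by transfer (simp add: Un_Diff)
  show "bot \<le> x" by transfer simp
  show "x \<le> top" by transfer simp
  show "sup x (inf y z) = inf (sup x y) (sup x z)"
    by transfer (simp add: eq_mod_fin_def Un_Int_distrib)
  show "inf x (- x) = bot" by transfer (simp add: eq_mod_fin_def)
  show "sup x (- x) = top" by transfer (simp add: eq_mod_fin_def)
  show "x - y = inf x (- y)" by transfer (simp add: eq_mod_fin_def Diff_eq)
qed

end

text \<open>
  The cardinals below a given cardinal all live on its carrier type, so the second
  clause covers every smaller cardinal.
\<close>

definition is_distributivity_number :: "'h rel \<Rightarrow> bool" where
  "is_distributivity_number h \<longleftrightarrow>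
     Card_order h \<and> \<not> distributive_law TYPE(pow_fin) (Field h) \<and>
     (\<forall>s :: 'h rel. Card_order s \<and> s <o h \<longrightarrow> distributive_law TYPE(pow_fin) (Field s))"


section \<open>Perfect trees\<close>

definition seqs :: "(nat \<Rightarrow> 'k::wellorder) \<Rightarrow> 'k list set" where
  "seqs \<kappa> = {t. \<forall>i < length t. t ! i < \<kappa> i}"

definition inf_seqs :: "(nat \<Rightarrow> 'k::wellorder) \<Rightarrow> (nat \<Rightarrow> 'k) set" where
  "inf_seqs \<kappa> = {f. \<forall>i. f i < \<kappa> i}"

definition restr :: "(nat \<Rightarrow> 'k) \<Rightarrow> nat \<Rightarrow> 'k list" where
  "restr f n = map f [0..<n]"

definition is_tree :: "(nat \<Rightarrow> 'k::wellorder) \<Rightarrow> 'k list set \<Rightarrow> bool" where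
  "is_tree \<kappa> T \<longleftrightarrow> T \<subseteq> seqs \<kappa> \<and> (\<forall>t\<in>T. \<forall>s. prefix s t \<longrightarrow> s \<in> T)"

definition branches :: "(nat \<Rightarrow> 'k::wellorder) \<Rightarrow> 'k list set \<Rightarrow> (nat \<Rightarrow> 'k) set" where
  "branches \<kappa> T = {f \<in> inf_seqs \<kappa>. \<forall>n. restr f n \<in> T}"

definition succs :: "'k list set \<Rightarrow> 'k list \<Rightarrow> 'k list set" where
  "succs T t = {s \<in> T. \<exists>a. s = t @ [a]}"

definition perfect_trees :: "(nat \<Rightarrow> 'k::wellorder) \<Rightarrow> 'k list set set" where
  "perfect_trees \<kappa> = {T. is_tree \<kappa> T \<and> T \<noteq> {} \<and>
     (\<forall>t\<in>T. \<exists>f \<in> branches \<kappa> T. restr f (length t) = t) \<and>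
     (\<forall>n. \<forall>t\<in>T. \<exists>t'\<in>T. prefix t t' \<and> seg_ord (\<kappa> n) \<le>o |succs T t'| )}"


section \<open>The ground model\<close>

text \<open>
  Sets of the ground model: well-founded trees whose nodes have at most \<open>|UNIV :: 'i set|\<close>
  children, i.e. (codes for) the sets of hereditary cardinality at most that of \<open>'i\<close>.
  The partial map \<open>A\<close> enumerates the elements of \<open>VSet A\<close>.
  The type \<open>'i\<close> is a parameter and can be chosen arbitrarily large. Being a surjection
  between two given sets is absolute, so once the forcing notion and the sets in question
  belong to this universe, it does not matter that larger sets are missing.
\<close>

datatype 'i vset = VSet "'i \<Rightarrow> 'i vset option"

primrec elems :: "'i vset \<Rightarrow> 'i vset set" where
  "elems (VSet A) = ran A"

text \<open>Meaningful when \<open>S\<close> is no larger than \<open>'i\<close>, see the next lemma.\<close>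

definition vset_of :: "'i vset set \<Rightarrow> 'i vset" where
  "vset_of S = (SOME x. elems x = S)"

lemma elems_vset_of:
  fixes S :: "'i vset set"
  assumes "|S| \<le>o |UNIV :: 'i set|"
  shows "elems (vset_of S) = S"
proof -
  from assms obtain e :: "'i vset \<Rightarrow> 'i" where e: "inj_on e S"
    unfolding card_of_ordLeq[symmetric] by auto
  define A where "A i = (if i \<in> e ` S then Some (inv_into S e i) else None)" for i
  have "elems (VSet A) = S"
    using e by (auto simp: A_def ran_def split: if_splits) (metis inv_into_f_f imageI)
  then show ?thesis
    unfolding vset_of_def by (rule someI)
qed

text \<open>
  The von Neumann ordinal of a well-order \<open>r\<close>: every element \<open>x\<close> is sent to the set of
  the images of its predecessors.
\<close>

definition vord_at :: "'a rel \<Rightarrow> 'a \<Rightarrow> 'i vset" where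
  "vord_at r = wfrec (r - Id) (\<lambda>g x. vset_of (g ` underS r x))"

definition vordinal :: "'a rel \<Rightarrow> 'i vset" where
  "vordinal r = vset_of (vord_at r ` Field r)"

lemma vord_at_eq:
  fixes r :: "'a rel" and x :: 'a
  assumes "Well_order r"
  shows "(vord_at r x :: 'i vset) = vset_of (vord_at r ` underS r x)"
proof -
  have "wf (r - Id)" using assms by (simp add: well_order_on_def)
  moreover have "cut (vord_at r :: 'a \<Rightarrow> 'i vset) (r - Id) x ` underS r x = vord_at r ` underS r x"
    by (rule image_cong) (auto simp: underS_def cut_apply)
  ultimately show ?thesis
    unfolding vord_at_def by (subst wfrec) (simp_all only:)
qed


section \<open>Forcing\<close>

subsection \<open>The language of set theory\<close>

text \<open>
  Formulas with parameters of type \<open>'n\<close>; the bound variable of a quantifier is a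
  variable of the metalogic.
\<close>

datatype 'n fm =
    Mem 'n 'n
  | Equ 'n 'n
  | Neg "'n fm"
  | Con "'n fm" "'n fm"
  | All "'n \<Rightarrow> 'n fm"

definition Dis :: "'n fm \<Rightarrow> 'n fm \<Rightarrow> 'n fm" where
  "Dis \<phi> \<psi> = Neg (Con (Neg \<phi>) (Neg \<psi>))"

definition Imp :: "'n fm \<Rightarrow> 'n fm \<Rightarrow> 'n fm" where
  "Imp \<phi> \<psi> = Neg (Con \<phi> (Neg \<psi>))"

definition Iff :: "'n fm \<Rightarrow> 'n fm \<Rightarrow> 'n fm" where
  "Iff \<phi> \<psi> = Con (Imp \<phi> \<psi>) (Imp \<psi> \<phi>)"

definition Exi :: "('n \<Rightarrow> 'n fm) \<Rightarrow> 'n fm" where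
  "Exi \<phi> = Neg (All (\<lambda>x. Neg (\<phi> x)))"

definition All_in :: "'n \<Rightarrow> ('n \<Rightarrow> 'n fm) \<Rightarrow> 'n fm" where
  "All_in a \<phi> = All (\<lambda>x. Imp (Mem x a) (\<phi> x))"

definition Exi_in :: "'n \<Rightarrow> ('n \<Rightarrow> 'n fm) \<Rightarrow> 'n fm" where
  "Exi_in a \<phi> = Exi (\<lambda>x. Con (Mem x a) (\<phi> x))"

definition Upair :: "'n \<Rightarrow> 'n \<Rightarrow> 'n \<Rightarrow> 'n fm" where  \<comment> \<open>\<open>z = {x, y}\<close>\<close>
  "Upair z x y = All (\<lambda>w. Iff (Mem w z) (Dis (Equ w x) (Equ w y)))"

definition Opair :: "'n \<Rightarrow> 'n \<Rightarrow> 'n \<Rightarrow> 'n fm" where  \<comment> \<open>\<open>z = {{x}, {x, y}}\<close>\<close>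
  "Opair z x y = Exi (\<lambda>a. Exi (\<lambda>b. Con (Upair a x x) (Con (Upair b x y) (Upair z a b))))"

definition Maps_to :: "'n \<Rightarrow> 'n \<Rightarrow> 'n \<Rightarrow> 'n fm" where  \<comment> \<open>\<open>(x, y) \<in> f\<close>\<close>
  "Maps_to f x y = Exi_in f (\<lambda>z. Opair z x y)"

definition Function :: "'n \<Rightarrow> 'n \<Rightarrow> 'n \<Rightarrow> 'n fm" where  \<comment> \<open>\<open>f : a \<rightarrow> b\<close>\<close>
  "Function f a b =
     Con (All_in f (\<lambda>z. Exi_in a (\<lambda>x. Exi_in b (\<lambda>y. Opair z x y))))
      (Con (All_in a (\<lambda>x. Exi_in b (\<lambda>y. Maps_to f x y)))
       (All_in a (\<lambda>x. All_in b (\<lambda>y. All_in b (\<lambda>y'.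
          Imp (Con (Maps_to f x y) (Maps_to f x y')) (Equ y y'))))))"

definition Surjection :: "'n \<Rightarrow> 'n \<Rightarrow> 'n \<Rightarrow> 'n fm" where
  "Surjection f a b = Con (Function f a b) (All_in b (\<lambda>y. Exi_in a (\<lambda>x. Maps_to f x y)))"


subsection \<open>Names\<close>

text \<open>
  A name is a set of pairs of a name and a condition; as for \<open>vset\<close>, the partial map
  enumerates these pairs.
\<close>

datatype ('i, 'p) name = Name "'i \<Rightarrow> (('i, 'p) name \<times> 'p) option"

primrec name_elems :: "('i, 'p) name \<Rightarrow> (('i, 'p) name \<times> 'p) set" where
  "name_elems (Name A) = ran A"

inductive_set names :: "'p set \<Rightarrow> ('i, 'p) name set" for P :: "'p set" where
  "(\<And>y p. (y, p) \<in> name_elems x \<Longrightarrow> y \<in> names P \<and> p \<in> P) \<Longrightarrow> x \<in> names P"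

text \<open>Check names; \<open>one\<close> stands for the greatest condition.\<close>

primrec check_name :: "'p \<Rightarrow> 'i vset \<Rightarrow> ('i, 'p) name" where
  "check_name one (VSet A) = Name (\<lambda>i. map_option (\<lambda>x. (x, one)) (map_option (check_name one) (A i)))"

lemma name_elems_check_name:
  "name_elems (check_name one x) = (\<lambda>y. (check_name one y, one)) ` elems x"
  by (cases x) (force simp: ran_def)


subsection \<open>The forcing relation\<close>

definition name_rel :: "(('i, 'p) name \<times> ('i, 'p) name) set" where
  "name_rel = {(y, x). y \<in> fst ` name_elems x}"

lemma wf_name_rel: "wf (name_rel :: (('i, 'p) name \<times> ('i, 'p) name) set)"
proof (rule wfUNIVI)
  fix Q :: "('i, 'p) name \<Rightarrow> bool" and x
  assume *: "\<forall>x. (\<forall>y. (y, x) \<in> name_rel \<longrightarrow> Q y) \<longrightarrow> Q x"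
  show "Q x"
  proof (induction x)
    case (Name A)
    have "Q y" if yx: "(y, Name A) \<in> name_rel" for y
    proof -
      from yx obtain i p where "A i = Some (y, p)"
        by (auto simp: name_rel_def ran_def)
      then have "(y, p) \<in> set_option (A i)" "A i \<in> range A" "y \<in> Basic_BNFs.fsts (y, p)"
        by (auto simp: fsts.simps intro: range_eqI[OF sym])
      then show ?thesis using Name by blast
    qed
    with * show ?case by blast
  qed
qed

text \<open>
  A forcing notion is a set \<open>P\<close> of conditions in a partially ordered type, smaller
  conditions being stronger. For the atomic formulas:
  \<open>p\<close> forces \<open>x = y\<close> iff, for every pair \<open>(u, r)\<close> in \<open>x\<close>, the conditions forcing \<open>u = v\<close>
  and lying below \<open>s\<close> for some \<open>(v, s)\<close> in \<open>y\<close> are dense below every common extension of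
  \<open>p\<close> and \<open>r\<close>, and likewise with \<open>x\<close> and \<open>y\<close> interchanged.
  \<open>p\<close> forces \<open>x \<in> y\<close> iff the conditions forcing \<open>x = v\<close> and lying below \<open>s\<close> for some
  \<open>(v, s)\<close> in \<open>y\<close> are dense below \<open>p\<close>.
\<close>

function forces_eq :: "'p::order set \<Rightarrow> 'p \<Rightarrow> ('i, 'p) name \<Rightarrow> ('i, 'p) name \<Rightarrow> bool" where
  "forces_eq P p x y \<longleftrightarrow>
     (\<forall>u \<in> name_elems x. \<forall>q\<in>P. q \<le> p \<and> q \<le> snd u \<longrightarrow>
        (\<exists>q'\<in>P. q' \<le> q \<and> (\<exists>v \<in> name_elems y. q' \<le> snd v \<and> forces_eq P q' (fst u) (fst v)))) \<and>
     (\<forall>v \<in> name_elems y. \<forall>q\<in>P. q \<le> p \<and> q \<le> snd v \<longrightarrow>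
        (\<exists>q'\<in>P. q' \<le> q \<and> (\<exists>u \<in> name_elems x. q' \<le> snd u \<and> forces_eq P q' (fst u) (fst v))))"
  by pat_completeness auto
termination
proof (relation "inv_image name_rel (\<lambda>(P, p, x, y). x)")
  show "wf (inv_image name_rel (\<lambda>(P :: 'p set, p :: 'p, x :: ('i, 'p) name, y :: ('i, 'p) name). x))"
    by (rule wf_inv_image[OF wf_name_rel])
qed (auto simp: name_rel_def)

declare forces_eq.simps [simp del]

definition forces_mem :: "'p::order set \<Rightarrow> 'p \<Rightarrow> ('i, 'p) name \<Rightarrow> ('i, 'p) name \<Rightarrow> bool" where
  "forces_mem P p x y \<longleftrightarrow>
     (\<forall>q\<in>P. q \<le> p \<longrightarrow>
        (\<exists>q'\<in>P. q' \<le> q \<and> (\<exists>v \<in> name_elems y. q' \<le> snd v \<and> forces_eq P q' x (fst v))))"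

primrec forces :: "'p::order set \<Rightarrow> 'p \<Rightarrow> ('i, 'p) name fm \<Rightarrow> bool" where
  "forces P p (Mem x y) \<longleftrightarrow> forces_mem P p x y"
| "forces P p (Equ x y) \<longleftrightarrow> forces_eq P p x y"
| "forces P p (Neg \<phi>) \<longleftrightarrow> (\<forall>q\<in>P. q \<le> p \<longrightarrow> \<not> forces P q \<phi>)"
| "forces P p (Con \<phi> \<psi>) \<longleftrightarrow> forces P p \<phi> \<and> forces P p \<psi>"
| "forces P p (All \<phi>) \<longleftrightarrow> (\<forall>x \<in> names P. forces P p (\<phi> x))"

text \<open>
  ``\<open>\<phi>\<close> holds in \<open>V[G]\<close> for every \<open>P\<close>-generic \<open>G\<close> over \<open>V\<close>'' means that every condition
  forces \<open>\<phi>\<close>.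
\<close>

definition holds_in_generic_extensions :: "'p::order set \<Rightarrow> ('i, 'p) name fm \<Rightarrow> bool" where
  "holds_in_generic_extensions P \<phi> \<longleftrightarrow> (\<forall>p\<in>P. forces P p \<phi>)"

end

theory Submission
  imports Defs "HOL-Library.Countable_Set"
begin

text \<open>
  A family of sets \<open>A i x\<close> of conditions, downward closed, with \<open>A i x\<close> and \<open>A i y\<close> disjoint for \<open>x \<noteq> y\<close>
  and with \<open>\<Union>i. A i x\<close> dense for every label \<open>x\<close>, is a name for a surjection from the indices onto the labels.
  Three such families are composed.

  The first one has labels below \<open>\<kappa>\<close> and reals as indices. Fix maximal antichains \<open>W g\<close> of trees whose
  splitting is bounded according to \<open>g\<close>, and well-order all their members. No condition is compatible with
  only \<open>\<kappa>\<close> many of them, so below a suitable condition the compatible members remain unbounded in one of few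
  ordinals of cofinality above \<open>\<kappa>\<close>. By fusion one can find \<open>g\<^sub>n\<close> and \<open>\<beta>\<^sub>n\<close> and, quite freely, steer the ordinals
  \<open>i\<^sub>n < \<beta>\<^sub>n\<close> of the members of \<open>W g\<^sub>n\<close> compatible with the condition. In a scale for \<open>\<Prod>\<beta>\<^sub>n\<close> modulo finite sets the
  position of \<open>i\<close> can be made any point of countable cofinality in some closed unbounded set, and as in
  Fodor's lemma one rung of its ladder takes \<open>\<kappa>\<close> many values stationarily often; that rung is the label.

  A further fusion turns labels in \<open>\<kappa>\<close> into countable sequences of such labels, indexed by reals. Finally, the
  split levels of a condition form an infinite subset of \<open>\<omega>\<close>, and below every infinite set a refining
  matrix of height \<open>h\<close> for \<open>P(\<omega>)/Fin\<close> splits into continuum many pieces at some level; labelling these pieces by reals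
  reduces the indices to \<open>h\<close>.
\<close>

section \<open>Forcing\<close>

text \<open>A fusion stage has up to \<kappa> many nodes, and each of them decides its own member of
  \<open>W g\<close>. So an index is never fixed; it is only kept between a demand made beforehand
  and a bound found afterwards. Both must survive \<kappa> many nodes, whence the ordinals of
  cofinality above \<kappa>. A label has to be a function of the indices that ignores where in such
  intervals they lie, and the position in a scale is of this kind. Which positions are attainable
  depends on the condition, up to a closed unbounded set; this is why a rung must take its value
  stationarily often.

  What all nodes of a stage share, namely the colour and the stem length, must come from fewer than
  \<kappa> values: then there are fewer than \<kappa> sequences of them, and one sequence can be
  fixed in advance for the whole fusion. The functions \<open>g\<close> are few enough to be part of
  the colour. They are needed because \<kappa> many trees can be avoided by thinning a given tree
  only if they split little on its splitting levels.\<close>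

definition name_of :: "(('i, 'p) name \<times> 'p) set \<Rightarrow> ('i, 'p) name" where
  "name_of S = (SOME x. name_elems x = S)"

lemma name_elems_name_of:
  fixes S :: "(('i, 'p) name \<times> 'p) set"
  assumes "|S| \<le>o |UNIV :: 'i set|"
  shows "name_elems (name_of S) = S"
proof -
  from assms obtain e :: "('i, 'p) name \<times> 'p \<Rightarrow> 'i" where e: "inj_on e S"
    unfolding card_of_ordLeq[symmetric] by auto
  define A where "A i = (if i \<in> e ` S then Some (inv_into S e i) else None)" for i
  have "name_elems (Name A) = S"
    using e by (auto simp: A_def ran_def split: if_splits) (metis inv_into_f_f imageI)
  then show ?thesis
    unfolding name_of_def by (rule someI)
qed

lemma names_iff: "x \<in> names P \<longleftrightarrow> (\<forall>u\<in>name_elems x. fst u \<in> names P \<and> snd u \<in> P)"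
  by (subst names.simps) (auto)

lemma check_name_in_names:
  assumes "one \<in> P"
  shows "check_name one v \<in> names P"
proof (induction v)
  case (VSet A)
  have "check_name one y \<in> names P" if "y \<in> ran A" for y
  proof -
    from that obtain i where "A i = Some y" by (auto simp: ran_def)
    then have "y \<in> set_option (A i)" "A i \<in> range A" by simp_all (metis rangeI)
    then show ?thesis using VSet by blast
  qed
  then show ?case
    by (subst names_iff) (auto simp: name_elems_check_name assms simp del: check_name.simps)
qed

section \<open>The forcing relation: congruence of equality, monotonicity, density,
  connectives\<close>

locale forcing =
  fixes P :: "'p::order set" and one :: 'p
  assumes one_in [simp]: "one \<in> P" and one_greatest [simp]: "\<And>p. p \<in> P \<Longrightarrow> p \<le> one"
begin

lemma forces_eq_mono: "forces_eq P p x y \<Longrightarrow> q \<le> p \<Longrightarrow> forces_eq P q x y"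
  by (subst forces_eq.simps, subst (asm) forces_eq.simps) (meson order_trans)

lemma forces_eq_dense:
  assumes "\<And>q. q \<in> P \<Longrightarrow> q \<le> p \<Longrightarrow> \<exists>q'\<in>P. q' \<le> q \<and> forces_eq P q' x y"
  shows "forces_eq P p x y"
proof (subst forces_eq.simps, intro conjI ballI impI; elim conjE)
  fix u q assume u: "u \<in> name_elems x" and q: "q \<in> P" "q \<le> p" "q \<le> snd u"
  from assms[OF q(1,2)] obtain q' where q': "q' \<in> P" "q' \<le> q" and "forces_eq P q' x y" by blast
  then show "\<exists>q'\<in>P. q' \<le> q \<and> (\<exists>v\<in>name_elems y. q' \<le> snd v \<and> forces_eq P q' (fst u) (fst v))"
    using u q by (subst (asm) forces_eq.simps) (meson order_trans order_refl)
next
  fix v q assume v: "v \<in> name_elems y" and q: "q \<in> P" "q \<le> p" "q \<le> snd v"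
  from assms[OF q(1,2)] obtain q' where q': "q' \<in> P" "q' \<le> q" and "forces_eq P q' x y" by blast
  then show "\<exists>q'\<in>P. q' \<le> q \<and> (\<exists>u\<in>name_elems x. q' \<le> snd u \<and> forces_eq P q' (fst u) (fst v))"
    using v q by (subst (asm) forces_eq.simps) (meson order_trans order_refl)
qed

lemma forces_eq_refl [simp]: "forces_eq P p x x"
proof (induction x arbitrary: p rule: wf_induct_rule[OF wf_name_rel])
  case (1 x)
  then have "forces_eq P q (fst u) (fst u)" if "u \<in> name_elems x" for u q
    using that by (auto simp: name_rel_def)
  then show ?case
    by (subst forces_eq.simps) (meson order_refl)
qed

lemma forces_eq_sym: "forces_eq P p x y \<Longrightarrow> forces_eq P p y x"
proof (induction x arbitrary: p y rule: wf_induct_rule[OF wf_name_rel])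
  case (1 x)
  then have "forces_eq P q (fst u) z \<Longrightarrow> forces_eq P q z (fst u)" if "u \<in> name_elems x" for u q z
    using that by (auto simp: name_rel_def)
  with 1(2) show ?case
    by (subst forces_eq.simps, subst (asm) forces_eq.simps) meson
qed

lemma forces_eq_trans: "forces_eq P p x y \<Longrightarrow> forces_eq P p y z \<Longrightarrow> forces_eq P p x z"
proof (induction x arbitrary: p y z rule: wf_induct_rule[OF wf_name_rel])
  case (1 x)
  have IH: "forces_eq P q (fst u) a \<Longrightarrow> forces_eq P q a b \<Longrightarrow> forces_eq P q (fst u) b"
    if "u \<in> name_elems x" for u q a b
    using that 1(1)[of "fst u"] by (auto simp: name_rel_def)
  note xy = 1(2)[unfolded forces_eq.simps[of P p x y]] and yz = 1(3)[unfolded forces_eq.simps[of P p y z]]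
  show ?case
  proof (subst forces_eq.simps, intro conjI ballI impI; elim conjE)
    fix u q assume u: "u \<in> name_elems x" and q: "q \<in> P" "q \<le> p" "q \<le> snd u"
    with xy obtain q' v where q': "q' \<in> P" "q' \<le> q" and v: "v \<in> name_elems y" "q' \<le> snd v"
      and uv: "forces_eq P q' (fst u) (fst v)" by blast
    with yz q obtain q'' w where q'': "q'' \<in> P" "q'' \<le> q'" and w: "w \<in> name_elems z" "q'' \<le> snd w"
      and vw: "forces_eq P q'' (fst v) (fst w)" by (meson order_trans)
    then show "\<exists>q'\<in>P. q' \<le> q \<and> (\<exists>v\<in>name_elems z. q' \<le> snd v \<and> forces_eq P q' (fst u) (fst v))"
      using IH[OF u forces_eq_mono[OF uv q''(2)] vw] q' by (meson order_trans)
  next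
    fix w q assume w: "w \<in> name_elems z" and q: "q \<in> P" "q \<le> p" "q \<le> snd w"
    with yz obtain q' v where q': "q' \<in> P" "q' \<le> q" and v: "v \<in> name_elems y" "q' \<le> snd v"
      and vw: "forces_eq P q' (fst v) (fst w)" by blast
    with xy q obtain q'' u where q'': "q'' \<in> P" "q'' \<le> q'" and u: "u \<in> name_elems x" "q'' \<le> snd u"
      and uv: "forces_eq P q'' (fst u) (fst v)" by (meson order_trans)
    then show "\<exists>q'\<in>P. q' \<le> q \<and> (\<exists>u\<in>name_elems x. q' \<le> snd u \<and> forces_eq P q' (fst u) (fst w))"
      using IH[OF u(1) uv forces_eq_mono[OF vw q''(2)]] q' by (meson order_trans)
  qed
qed

lemma forces_mem_mono: "forces_mem P p x y \<Longrightarrow> q \<le> p \<Longrightarrow> forces_mem P q x y"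
  unfolding forces_mem_def by (meson order_trans)

lemma forces_mem_dense:
  assumes "\<And>q. q \<in> P \<Longrightarrow> q \<le> p \<Longrightarrow> \<exists>q'\<in>P. q' \<le> q \<and> forces_mem P q' x y"
  shows "forces_mem P p x y"
  using assms unfolding forces_mem_def by (meson order_trans order_refl)

lemma forces_memE:
  assumes "forces_mem P p x y" "p \<in> P"
  obtains q v where "q \<in> P" "q \<le> p" "v \<in> name_elems y" "q \<le> snd v" "forces_eq P q x (fst v)"
  using assms unfolding forces_mem_def by (meson order_refl)

lemma forces_memI:
  assumes "v \<in> name_elems y" "p \<le> snd v" "forces_eq P p x (fst v)"
  shows "forces_mem P p x y"
  using assms unfolding forces_mem_def by (meson forces_eq_mono order_trans order_refl)

lemma forces_mem_cong:
  assumes "forces_mem P p x y" "forces_eq P p x x'" "forces_eq P p y y'"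
  shows "forces_mem P p x' y'"
proof (rule forces_mem_dense)
  fix q assume q: "q \<in> P" "q \<le> p"
  then obtain r v where r: "r \<in> P" "r \<le> q" "v \<in> name_elems y" "r \<le> snd v" "forces_eq P r x (fst v)"
    using forces_memE[OF forces_mem_mono[OF assms(1)]] by metis
  have rp: "r \<le> p" using r q by (meson order_trans)
  obtain s w where s: "s \<in> P" "s \<le> r" "w \<in> name_elems y'" "s \<le> snd w" "forces_eq P s (fst v) (fst w)"
    using forces_eq_mono[OF assms(3) rp, unfolded forces_eq.simps[of P r y y']] r(1,3,4) order_refl by blast
  have "s \<le> q" using r s by (meson order_trans)
  then have "s \<le> p" using q by (meson order_trans)
  have "forces_eq P s x' (fst w)"
    using forces_eq_mono[OF assms(2) \<open>s \<le> p\<close>] forces_eq_mono[OF r(5) s(2)] s(5)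
    by (meson forces_eq_sym forces_eq_trans)
  with s r q show "\<exists>q'\<in>P. q' \<le> q \<and> forces_mem P q' x' y'"
    by (meson forces_memI order_trans)
qed

text \<open>Extensionality for names. It follows once membership is known to respect forced
  equality, and it replaces the recursive clauses of \<open>forces_eq\<close> in all later
  arguments.\<close>

lemma forces_eq_iff:
  "forces_eq P p x y \<longleftrightarrow>
    (\<forall>u\<in>name_elems x. \<forall>q\<in>P. q \<le> p \<and> q \<le> snd u \<longrightarrow> forces_mem P q (fst u) y) \<and>
    (\<forall>v\<in>name_elems y. \<forall>q\<in>P. q \<le> p \<and> q \<le> snd v \<longrightarrow> forces_mem P q (fst v) x)" (is "?L \<longleftrightarrow> ?R")
proof
  assume ?L
  then show ?R
    by (meson forces_eq_mono forces_eq_refl forces_eq_sym forces_memI forces_mem_cong)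
next
  assume R: ?R
  show ?L
  proof (subst forces_eq.simps, intro conjI ballI impI; elim conjE)
    fix u q assume u: "u \<in> name_elems x" and q: "q \<in> P" "q \<le> p" "q \<le> snd u"
    with R have "forces_mem P q (fst u) y" by blast
    with q show "\<exists>q'\<in>P. q' \<le> q \<and> (\<exists>v\<in>name_elems y. q' \<le> snd v \<and> forces_eq P q' (fst u) (fst v))"
      by (meson forces_memE)
  next
    fix v q assume v: "v \<in> name_elems y" and q: "q \<in> P" "q \<le> p" "q \<le> snd v"
    with R have "forces_mem P q (fst v) x" by blast
    with q show "\<exists>q'\<in>P. q' \<le> q \<and> (\<exists>u\<in>name_elems x. q' \<le> snd u \<and> forces_eq P q' (fst u) (fst v))"
      by (meson forces_memE forces_eq_sym)
  qed
qed

lemma forces_eqI: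
  assumes "x \<in> names P" "y \<in> names P"
    and "\<And>w q. w \<in> names P \<Longrightarrow> q \<in> P \<Longrightarrow> q \<le> p \<Longrightarrow> forces_mem P q w x \<longleftrightarrow> forces_mem P q w y"
  shows "forces_eq P p x y"
  unfolding forces_eq_iff
proof (intro conjI ballI impI; elim conjE)
  fix u q assume "u \<in> name_elems x" "q \<in> P" "q \<le> p" "q \<le> snd u"
  then show "forces_mem P q (fst u) y"
    using assms by (metis forces_eq_refl forces_memI names_iff)
next
  fix u q assume "u \<in> name_elems y" "q \<in> P" "q \<le> p" "q \<le> snd u"
  then show "forces_mem P q (fst u) x"
    using assms by (metis forces_eq_refl forces_memI names_iff)
qed

lemma forces_mono: "forces P p \<phi> \<Longrightarrow> q \<le> p \<Longrightarrow> forces P q \<phi>"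
proof (induction \<phi> arbitrary: p q)
  case (Mem x y) then show ?case by (auto intro: forces_mem_mono)
next
  case (Equ x y) then show ?case by (auto intro: forces_eq_mono)
next
  case (Neg \<phi>) then show ?case by auto
next
  case (Con \<phi> \<psi>) then show ?case by (meson forces.simps(4))
next
  case (All \<phi>) then show ?case by auto
qed

lemma forces_dense:
  fixes \<phi> :: "('i, 'p) name fm"
  assumes "\<And>q. q \<in> P \<Longrightarrow> q \<le> p \<Longrightarrow> \<exists>q'\<in>P. q' \<le> q \<and> forces P q' \<phi>"
  shows "forces P p \<phi>"
  using assms
proof (induction \<phi> arbitrary: p)
  case (Mem x y) then show ?case by (auto intro: forces_mem_dense)
next
  case (Equ x y) then show ?case by (auto intro: forces_eq_dense)
next
  case (Neg \<phi>) then show ?case by simp (meson forces_mono order_refl)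
next
  case (Con \<phi> \<psi>)
  show ?case unfolding forces.simps
    by (intro conjI Con.IH; use Con.prems in \<open>force simp: forces.simps(4)\<close>)
next
  case (All \<phi>)
  show ?case unfolding forces.simps
  proof
    fix x :: "('i, 'p) name" assume x: "x \<in> names P"
    show "forces P p (\<phi> x)"
    proof (rule All.IH[of "\<phi> x"])
      fix q assume "q \<in> P" "q \<le> p"
      from All.prems[OF this] x show "\<exists>q'\<in>P. q' \<le> q \<and> forces P q' (\<phi> x)" unfolding forces.simps by blast
    qed simp
  qed
qed

text \<open>Classical logic in the extension: a double negation says that the conditions forcing the
  formula are dense below \<open>p\<close>, and \<open>forces_dense\<close> applies.\<close>

lemma forces_Neg_Neg: "p \<in> P \<Longrightarrow> forces P p (Neg (Neg \<phi>)) \<longleftrightarrow> forces P p \<phi>"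
proof
  assume "forces P p (Neg (Neg \<phi>))"
  then show "forces P p \<phi>" by (intro forces_dense) simp
next
  assume "forces P p \<phi>"
  then show "forces P p (Neg (Neg \<phi>))" by simp (meson forces_mono order_refl)
qed

lemma forces_Dis:
  "p \<in> P \<Longrightarrow> forces P p (Dis \<phi> \<psi>) \<longleftrightarrow> (\<forall>q\<in>P. q \<le> p \<longrightarrow> (\<exists>q'\<in>P. q' \<le> q \<and> (forces P q' \<phi> \<or> forces P q' \<psi>)))"
  unfolding Dis_def by simp (meson forces_mono order_trans order_refl)

lemma forces_Imp:
  assumes "p \<in> P"
  shows "forces P p (Imp \<phi> \<psi>) \<longleftrightarrow> (\<forall>q\<in>P. q \<le> p \<longrightarrow> forces P q \<phi> \<longrightarrow> forces P q \<psi>)" (is "?L \<longleftrightarrow> ?R")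
proof
  assume L: ?L
  show ?R
  proof (intro ballI impI)
    fix q assume q: "q \<in> P" "q \<le> p" "forces P q \<phi>"
    have "forces P q (Neg (Neg \<psi>))"
      unfolding forces.simps
    proof (intro ballI impI notI)
      fix r assume r: "r \<in> P" "r \<le> q" "\<forall>s\<in>P. s \<le> r \<longrightarrow> \<not> forces P s \<psi>"
      then have "forces P r (Con \<phi> (Neg \<psi>))" using forces_mono q by auto
      moreover have "r \<le> p" using r q by (meson order_trans)
      ultimately show False using L r unfolding Imp_def by auto
    qed
    then show "forces P q \<psi>" using q by (simp only: forces_Neg_Neg)
  qed
next
  assume ?R
  then show ?L unfolding Imp_def by simp (meson order_refl)
qed

lemma forces_Iff:
  "p \<in> P \<Longrightarrow> forces P p (Iff \<phi> \<psi>) \<longleftrightarrow> (\<forall>q\<in>P. q \<le> p \<longrightarrow> forces P q \<phi> \<longleftrightarrow> forces P q \<psi>)"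
  by (auto simp: Iff_def forces_Imp)

lemma forces_Exi:
  "forces P p (Exi \<phi>) \<longleftrightarrow> (\<forall>q\<in>P. q \<le> p \<longrightarrow> (\<exists>q'\<in>P. q' \<le> q \<and> (\<exists>x\<in>names P. forces P q' (\<phi> x))))"
  unfolding Exi_def by simp (meson forces_mono order_trans order_refl)

lemma forces_ExiI:
  assumes "x \<in> names P" "forces P p (\<phi> x)"
  shows "forces P p (Exi \<phi>)"
  unfolding forces_Exi using assms forces_mono by blast

lemma forces_ExiE:
  assumes "forces P p (Exi \<phi>)" "p \<in> P"
  obtains q x where "q \<in> P" "q \<le> p" "x \<in> names P" "forces P q (\<phi> x)"
  using assms unfolding forces_Exi by blast

lemma forces_Exi_inI:
  assumes "x \<in> names P" "forces_mem P p x a" "forces P p (\<phi> x)"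
  shows "forces P p (Exi_in a \<phi>)"
  unfolding Exi_in_def by (rule forces_ExiI[OF assms(1)]) (simp add: assms)

lemma forces_Exi_inE:
  assumes "forces P p (Exi_in a \<phi>)" "p \<in> P"
  obtains q x where "q \<in> P" "q \<le> p" "x \<in> names P" "forces_mem P q x a" "forces P q (\<phi> x)"
  using assms unfolding Exi_in_def by (auto elim!: forces_ExiE)

lemma forces_All_in:
  assumes "p \<in> P"
  shows "forces P p (All_in a \<phi>) \<longleftrightarrow>
    (\<forall>x\<in>names P. \<forall>q\<in>P. q \<le> p \<longrightarrow> forces_mem P q x a \<longrightarrow> forces P q (\<phi> x))"
  using assms by (simp add: All_in_def forces_Imp)

lemma forces_Exi_in:
  "forces P p (Exi_in a \<phi>) \<longleftrightarrow>
    (\<forall>q\<in>P. q \<le> p \<longrightarrow> (\<exists>q'\<in>P. q' \<le> q \<and> (\<exists>x\<in>names P. forces_mem P q' x a \<and> forces P q' (\<phi> x))))"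
  by (simp add: Exi_in_def forces_Exi)

end

text \<open>\<open>dummy\<close> makes the type \<open>'i\<close> a parameter of the locale. As
  \<open>'i\<close> is infinite, every pair of names can be enumerated by it, so that unordered
  pairs have names.\<close>

locale forcing_names = forcing P one for P :: "'p::order set" and one +
  fixes dummy :: "'i itself"
  assumes infinite_names: "infinite (UNIV :: 'i set)"
begin

section \<open>Names for pairs, and for a surjection given by a labelled family of
  conditions\<close>

definition up :: "('i, 'p) name \<Rightarrow> ('i, 'p) name \<Rightarrow> ('i, 'p) name" where
  "up x y = name_of {(x, one), (y, one)}"

definition op :: "('i, 'p) name \<Rightarrow> ('i, 'p) name \<Rightarrow> ('i, 'p) name" where
  "op x y = up (up x x) (up x y)"

lemma name_elems_up: "name_elems (up x y) = {(x, one), (y, one)}"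
  unfolding up_def
proof (rule name_elems_name_of)
  show "|{(x, one), (y, one)}| \<le>o |UNIV :: 'i set|"
    using card_of_ordLeq_finite[of "UNIV :: 'i set" "{(x, one), (y, one)}"] infinite_names
    by (metis card_of_Well_order finite.emptyI finite.insertI ordLeq_total)
qed

lemma up_names [simp]: "x \<in> names P \<Longrightarrow> y \<in> names P \<Longrightarrow> up x y \<in> names P"
  by (subst names_iff) (simp add: name_elems_up)

lemma op_names [simp]: "x \<in> names P \<Longrightarrow> y \<in> names P \<Longrightarrow> op x y \<in> names P"
  by (simp add: op_def)

lemma forces_mem_up:
  "forces_mem P p w (up x y) \<longleftrightarrow>
    (\<forall>q\<in>P. q \<le> p \<longrightarrow> (\<exists>q'\<in>P. q' \<le> q \<and> (forces_eq P q' w x \<or> forces_eq P q' w y)))"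
  unfolding forces_mem_def name_elems_up by auto

lemma forces_mem_up1 [simp]: "forces_mem P p x (up x y)" "forces_mem P p y (up x y)"
  unfolding forces_mem_up by auto

lemma forces_mem_upE:
  assumes "forces_mem P p w (up x y)" "p \<in> P"
  obtains q where "q \<in> P" "q \<le> p" "forces_eq P q w x \<or> forces_eq P q w y"
  using assms unfolding forces_mem_up by blast

lemma forces_mem_up_same: "forces_mem P p w (up x x) \<Longrightarrow> forces_eq P p w x"
  by (rule forces_eq_dense) (auto simp: forces_mem_up)

lemma forces_Upair:
  assumes "p \<in> P" "x \<in> names P" "y \<in> names P" "z \<in> names P"
  shows "forces P p (Upair z x y) \<longleftrightarrow> forces_eq P p z (up x y)"
proof -
  have "forces P q (Dis (Equ w x) (Equ w y)) \<longleftrightarrow> forces_mem P q w (up x y)" if "q \<in> P" for q w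
    using that by (simp add: forces_Dis forces_mem_up)
  then have "forces P p (Upair z x y) \<longleftrightarrow>
     (\<forall>w\<in>names P. \<forall>q\<in>P. q \<le> p \<longrightarrow> forces_mem P q w z \<longleftrightarrow> forces_mem P q w (up x y))"
    using assms by (auto simp: Upair_def forces_Iff)
  also have "\<dots> \<longleftrightarrow> forces_eq P p z (up x y)"
  proof
    assume "forces_eq P p z (up x y)"
    then show "\<forall>w\<in>names P. \<forall>q\<in>P. q \<le> p \<longrightarrow> forces_mem P q w z \<longleftrightarrow> forces_mem P q w (up x y)"
      by (meson forces_eq_mono forces_eq_refl forces_eq_sym forces_mem_cong)
  qed (use assms in \<open>auto intro: forces_eqI\<close>)
  finally show ?thesis .
qed

lemma up_cong:
  assumes x: "forces_eq P p x x'" and y: "forces_eq P p y y'"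
  shows "forces_eq P p (up x y) (up x' y')"
proof -
  have "forces_mem P q x (up x' y')" "forces_mem P q x' (up x y)"
    "forces_mem P q y (up x' y')" "forces_mem P q y' (up x y)" if "q \<le> p" for q
    using forces_eq_mono[OF x that] forces_eq_mono[OF y that]
      forces_mem_cong[OF forces_mem_up1(1) _ forces_eq_refl] forces_mem_cong[OF forces_mem_up1(2) _ forces_eq_refl]
      forces_eq_sym by blast+
  then show ?thesis
    unfolding forces_eq_iff name_elems_up by simp
qed

lemma op_cong: "forces_eq P p x x' \<Longrightarrow> forces_eq P p y y' \<Longrightarrow> forces_eq P p (op x y) (op x' y')"
  by (simp add: op_def up_cong)

lemma op_inject1:
  assumes "forces_eq P p (op x y) (op x' y')" "p \<in> P"
  shows "forces_eq P p x x'"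
proof (rule forces_eq_dense)
  fix q assume q: "q \<in> P" "q \<le> p"
  have "forces_mem P q (up x x) (op x y)" by (simp add: op_def)
  then have "forces_mem P q (up x x) (op x' y')"
    by (rule forces_mem_cong[OF _ forces_eq_refl forces_eq_mono[OF assms(1) q(2)]])
  then obtain r where r: "r \<in> P" "r \<le> q" "forces_eq P r (up x x) (up x' x') \<or> forces_eq P r (up x x) (up x' y')"
    using q unfolding op_def by (auto elim: forces_mem_upE)
  then have "forces_mem P r x' (up x x)"
    using forces_mem_cong[OF forces_mem_up1(1) forces_eq_refl forces_eq_sym] by blast
  then show "\<exists>q'\<in>P. q' \<le> q \<and> forces_eq P q' x x'"
    using r forces_mem_up_same forces_eq_sym by blast
qed

lemma op_inject2:
  assumes "forces_eq P p (op x y) (op x' y')" "p \<in> P"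
  shows "forces_eq P p y y'"
proof (rule forces_eq_dense)
  fix q assume q: "q \<in> P" "q \<le> p"
  have xx: "forces_eq P q x x'" and eq: "forces_eq P q (op x y) (op x' y')"
    using op_inject1[OF assms] forces_eq_mono q assms by blast+
  have "forces_mem P q (up x y) (op x y)" by (simp add: op_def)
  then have "forces_mem P q (up x y) (op x' y')"
    by (rule forces_mem_cong[OF _ forces_eq_refl eq])
  then obtain r where r: "r \<in> P" "r \<le> q" "forces_eq P r (up x y) (up x' x') \<or> forces_eq P r (up x y) (up x' y')"
    using q unfolding op_def by (auto elim: forces_mem_upE)
  then have "forces_mem P r y (up x' x') \<or> forces_mem P r y (up x' y')"
    using forces_mem_cong[OF forces_mem_up1(2) forces_eq_refl] by blast
  then obtain s where s: "s \<in> P" "s \<le> r" "forces_eq P s y x' \<or> forces_eq P s y y'"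
    using forces_mem_upE[OF _ r(1)] by blast
  show "\<exists>q'\<in>P. q' \<le> q \<and> forces_eq P q' y y'"
  proof (cases "forces_eq P s y y'")
    case True
    then show ?thesis using r s by (meson order_trans)
  next
    \<comment> \<open>The degenerate case of Kuratowski pairs: \<open>s\<close> forces
      \<open>y\<close>, \<open>x'\<close> and \<open>x\<close> to be equal, so \<open>y'\<close> has
      to be located from the other side, as an element of a member of \<open>op x y\<close>.\<close>
    case False
    with s have yx: "forces_eq P s y x'" by blast
    have sq: "s \<le> q" using r s by (meson order_trans)
    have yx2: "forces_eq P s y x" using yx xx sq by (meson forces_eq_mono forces_eq_sym forces_eq_trans)
    have "forces_mem P s (up x' y') (op x' y')" by (simp add: op_def)
    then have "forces_mem P s (up x' y') (op x y)"
      by (rule forces_mem_cong[OF _ forces_eq_refl forces_eq_sym[OF forces_eq_mono[OF eq sq]]])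
    then obtain t where t: "t \<in> P" "t \<le> s" "forces_eq P t (up x' y') (up x x) \<or> forces_eq P t (up x' y') (up x y)"
      using s unfolding op_def by (auto elim: forces_mem_upE)
    then have "forces_mem P t y' (up x x) \<or> forces_mem P t y' (up x y)"
      using forces_mem_cong[OF forces_mem_up1(2) forces_eq_refl] by blast
    then obtain v where v: "v \<in> P" "v \<le> t" "forces_eq P v y' x \<or> forces_eq P v y' y"
      using forces_mem_upE[OF _ t(1)] by blast
    have "v \<le> s" using v t by (meson order_trans)
    then have "forces_eq P v y y'"
      using v yx2 by (meson forces_eq_mono forces_eq_sym forces_eq_trans)
    then show ?thesis using v \<open>v \<le> s\<close> sq by (meson order_trans)
  qed
qed

lemma forces_Opair:
  assumes "p \<in> P" "x \<in> names P" "y \<in> names P" "z \<in> names P"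
  shows "forces P p (Opair z x y) \<longleftrightarrow> forces_eq P p z (op x y)" (is "?L \<longleftrightarrow> ?R")
proof
  assume L: ?L
  show ?R
  proof (rule forces_eq_dense)
    fix q assume q: "q \<in> P" "q \<le> p"
    have "forces P q (Opair z x y)" using L q by (meson forces_mono)
    then obtain r a where r: "r \<in> P" "r \<le> q" "a \<in> names P"
        "forces P r (Exi (\<lambda>b. Con (Upair a x x) (Con (Upair b x y) (Upair z a b))))"
      unfolding Opair_def by (rule forces_ExiE) (use q in auto)
    obtain s b where s: "s \<in> P" "s \<le> r" "b \<in> names P"
        "forces P s (Con (Upair a x x) (Con (Upair b x y) (Upair z a b)))"
      using r(4,1) by (rule forces_ExiE)
    then have "forces_eq P s a (up x x)" "forces_eq P s b (up x y)" "forces_eq P s z (up a b)"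
      using assms r by (auto simp: forces_Upair)
    then have "forces_eq P s z (op x y)"
      unfolding op_def by (meson forces_eq_trans up_cong)
    then show "\<exists>q'\<in>P. q' \<le> q \<and> forces_eq P q' z (op x y)" using s r by (meson order_trans)
  qed
next
  assume R: ?R
  have *: "forces P q (Con (Upair (up x x) x x) (Con (Upair (up x y) x y) (Upair z (up x x) (up x y))))"
    if "q \<in> P" "q \<le> p" for q
    using that assms R by (auto simp: forces_Upair op_def intro: forces_eq_mono)
  have **: "forces P q (Exi (\<lambda>b. Con (Upair (up x x) x x) (Con (Upair b x y) (Upair z (up x x) b))))"
    if "q \<in> P" "q \<le> p" for q
    by (rule forces_ExiI[of "up x y"]) (use that assms * in auto)
  show ?L unfolding Opair_def
    by (rule forces_ExiI[of "up x x"]) (use assms ** in auto)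
qed

lemma forces_Maps_to:
  assumes "p \<in> P" "x \<in> names P" "y \<in> names P"
  shows "forces P p (Maps_to f x y) \<longleftrightarrow> forces_mem P p (op x y) f"
proof
  assume L: "forces P p (Maps_to f x y)"
  show "forces_mem P p (op x y) f"
  proof (rule forces_mem_dense)
    fix q assume q: "q \<in> P" "q \<le> p"
    then have "forces P q (Exi_in f (\<lambda>z. Opair z x y))"
      using L forces_mono unfolding Maps_to_def by blast
    from forces_Exi_inE[OF this q(1)] obtain r z where r: "r \<in> P" "r \<le> q" "z \<in> names P"
      "forces_mem P r z f" "forces P r (Opair z x y)" .
    then have "forces_eq P r z (op x y)" using assms by (simp add: forces_Opair)
    then have "forces_mem P r (op x y) f" using r forces_eq_refl forces_mem_cong by blast
    then show "\<exists>q'\<in>P. q' \<le> q \<and> forces_mem P q' (op x y) f" using r by blast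
  qed
next
  assume R: "forces_mem P p (op x y) f"
  show "forces P p (Maps_to f x y)"
    unfolding Maps_to_def
    by (rule forces_Exi_inI[of "op x y"]) (use assms R in \<open>auto simp: forces_Opair\<close>)
qed

text \<open>The name \<open>f\<close> puts \<open>(i, j)\<close> into the function when the generic
  filter meets \<open>B i j\<close>; each clause is then a density argument. \<open>inj\<close>
  keeps two indices from being merged in the extension, where single-valuedness would otherwise be
  lost. The codes of the labels need not be injective, because only equality of the values is
  concluded. \<open>small\<close> makes the set of pairs enumerable by \<open>'i\<close>.\<close>

lemma forces_Surjection:
  fixes ea :: "'x \<Rightarrow> 'i vset" and eb :: "'y \<Rightarrow> 'i vset" and B :: "'x \<Rightarrow> 'y \<Rightarrow> 'p set"
  assumes va: "elems va = ea ` I" and vb: "elems vb = eb ` J"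
    and sub: "\<And>i j. B i j \<subseteq> P"
    and down: "\<And>i j p q. p \<in> B i j \<Longrightarrow> q \<in> P \<Longrightarrow> q \<le> p \<Longrightarrow> q \<in> B i j"
    and total: "\<And>i p. i \<in> I \<Longrightarrow> p \<in> P \<Longrightarrow> \<exists>j\<in>J. \<exists>q\<in>B i j. q \<le> p"
    and cons: "\<And>i j j' p. i \<in> I \<Longrightarrow> p \<in> B i j \<Longrightarrow> p \<in> B i j' \<Longrightarrow> j = j'"
    and surj: "\<And>j p. j \<in> J \<Longrightarrow> p \<in> P \<Longrightarrow> \<exists>i\<in>I. \<exists>q\<in>B i j. q \<le> p"
    and inj: "\<And>i i' p. i \<in> I \<Longrightarrow> i' \<in> I \<Longrightarrow> p \<in> P \<Longrightarrow>
       forces_eq P p (check_name one (ea i)) (check_name one (ea i')) \<Longrightarrow> i = i'"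
    and small: "|I \<times> J \<times> P| \<le>o |UNIV :: 'i set|"
    and p: "p \<in> P"
  shows "forces P p (Exi (\<lambda>f. Surjection f (check_name one va) (check_name one vb)))"
proof -
  let ?a = "\<lambda>i. check_name one (ea i)" and ?b = "\<lambda>j. check_name one (eb j)"
  define F where "F = {(op (?a i) (?b j), q) | i j q. i \<in> I \<and> j \<in> J \<and> q \<in> B i j}"
  define f where "f = name_of F"
  have "F \<subseteq> (\<lambda>(i, j, q). (op (?a i) (?b j), q)) ` (I \<times> J \<times> P)"
    using sub unfolding F_def by force
  then have "|F| \<le>o |UNIV :: 'i set|"
    using small by (meson card_of_image card_of_mono1 ordLeq_transitive)
  then have fe: "name_elems f = F" unfolding f_def by (rule name_elems_name_of)
  have an [simp]: "check_name one v \<in> names P" for v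
    by (rule check_name_in_names) simp
  have fn [simp]: "f \<in> names P"
    using sub by (subst names_iff) (auto simp: fe F_def)
  have memf: "forces_mem P r (op (?a i) (?b j)) f" if "i \<in> I" "j \<in> J" "r \<in> B i j" for i j r
    by (rule forces_memI[of "(op (?a i) (?b j), r)"]) (use that in \<open>auto simp: fe F_def\<close>)
  have mema: "forces_mem P r (?a i) (check_name one va)" if "i \<in> I" "r \<in> P" for i r
    by (rule forces_memI[of "(?a i, one)"]) (use that in \<open>auto simp: name_elems_check_name va\<close>)
  have memb: "forces_mem P r (?b j) (check_name one vb)" if "j \<in> J" "r \<in> P" for j r
    by (rule forces_memI[of "(?b j, one)"]) (use that in \<open>auto simp: name_elems_check_name vb\<close>)
  have fE: "\<exists>s\<in>P. \<exists>i\<in>I. \<exists>j\<in>J. s \<le> r \<and> s \<in> B i j \<and> forces_eq P s z (op (?a i) (?b j))"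
    if "forces_mem P r z f" "r \<in> P" for r z
  proof -
    from forces_memE[OF that] obtain s v where s: "s \<in> P" "s \<le> r" "v \<in> F" "s \<le> snd v" "forces_eq P s z (fst v)"
      using fe by metis
    then show ?thesis unfolding F_def using down by force
  qed
  have aE: "\<exists>s\<in>P. \<exists>i\<in>I. s \<le> r \<and> forces_eq P s z (?a i)"
    if m: "forces_mem P r z (check_name one va)" and r: "r \<in> P" for r z
    by (rule forces_memE[OF m r]) (auto simp: name_elems_check_name va; blast)
  have bE: "\<exists>s\<in>P. \<exists>j\<in>J. s \<le> r \<and> forces_eq P s z (?b j)"
    if m: "forces_mem P r z (check_name one vb)" and r: "r \<in> P" for r z
    by (rule forces_memE[OF m r]) (auto simp: name_elems_check_name vb; blast)
  have opx: "forces_mem P r (op x y) f" if "forces_eq P r x (?a i)" "forces_eq P r y (?b j)" "i \<in> I" "j \<in> J" "r \<in> B i j"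
    for r x y i j
    using memf[OF that(3-5)] op_cong[OF that(1,2)] by (meson forces_eq_refl forces_eq_sym forces_mem_cong)
  have 1: "forces P r (All_in f (\<lambda>z. Exi_in (check_name one va) (\<lambda>x. Exi_in (check_name one vb) (\<lambda>y. Opair z x y))))"
    if "r \<in> P" for r
    unfolding forces_All_in[OF that]
  proof (intro ballI impI)
    fix z q assume z: "z \<in> names P" and q: "q \<in> P" "q \<le> r" "forces_mem P q z f"
    show "forces P q (Exi_in (check_name one va) (\<lambda>x. Exi_in (check_name one vb) (\<lambda>y. Opair z x y)))"
    proof (rule forces_dense)
      fix q1 assume q1: "q1 \<in> P" "q1 \<le> q"
      from fE[OF forces_mem_mono[OF q(3) q1(2)] q1(1)]
      obtain s i j where s: "s \<in> P" "i \<in> I" "j \<in> J" "s \<le> q1" "s \<in> B i j" "forces_eq P s z (op (?a i) (?b j))"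
        by blast
      have "forces P s (Opair z (?a i) (?b j))"
        using z s by (auto simp: forces_Opair)
      then have "forces P s (Exi_in (check_name one vb) (\<lambda>y. Opair z (?a i) y))"
        by (rule forces_Exi_inI[of "?b j", rotated 2]) (use memb s in auto)
      then have "forces P s (Exi_in (check_name one va) (\<lambda>x. Exi_in (check_name one vb) (\<lambda>y. Opair z x y)))"
        by (rule forces_Exi_inI[of "?a i", rotated 2]) (use mema s in auto)
      then show "\<exists>q'\<in>P. q' \<le> q1 \<and> forces P q' (Exi_in (check_name one va) (\<lambda>x. Exi_in (check_name one vb) (\<lambda>y. Opair z x y)))"
        using s by blast
    qed
  qed
  have 2: "forces P r (All_in (check_name one va) (\<lambda>x. Exi_in (check_name one vb) (\<lambda>y. Maps_to f x y)))"
    if "r \<in> P" for r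
    unfolding forces_All_in[OF that] forces_Exi_in
  proof (intro ballI impI)
    fix x q q1 assume x: "x \<in> names P" and q: "q \<in> P" "q \<le> r" "forces_mem P q x (check_name one va)" and q1: "q1 \<in> P" "q1 \<le> q"
    from aE[OF forces_mem_mono[OF q(3) q1(2)] q1(1)] obtain s i where s: "s \<in> P" "i \<in> I" "s \<le> q1" "forces_eq P s x (?a i)"
      by blast
    from total[OF s(2,1)] obtain j t where t: "j \<in> J" "t \<in> B i j" "t \<le> s" by blast
    then have tP: "t \<in> P" using sub by blast
    have "forces P t (Maps_to f x (?b j))"
      using tP x t s opx[of t x i "?b j" j] by (auto simp: forces_Maps_to intro: forces_eq_mono)
    then show "\<exists>q'\<in>P. q' \<le> q1 \<and> (\<exists>y\<in>names P. forces_mem P q' y (check_name one vb) \<and> forces P q' (Maps_to f x y))"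
      using t tP s memb by (meson an order_trans)
  qed
  have 3: "forces P r (All_in (check_name one va) (\<lambda>x. All_in (check_name one vb) (\<lambda>y. All_in (check_name one vb) (\<lambda>y'.
          Imp (Con (Maps_to f x y) (Maps_to f x y')) (Equ y y')))))" if "r \<in> P" for r
  proof -
    have *: "forces_eq P q y y'" if q: "q \<in> P" "forces_mem P q (op x y) f" "forces_mem P q (op x y') f" for q x y y'
    proof (rule forces_eq_dense)
      fix q1 assume q1: "q1 \<in> P" "q1 \<le> q"
      from fE[OF forces_mem_mono[OF q(2) q1(2)] q1(1)] obtain s i j where s: "s \<in> P" "i \<in> I" "j \<in> J" "s \<le> q1" "s \<in> B i j"
        "forces_eq P s (op x y) (op (?a i) (?b j))" by blast
      have "s \<le> q" using s q1 by (meson order_trans)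
      from fE[OF forces_mem_mono[OF q(3) this] s(1)] obtain t i' j' where t: "t \<in> P" "i' \<in> I" "j' \<in> J" "t \<le> s" "t \<in> B i' j'"
        "forces_eq P t (op x y') (op (?a i') (?b j'))" by blast
      have s': "forces_eq P t (op x y) (op (?a i) (?b j))" using s t forces_eq_mono by blast
      have "forces_eq P t (?a i) (?a i')"
        using op_inject1[OF s' t(1)] op_inject1[OF t(6) t(1)] by (meson forces_eq_sym forces_eq_trans)
      then have "i = i'" using inj s t by blast
      moreover have "t \<in> B i j" using down s t by blast
      ultimately have "j = j'" using cons t by blast
      then have "forces_eq P t y y'"
        using op_inject2[OF s' t(1)] op_inject2[OF t(6) t(1)] by (meson forces_eq_sym forces_eq_trans)
      then show "\<exists>q'\<in>P. q' \<le> q1 \<and> forces_eq P q' y y'" using t s by (meson order_trans)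
    qed
    show ?thesis
      using that by (auto simp: forces_All_in forces_Imp forces_Maps_to intro: *)
  qed
  have 4: "forces P r (All_in (check_name one vb) (\<lambda>y. Exi_in (check_name one va) (\<lambda>x. Maps_to f x y)))"
    if "r \<in> P" for r
    unfolding forces_All_in[OF that] forces_Exi_in
  proof (intro ballI impI)
    fix y q q1 assume y: "y \<in> names P" and q: "q \<in> P" "q \<le> r" "forces_mem P q y (check_name one vb)" and q1: "q1 \<in> P" "q1 \<le> q"
    from bE[OF forces_mem_mono[OF q(3) q1(2)] q1(1)] obtain s j where s: "s \<in> P" "j \<in> J" "s \<le> q1" "forces_eq P s y (?b j)"
      by blast
    from surj[OF s(2,1)] obtain i t where t: "i \<in> I" "t \<in> B i j" "t \<le> s" by blast
    then have tP: "t \<in> P" using sub by blast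
    have "forces P t (Maps_to f (?a i) y)"
      using tP y t s opx[of t "?a i" i y j] by (auto simp: forces_Maps_to intro: forces_eq_mono)
    then show "\<exists>q'\<in>P. q' \<le> q1 \<and> (\<exists>x\<in>names P. forces_mem P q' x (check_name one va) \<and> forces P q' (Maps_to f x y))"
      using t tP s mema by (meson an order_trans)
  qed
  have "forces P r (Surjection f (check_name one va) (check_name one vb))" if "r \<in> P" for r
    unfolding Surjection_def Function_def forces.simps using 1 2 3 4 that by simp
  then show ?thesis unfolding forces_Exi using fn by (meson order_refl)
qed

text \<open>Descent instead of absoluteness: if equality with a smaller ordinal \<open>y\<close>
  were forced, \<open>y\<close> would be forced to be an element of itself, hence some extension
  would force it to equal an ordinal \<open>u\<close> below \<open>y\<close>.\<close>

lemma check_vord_inject: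
  fixes r :: "'a rel"
  assumes wo: "Well_order r" and small: "|Field r| \<le>o |UNIV :: 'i set|"
    and x: "x \<in> Field r" "x' \<in> Field r" and p: "p \<in> P"
    and eq: "forces_eq P p (check_name one (vord_at r x :: 'i vset)) (check_name one (vord_at r x'))"
  shows "x = x'"
proof -
  let ?v = "\<lambda>x. check_name one (vord_at r x :: 'i vset)"
  have el: "elems (vord_at r y :: 'i vset) = vord_at r ` underS r y" for y
  proof -
    have "|vord_at r ` underS r y :: 'i vset set| \<le>o |underS r y|" by (rule card_of_image)
    moreover have "|underS r y| \<le>o |Field r|" by (rule card_of_mono1) (auto simp: underS_def Field_def)
    ultimately show ?thesis using small wo
      by (subst vord_at_eq) (auto intro!: elems_vset_of intro: ordLeq_transitive)
  qed
  have wf: "wf (r - Id)" using wo by (simp add: well_order_on_def)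
  have main: "\<not> forces_eq P q (?v z) (?v y)" if "y \<in> underS r z" "q \<in> P" for y z q
    using wf that
  proof (induction y arbitrary: z q rule: wf_induct_rule)
    case (less y)
    show ?case
    proof
      assume eq: "forces_eq P q (?v z) (?v y)"
      have "forces_mem P q (?v y) (?v z)"
        by (rule forces_memI[of "(?v y, one)"]) (use less in \<open>auto simp: name_elems_check_name el\<close>)
      then have "forces_mem P q (?v y) (?v y)" using eq forces_eq_refl forces_mem_cong by blast
      then obtain s v where s: "s \<in> P" "s \<le> q" "v \<in> name_elems (?v y)" "forces_eq P s (?v y) (fst v)"
        using forces_memE less by metis
      then obtain u where u: "u \<in> underS r y" "forces_eq P s (?v y) (?v u)"
        by (auto simp: name_elems_check_name el)
      have "(u, y) \<in> r - Id" using u by (auto simp: underS_def)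
      from less(1)[OF this u(1) s(1)] u show False by blast
    qed
  qed
  have "x = x' \<or> x \<in> underS r x' \<or> x' \<in> underS r x"
    using x wo unfolding well_order_on_def linear_order_on_def total_on_def underS_def by auto
  then show ?thesis using main p eq forces_eq_sym by blast
qed

end

section \<open>Cardinals\<close>

lemma ordLeq_not_ordLess: "\<not> |A| <o |B| \<longleftrightarrow> |B| \<le>o |A|"
  by (simp add: not_ordLess_iff_ordLeq card_of_Well_order)

lemma card_of_UN_le:
  assumes "infinite B" "|A| \<le>o |B|" "\<And>a. a \<in> A \<Longrightarrow> |F a| \<le>o |B|"
  shows "|\<Union>a\<in>A. F a| \<le>o |B|"
  using assms by (intro card_of_UNION_ordLeq_infinite) auto

section \<open>Cardinal arithmetic below the singular cardinal \<kappa>\<close>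

locale singular_card =
  fixes \<kappa> :: "nat \<Rightarrow> 'k::wellorder"
  assumes card_whole: "Card_order (whole_ord :: 'k rel)"
    and mono_\<kappa>: "strict_mono \<kappa>"
    and card_\<kappa>: "\<And>n. Card_order (seg_ord (\<kappa> n)) \<and> regularCard (seg_ord (\<kappa> n))"
    and unctbl_\<kappa>: "\<And>n. natLeq <o seg_ord (\<kappa> n)"
    and cofinal_\<kappa>: "\<And>\<alpha>. \<exists>n. \<alpha> < \<kappa> n"
    and pow_lt: "\<And>\<mu> :: 'k. Card_order (seg_ord \<mu>) \<Longrightarrow> seg_ord \<mu> ^c natLeq <o (whole_ord :: 'k rel)"
begin

text \<open>The cardinal \<open>\<kappa> n\<close> as a set of ordinals, so that all comparisons are
  between cardinalities of sets; size below \<kappa> becomes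
  \<open>|X| <o |UNIV :: 'k set|\<close>.\<close>

definition K :: "nat \<Rightarrow> 'k set" where "K n = {..<\<kappa> n}"

lemma seg_K: "seg_ord (\<kappa> n) =o |K n|"
  using card_of_Field_ordIso[of "seg_ord (\<kappa> n)"] card_\<kappa>[of n] by (simp add: K_def ordIso_symmetric)

lemma whole_UNIV: "(whole_ord :: 'k rel) =o |UNIV :: 'k set|"
  using card_of_Field_ordIso[OF card_whole] by (simp add: ordIso_symmetric)

lemma natLeq_K: "|UNIV :: nat set| <o |K n|"
  using ordLess_ordIso_trans[OF ordIso_ordLess_trans[OF card_of_nat unctbl_\<kappa>[of n]] seg_K[of n]] .

lemma infinite_K [simp]: "infinite (K n)"
proof -
  have "|UNIV :: nat set| \<le>o |K n|" by (rule ordLess_imp_ordLeq[OF natLeq_K])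
  then show ?thesis by (rule card_of_ordLeq_infinite) simp
qed

lemma infinite_UNIV_k [simp]: "infinite (UNIV :: 'k set)"
  by (rule infinite_super[OF subset_UNIV infinite_K])

lemma stable_K: "stable |K n|"
proof -
  have "infinite (Field (seg_ord (\<kappa> n)))"
    using infinite_K[of n] by (simp add: K_def)
  then have "stable (seg_ord (\<kappa> n))"
    using regularCard_stable[of "seg_ord (\<kappa> n)"] card_\<kappa>[of n] by blast
  then show ?thesis by (rule stable_ordIso1[OF _ ordIso_symmetric[OF seg_K]])
qed

lemma UN_lt_K:
  assumes "|A| <o |K n|" "\<And>a. a \<in> A \<Longrightarrow> |F a| <o |K n|"
  shows "|\<Union>a\<in>A. F a| <o |K n|"
  using stable_UNION[OF stable_K, of A n F] assms by blast

lemma K_lt: "m < n \<Longrightarrow> |K m| <o |K n|"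
proof -
  assume "m < n"
  then have lt: "\<kappa> m < \<kappa> n" using mono_\<kappa> by (simp add: strict_mono_def)
  have "underS (seg_ord (\<kappa> n)) (\<kappa> m) = K m"
    using lt by (auto simp: underS_def seg_ord_def K_def)
  moreover have "|underS (seg_ord (\<kappa> n)) (\<kappa> m)| <o seg_ord (\<kappa> n)"
    by (rule card_of_underS) (use card_\<kappa>[of n] lt in auto)
  ultimately show ?thesis using seg_K[of n] ordLess_ordIso_trans by fastforce
qed

lemma K_le: "m \<le> n \<Longrightarrow> |K m| \<le>o |K n|"
  using K_lt[of m n] by (cases "m = n") (auto intro: ordLess_imp_ordLeq card_of_mono1)

lemma K_subset_UNIV: "|K n| <o |UNIV :: 'k set|"
  using K_lt[of n "Suc n"] card_of_mono1[of "K (Suc n)" UNIV] by (meson lessI ordLess_ordLeq_trans subset_UNIV)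

text \<open>A set of size below \<kappa> is equipotent to a proper initial segment, and the
  \<open>\<kappa> n\<close> are cofinal. This turns every smallness hypothesis into a stage
  \<open>n\<close> from which on there is enough room.\<close>

lemma small_iff: "|X| <o |UNIV :: 'k set| \<longleftrightarrow> (\<exists>n. |X| \<le>o |K n| )"
proof
  assume "|X| <o |UNIV :: 'k set|"
  then have "|X| <o (whole_ord :: 'k rel)" using whole_UNIV by (meson ordIso_symmetric ordLess_ordIso_trans)
  moreover have "Well_order (whole_ord :: 'k rel)" by (rule Well_order_whole_ord)
  ultimately obtain a where a: "|X| =o Restr (whole_ord :: 'k rel) (underS whole_ord a)"
    using ordLess_iff_ordIso_Restr[of whole_ord "|X|"] card_of_Well_order[of X] by blast
  have us: "underS whole_ord a = {..<a}" by (auto simp: underS_def whole_ord_def)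
  have "|X| \<le>o |{..<a}|"
  proof -
    obtain f where "iso |X| (Restr (whole_ord :: 'k rel) (underS whole_ord a)) f"
      using a unfolding ordIso_def by blast
    then have "bij_betw f X (Field (Restr (whole_ord :: 'k rel) (underS whole_ord a)))"
      by (simp add: iso_def Field_card_of)
    moreover have "Field (Restr (whole_ord :: 'k rel) (underS whole_ord a)) \<subseteq> {..<a}"
      unfolding us by (auto simp: Field_def)
    ultimately show ?thesis
      by (intro card_of_ordLeq[THEN iffD1] exI[of _ f]) (auto simp: bij_betw_def)
  qed
  moreover obtain n where "a < \<kappa> n" using cofinal_\<kappa> by blast
  then have "|{..<a}| \<le>o |K n|" unfolding K_def by (intro card_of_mono1) auto
  ultimately show "\<exists>n. |X| \<le>o |K n|" using ordLeq_transitive by blast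
next
  assume "\<exists>n. |X| \<le>o |K n|"
  then show "|X| <o |UNIV :: 'k set|" using K_subset_UNIV ordLeq_ordLess_trans by blast
qed

lemma UN_K: "(\<Union>n. K n) = UNIV"
  using cofinal_\<kappa> by (auto simp: K_def)

lemma UN_le_k:
  assumes "|A| \<le>o |UNIV :: 'k set|" "\<And>a. a \<in> A \<Longrightarrow> |F a| \<le>o |UNIV :: 'k set|"
  shows "|\<Union>a\<in>A. F a| \<le>o |UNIV :: 'k set|"
  by (rule card_of_UN_le) (use assms in auto)

text \<open>The assumption on \<mu>^\<omega> enters here, applied to some \<open>\<kappa> n\<close>
  above the size of \<open>X\<close>.\<close>

lemma Func_lt:
  assumes "|X| <o |UNIV :: 'k set|"
  shows "|Func (UNIV :: nat set) X| <o |UNIV :: 'k set|"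
proof -
  obtain n where n: "|X| \<le>o |K n|" using assms small_iff by blast
  obtain f where f: "inj_on f X" "f ` X \<subseteq> K n"
    using n card_of_ordLeq[of X "K n"] by auto
  have "|Func (UNIV :: nat set) X| \<le>o |Func (UNIV :: nat set) (K n)|"
    unfolding card_of_ordLeq[symmetric]
  proof (intro exI conjI)
    show "inj_on (\<lambda>g. f \<circ> g) (Func UNIV X)"
      using f(1) unfolding inj_on_def Func_def by (auto simp: fun_eq_iff)
    show "(\<lambda>g. f \<circ> g) ` Func UNIV X \<subseteq> Func UNIV (K n)"
      using f(2) by (auto simp: Func_def)
  qed
  moreover have "|Func (UNIV :: nat set) (K n)| \<le>o seg_ord (\<kappa> n) ^c natLeq"
    unfolding cexp_def Field_natLeq K_def Field_seg_ord by (rule card_of_mono1) simp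
  moreover have "seg_ord (\<kappa> n) ^c natLeq <o |UNIV :: 'k set|"
    using pow_lt card_\<kappa> whole_UNIV ordLess_ordIso_trans by blast
  ultimately show ?thesis
    by (meson ordLeq_ordLess_trans)
qed

lemma seqs_small_fun:
  assumes "|X| <o |UNIV :: 'k set|"
  shows "|{g :: nat \<Rightarrow> 'a. range g \<subseteq> X}| <o |UNIV :: 'k set|"
proof -
  have "{g :: nat \<Rightarrow> 'a. range g \<subseteq> X} = Func UNIV X" by (auto simp: Func_def)
  then show ?thesis using Func_lt[OF assms] by simp
qed

text \<open>This is where the countable cofinality of \<open>\<kappa>\<close> enters.\<close>

lemma small_UNION_K:
  assumes "|X| \<le>o |UNIV :: 'k set|"
  obtains F where "X = (\<Union>n. F n)" "\<And>n. |F n| \<le>o |K n|" "\<And>m n. m \<le> n \<Longrightarrow> F m \<subseteq> F n"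
proof -
  obtain f :: "_ \<Rightarrow> 'k" where f: "inj_on f X" using assms card_of_ordLeq[of X UNIV] by auto
  define F where "F n = {x \<in> X. f x \<in> K n}" for n
  have "X = (\<Union>n. F n)" using UN_K by (auto simp: F_def)
  moreover have "|F n| \<le>o |K n|" for n
    using card_of_ordLeq[of "F n" "K n"] inj_on_subset[OF f, of "F n"] by (auto simp: F_def)
  moreover have "F m \<subseteq> F n" if "m \<le> n" for m n
    using that mono_\<kappa> by (auto simp: F_def K_def strict_mono_less_eq intro: less_le_trans)
  ultimately show ?thesis using that by blast
qed

end

section \<open>Perfect trees and fusion\<close>

context singular_card
begin

definition sc :: "'k list set \<Rightarrow> 'k list \<Rightarrow> 'k set" where
  "sc T t = {a. t @ [a] \<in> T}"

abbreviation PT :: "'k list set set" where "PT \<equiv> perfect_trees \<kappa>"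

lemma seg_le_succs: "seg_ord (\<kappa> n) \<le>o |succs T t| \<longleftrightarrow> |K n| \<le>o |sc T t|"
proof -
  have "bij_betw (\<lambda>a. t @ [a]) (sc T t) (succs T t)"
    by (auto simp: bij_betw_def inj_on_def sc_def succs_def)
  then have "|sc T t| =o |succs T t|" using card_of_ordIso by blast
  then show ?thesis
    using seg_K[of n] by (meson ordIso_ordLeq_trans ordIso_symmetric ordLeq_ordIso_trans)
qed

lemma PT_tree: "T \<in> PT \<Longrightarrow> is_tree \<kappa> T"
  by (simp add: perfect_trees_def)

lemma PT_prefix: "T \<in> PT \<Longrightarrow> t \<in> T \<Longrightarrow> prefix s t \<Longrightarrow> s \<in> T"
  by (auto simp: perfect_trees_def is_tree_def)

lemma PT_ne: "T \<in> PT \<Longrightarrow> T \<noteq> {}"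
  by (simp add: perfect_trees_def)

lemma PT_Nil: "T \<in> PT \<Longrightarrow> [] \<in> T"
  using PT_ne PT_prefix[of T _ "[]"] by auto

lemma PT_big: "T \<in> PT \<Longrightarrow> t \<in> T \<Longrightarrow> \<exists>t'\<in>T. prefix t t' \<and> |K n| \<le>o |sc T t'|"
  by (auto simp: perfect_trees_def seg_le_succs)

lemma PT_succ: assumes "T \<in> PT" "t \<in> T" shows "sc T t \<noteq> {}"
proof -
  from assms obtain f where f: "f \<in> branches \<kappa> T" "restr f (length t) = t"
    unfolding perfect_trees_def by blast
  then have "restr f (Suc (length t)) \<in> T" by (auto simp: branches_def)
  then have "t @ [f (length t)] \<in> T" using f(2) by (simp add: restr_def)
  then show ?thesis by (auto simp: sc_def)
qed

text \<open>Branches need not be exhibited: trees here have height \<omega>, so where every node has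
  a successor, iterated choice of successors gives a branch through any node.\<close>

lemma PT_I:
  assumes tree: "is_tree \<kappa> T" and ne: "T \<noteq> {}"
    and suc: "\<And>t. t \<in> T \<Longrightarrow> sc T t \<noteq> {}"
    and big: "\<And>n t. t \<in> T \<Longrightarrow> \<exists>t'\<in>T. prefix t t' \<and> |K n| \<le>o |sc T t'|"
  shows "T \<in> PT"
proof -
  have "\<exists>f \<in> branches \<kappa> T. restr f (length t) = t" if t: "t \<in> T" for t
  proof -
    define N where "N = rec_nat t (\<lambda>_ s. s @ [SOME a. a \<in> sc T s])"
    have N0: "N 0 = t" and NS: "N (Suc n) = N n @ [SOME a. a \<in> sc T (N n)]" for n
      by (simp_all add: N_def)
    have NT: "N n \<in> T" for n
    proof (induction n)
      case (Suc n)
      then have "(SOME a. a \<in> sc T (N n)) \<in> sc T (N n)" using suc by (simp add: some_in_eq)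
      then show ?case by (simp add: NS sc_def)
    qed (simp add: N0 t)
    have len: "length (N n) = length t + n" for n by (induction n) (auto simp: N0 NS)
    have pre: "prefix (N m) (N (m + k))" for m k
      by (induction k) (auto simp: NS intro: prefix_order.trans)
    define f where "f i = N (Suc i) ! i" for i
    have fN: "f i = N n ! i" if "i < length (N n)" for i n
    proof -
      have "prefix (N n) (N (n + Suc i))" "prefix (N (Suc i)) (N (Suc i + n))" by (rule pre)+
      then have "N (n + Suc i) ! i = N n ! i" "N (Suc i + n) ! i = N (Suc i) ! i"
        using that len[of "Suc i"] by (auto simp: prefix_def nth_append)
      then show ?thesis by (simp add: f_def add.commute)
    qed
    have "restr f n = take n (N n)" for n
      by (rule nth_equalityI) (auto simp: restr_def len fN)
    moreover have "take n (N n) \<in> T" for n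
      using NT tree by (meson is_tree_def take_is_prefix)
    ultimately have r: "restr f n \<in> T" for n by simp
    have "f i < \<kappa> i" for i
      using NT[of "Suc i"] tree len[of "Suc i"] by (auto simp: is_tree_def seqs_def f_def)
    moreover have "restr f (length t) = t"
      by (rule nth_equalityI) (auto simp: restr_def fN[of _ 0] N0)
    ultimately show ?thesis using r by (auto simp: branches_def inf_seqs_def)
  qed
  then show ?thesis
    using assms by (auto simp: perfect_trees_def seg_le_succs)
qed

lemma sc_mono: "S \<subseteq> T \<Longrightarrow> sc S t \<subseteq> sc T t"
  by (auto simp: sc_def)

lemma PT_long:
  assumes "T \<in> PT" "t \<in> T"
  obtains s where "s \<in> T" "prefix t s" "length s = length t + n"
proof -
  have "\<exists>s\<in>T. prefix t s \<and> length s = length t + n"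
  proof (induction n)
    case (Suc n)
    then obtain s a where "s \<in> T" "prefix t s" "length s = length t + n" "a \<in> sc T s"
      using PT_succ assms by blast
    then show ?case by (intro bexI[of _ "s @ [a]"]) (auto simp: sc_def)
  qed (use assms in auto)
  then show ?thesis using that by blast
qed

lemma one_PT: "seqs \<kappa> \<in> PT"
proof (rule PT_I)
  show "is_tree \<kappa> (seqs \<kappa>)"
    by (auto simp: is_tree_def seqs_def prefix_def nth_append split: if_splits)
  show "seqs \<kappa> \<noteq> {}" by (auto simp: seqs_def intro: exI[of _ "[]"])
  have sc: "sc (seqs \<kappa>) t = K (length t)" if "t \<in> seqs \<kappa>" for t
    using that by (auto simp: sc_def seqs_def K_def nth_append less_Suc_eq)
  show "sc (seqs \<kappa>) t \<noteq> {}" if "t \<in> seqs \<kappa>" for t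
    using sc[OF that] infinite_imp_nonempty[OF infinite_K] by simp
  show "\<exists>t'\<in>seqs \<kappa>. prefix t t' \<and> |K n| \<le>o |sc (seqs \<kappa>) t'|" if "t \<in> seqs \<kappa>" for n t
  proof -
    have "\<exists>s\<in>seqs \<kappa>. prefix t s \<and> length s = length t + n"
    proof (induction n)
      case (Suc n)
      then obtain s a where "s \<in> seqs \<kappa>" "prefix t s" "length s = length t + n" "a \<in> sc (seqs \<kappa>) s"
        using sc infinite_K by (metis equals0I finite.emptyI)
      then show ?case by (intro bexI[of _ "s @ [a]"]) (auto simp: sc_def)
    qed (use that in auto)
    then obtain s where s: "s \<in> seqs \<kappa>" "prefix t s" "length s = length t + n" by blast
    moreover have "|K n| \<le>o |sc (seqs \<kappa>) s|" using s sc K_le by simp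
    ultimately show ?thesis by blast
  qed
qed

lemma PT_subset_one: "T \<in> PT \<Longrightarrow> T \<subseteq> seqs \<kappa>"
  by (simp add: perfect_trees_def is_tree_def)

definition tr :: "'k list set \<Rightarrow> 'k list \<Rightarrow> 'k list set" where
  "tr T t = {s \<in> T. prefix s t \<or> prefix t s}"

lemma tr_subset: "tr T t \<subseteq> T" by (auto simp: tr_def)

lemma tr_mono: "S \<subseteq> T \<Longrightarrow> tr S t \<subseteq> tr T t" by (auto simp: tr_def)

lemma sc_tr_above: "prefix t s \<Longrightarrow> sc (tr T t) s = sc T s"
  by (auto simp: sc_def tr_def)

lemma tr_PT:
  assumes T: "T \<in> PT" and t: "t \<in> T"
  shows "tr T t \<in> PT"
proof (rule PT_I)
  show "is_tree \<kappa> (tr T t)"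
    using PT_tree[OF T] unfolding is_tree_def tr_def
    by (auto dest: prefix_same_cases intro: prefix_order.trans)
  show "tr T t \<noteq> {}" using t by (auto simp: tr_def)
  have up: "\<exists>s'\<in>tr T t. prefix s s' \<and> prefix t s'" if "s \<in> tr T t" for s
    using that t by (auto simp: tr_def)
  show "sc (tr T t) s \<noteq> {}" if s: "s \<in> tr T t" for s
  proof (cases "prefix t s")
    case True
    then show ?thesis using s PT_succ[OF T, of s] by (simp add: sc_tr_above) (auto simp: tr_def)
  next
    case False
    with s have "strict_prefix s t" by (auto simp: tr_def strict_prefix_def)
    then obtain a u where "t = s @ a # u" by (auto simp: strict_prefix_def prefix_def) (metis neq_Nil_conv)
    then have "prefix (s @ [a]) t" by (simp add: prefix_def)
    then show ?thesis using PT_prefix[OF T t] by (auto simp: sc_def tr_def)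
  qed
  show "\<exists>t'\<in>tr T t. prefix s t' \<and> |K n| \<le>o |sc (tr T t) t'|" if s: "s \<in> tr T t" for n s
  proof -
    obtain s' where s': "s' \<in> tr T t" "prefix s s'" "prefix t s'" using up[OF s] by blast
    then obtain u where u: "u \<in> T" "prefix s' u" "|K n| \<le>o |sc T u|"
      using PT_big[OF T] by (auto simp: tr_def) 
    then have "prefix t u" using s' prefix_order.trans by blast
    then show ?thesis using u s' prefix_order.trans sc_tr_above by (intro bexI[of _ u]) (auto simp: tr_def)
  qed
qed

definition stemmed :: "nat \<Rightarrow> 'k list set \<Rightarrow> 'k list \<Rightarrow> bool" where
  "stemmed n T t \<longleftrightarrow> T \<in> PT \<and> t \<in> T \<and> (\<forall>s\<in>T. prefix s t \<or> prefix t s) \<and> |K n| \<le>o |sc T t|"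

lemma stemmed_ex:
  assumes "T \<in> PT" "t \<in> T"
  obtains S s where "stemmed n S s" "S \<subseteq> tr T t" "prefix t s"
proof -
  obtain s where s: "s \<in> T" "prefix t s" "|K n| \<le>o |sc T s|" using PT_big[OF assms] by blast
  have "stemmed n (tr T s) s"
    unfolding stemmed_def using tr_PT[OF assms(1) s(1)] s by (auto simp: tr_def sc_def)
  moreover have "tr T s \<subseteq> tr T t" using s(2) by (auto simp: tr_def dest: prefix_order.trans prefix_same_cases)
  ultimately show ?thesis using that s by blast
qed

text \<open>One set of splitting levels for the whole tree. It lets other trees be compared with
  \<open>T\<close> level by level, and it ties a condition to a subset of \<omega>.\<close>

definition uniform :: "'k list set \<Rightarrow> (nat \<Rightarrow> nat) \<Rightarrow> bool" where
  "uniform T l \<longleftrightarrow> strict_mono l \<and> (\<forall>t\<in>T. (\<forall>n. length t = l n \<longrightarrow> |K n| \<le>o |sc T t| ) \<and>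
     (length t \<notin> range l \<longrightarrow> (\<exists>a. sc T t = {a})))"

end

text \<open>Positions of a fusion are addressed by the list of the choices made so far, the latest one first.\<close>

locale fusion = singular_card \<kappa> for \<kappa> :: "nat \<Rightarrow> 'k::wellorder" +
  fixes T0 :: "'k list set" and tree :: "'k list \<Rightarrow> 'k list set" and stem :: "'k list \<Rightarrow> 'k list"
    and A :: "'k list \<Rightarrow> 'k set" and valid :: "'k list \<Rightarrow> bool" and l :: "nat \<Rightarrow> nat" and c :: nat
  assumes valid_Nil: "valid []" and valid_Cons: "\<And>a r. valid (a # r) \<longleftrightarrow> valid r \<and> a \<in> A r"
    and tree_Nil: "tree [] \<subseteq> T0"
    and st: "\<And>r. valid r \<Longrightarrow> stemmed (c + length r) (tree r) (stem r)"
    and A_big: "\<And>r. valid r \<Longrightarrow> |K (c + length r)| \<le>o |A r|"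
    and tree_Cons: "\<And>a r. valid (a # r) \<Longrightarrow> tree (a # r) \<subseteq> tr (tree r) (stem r @ [a])"
    and stem_Cons: "\<And>a r. valid (a # r) \<Longrightarrow> prefix (stem r @ [a]) (stem (a # r))"
    and len: "\<And>r. valid r \<Longrightarrow> length (stem r) = l (length r)"
begin

definition fused :: "'k list set" where
  "fused = {s. \<exists>r. valid r \<and> prefix s (stem r)}"

lemma A_ne: "valid r \<Longrightarrow> A r \<noteq> {}"
  using A_big[of r] infinite_K[of "c + length r"] card_of_ordLeq_finite by fastforce

lemma valid_ex: "valid r \<Longrightarrow> \<exists>u. valid (u @ r) \<and> length u = n"
proof (induction n)
  case (Suc n)
  then obtain u where u: "valid (u @ r)" "length u = n" by blast
  then obtain a where "a \<in> A (u @ r)" using A_ne by blast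
  then show ?case using u by (intro exI[of _ "a # u"]) (auto simp: valid_Cons)
qed auto

lemma valid_append: "valid (u @ r) \<Longrightarrow> valid r"
  by (induction u) (auto simp: valid_Cons)

lemma len_strict: "strict_mono l"
proof (rule strict_mono_Suc_iff[THEN iffD2], rule allI)
  fix n
  obtain u where u: "valid u" "length u = n" using valid_ex[OF valid_Nil, of n] by auto
  then obtain a where "a \<in> A u" using A_ne by blast
  then have v: "valid (a # u)" using u by (simp add: valid_Cons)
  have "length (stem u @ [a]) \<le> length (stem (a # u))" by (rule prefix_length_le[OF stem_Cons[OF v]])
  then show "l n < l (Suc n)" using len u v by fastforce
qed

lemma len_less: "m < n \<Longrightarrow> l m < l n"
  using len_strict by (simp add: strict_mono_less)

lemma stem_append: "valid (u @ r) \<Longrightarrow> prefix (stem r) (stem (u @ r))"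
proof (induction u)
  case (Cons a u)
  then show ?case using stem_Cons[of a "u @ r"] valid_Cons
    by (auto intro: prefix_order.trans append_prefixD)
qed simp

lemma tree_append: "valid (u @ r) \<Longrightarrow> tree (u @ r) \<subseteq> tree r"
proof (induction u)
  case (Cons a u)
  then show ?case using tree_Cons[of a "u @ r"] valid_Cons tr_subset by fastforce
qed simp

lemma split_valid:
  assumes "valid r" "n \<le> length r"
  obtains u r' where "r = u @ r'" "length r' = n" "valid r'"
proof -
  have "r = take (length r - n) r @ drop (length r - n) r" by simp
  moreover have "length (drop (length r - n) r) = n" using assms by simp
  ultimately show ?thesis using that valid_append assms(1) by metis
qed

lemma prefix_eq: "prefix a s \<Longrightarrow> prefix b s \<Longrightarrow> length a = length b \<Longrightarrow> a = b"
  by (auto simp: prefix_def)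

lemma fused_level:
  assumes "s \<in> fused" "length s \<le> l n"
  obtains r where "valid r" "length r = n" "prefix s (stem r)"
proof -
  obtain r where r: "valid r" "prefix s (stem r)" using assms by (auto simp: fused_def)
  obtain u where u: "valid (u @ r)" "length u = n" using valid_ex[OF r(1)] by blast
  obtain v w where vw: "u @ r = v @ w" "length w = n" "valid w"
    using split_valid[OF u(1), of n] u by auto
  have "prefix s (stem (u @ r))" using r stem_append[OF u(1)] prefix_order.trans by blast
  moreover have "prefix (stem w) (stem (u @ r))" using stem_append[of v w] u vw by simp
  ultimately have "prefix s (stem w)"
    using len[OF vw(3)] vw assms by (metis prefix_length_prefix)
  then show ?thesis using that vw by blast
qed

lemma stem_inj: "valid r \<Longrightarrow> valid r' \<Longrightarrow> length r = length r' \<Longrightarrow> stem r = stem r' \<Longrightarrow> r = r'"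
proof (induction r arbitrary: r')
  case (Cons a r)
  then obtain b r1 where r': "r' = b # r1" by (cases r') auto
  have v: "valid r" "valid r1" using Cons r' by (auto simp: valid_Cons)
  have "stem r @ [a] = stem r1 @ [b]"
    using stem_Cons[of a r] stem_Cons[of b r1] Cons.prems r' len[OF v(1)] len[OF v(2)]
    by (intro prefix_eq[of _ "stem (a # r)"]) auto
  then show ?case using Cons.IH[of r1] Cons.prems r' v by simp
qed simp

lemma stem_in: "valid r \<Longrightarrow> stem r \<in> fused" by (auto simp: fused_def)

lemma stem_iff: "s \<in> fused \<Longrightarrow> length s = l n \<Longrightarrow> \<exists>r. valid r \<and> length r = n \<and> s = stem r"
  by (metis fused_level len order_refl prefix_eq prefix_order.refl)

lemma sc_stem:
  assumes r: "valid r"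
  shows "sc fused (stem r) = A r"
proof (intro set_eqI iffI)
  fix a assume "a \<in> A r"
  then have "valid (a # r)" using r by (simp add: valid_Cons)
  then show "a \<in> sc fused (stem r)" using stem_Cons by (auto simp: fused_def sc_def)
next
  fix a assume "a \<in> sc fused (stem r)"
  then have s: "stem r @ [a] \<in> fused" by (simp add: sc_def)
  have "length (stem r @ [a]) \<le> l (Suc (length r))" using len[OF r] len_less[of "length r" "Suc (length r)"] by simp
  from fused_level[OF s this] obtain r1 where r1: "valid r1" "length r1 = Suc (length r)" "prefix (stem r @ [a]) (stem r1)" .
  then obtain b r2 where r2: "r1 = b # r2" by (cases r1) auto
  then have v: "valid r2" "b \<in> A r2" using r1 by (auto simp: valid_Cons)
  have "stem r @ [a] = stem r2 @ [b]"
    using r1 r2 stem_Cons[of b r2] len[OF r] len[OF v(1)] by (intro prefix_eq[of _ "stem r1"]) auto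
  moreover from this have "r = r2" using stem_inj[OF r v(1)] r1 r2 by simp
  ultimately show "a \<in> A r" using v by simp
qed

lemma sc_single:
  assumes s: "s \<in> fused" and nl: "length s \<notin> range l"
  shows "\<exists>a. sc fused s = {a}"
proof -
  define m where "m = (LEAST n. length s < l n)"
  have "length s < l (Suc (length s))"
    using strict_mono_imp_increasing[OF len_strict, of "Suc (length s)"] by simp
  then have m: "length s < l m" unfolding m_def by (rule LeastI)
  \<comment> \<open>\<open>s\<close> is longer than the stems of the previous stage, so it already
    contains the choice made there; two positions of length \<open>m\<close> above \<open>s\<close>
    therefore agree.\<close>
  have uniq: "r = r'"
    if st: "valid r" "valid r'" "length r = m" "length r' = m" "prefix s (stem r)" "prefix s (stem r')"
    for r r'
  proof (cases m)
    case 0 then show ?thesis using st by simp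
  next
    case (Suc k)
    then have "\<not> length s < l k" unfolding m_def using not_less_Least[of k] m_def by (metis lessI)
    then have lk: "l k < length s" using nl by (metis linorder_neqE_nat rangeI)
    obtain a q where q: "r = a # q" using st Suc by (cases r) auto
    obtain a' q' where q': "r' = a' # q'" using st Suc by (cases r') auto
    have v: "valid q" "valid q'" using st q q' by (auto simp: valid_Cons)
    have "prefix (stem q @ [a]) s" "prefix (stem q' @ [a']) s"
      using stem_Cons[of a q] stem_Cons[of a' q'] st q q' lk Suc len[OF v(1)] len[OF v(2)]
      by (auto intro: prefix_length_prefix)
    then have "stem q @ [a] = stem q' @ [a']"
      using len[OF v(1)] len[OF v(2)] q q' st Suc by (intro prefix_eq) auto
    then show ?thesis using st q q' v Suc by (auto intro: stem_inj)
  qed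
  obtain r where r: "valid r" "length r = m" "prefix s (stem r)"
    using fused_level[OF s] m by (metis less_imp_le)
  have "length s < length (stem r)" using len[OF r(1)] r m by simp
  then obtain a where a: "prefix (s @ [a]) (stem r)"
    using r(3) by (auto simp: prefix_def) (metis append_Nil2 neq_Nil_conv nat_neq_iff)
  have "b = a" if b: "b \<in> sc fused s" for b
  proof -
    have "s @ [b] \<in> fused" "length (s @ [b]) \<le> l m" using b m by (auto simp: sc_def)
    from fused_level[OF this] obtain r1 where r1: "valid r1" "length r1 = m" "prefix (s @ [b]) (stem r1)" .
    then have "prefix s (stem r1)" by (meson append_prefixD)
    then have "r = r1" using uniq[OF r(1) r1(1) r(2) r1(2) r(3)] by simp
    then have "s @ [a] = s @ [b]" using a r1 by (intro prefix_eq[of _ "stem r"]) auto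
    then show ?thesis by simp
  qed
  moreover have "a \<in> sc fused s" using a r by (auto simp: sc_def fused_def)
  ultimately show ?thesis by blast
qed

lemma fused_uniform: "uniform fused l"
  unfolding uniform_def
proof (intro conjI ballI allI impI)
  fix t n assume t: "t \<in> fused" "length t = l n"
  then obtain r where r: "valid r" "length r = n" "t = stem r" using stem_iff by blast
  show "|K n| \<le>o |sc fused t|"
    using A_big[OF r(1)] r sc_stem[OF r(1)] K_le[of n "c + n"] ordLeq_transitive by fastforce
qed (use sc_single len_strict in auto)

text \<open>A node of the fusion above \<open>stem r\<close> lies below the stem of a longer
  position extending \<open>r\<close>; that stem belongs to its own tree, and the trees shrink along
  a position.\<close>

lemma fused_capture:
  assumes "valid r"
  shows "tr fused (stem r) \<subseteq> tree r"
proof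
  fix s assume "s \<in> tr fused (stem r)"
  then have s: "s \<in> fused" "prefix s (stem r) \<or> prefix (stem r) s" by (auto simp: tr_def)
  have T: "tree q \<in> PT" "stem q \<in> tree q" if "valid q" for q using st[OF that] by (auto simp: stemmed_def)
  show "s \<in> tree r"
  proof (cases "prefix s (stem r)")
    case True
    then show ?thesis using T[OF assms] PT_prefix by blast
  next
    case False
    then have ps: "prefix (stem r) s" using s by blast
    define n where "n = max (length r) (length s)"
    have "length s \<le> l n"
      using strict_mono_imp_increasing[OF len_strict, of n] unfolding n_def by linarith
    from fused_level[OF s(1) this] obtain q where q: "valid q" "length q = n" "prefix s (stem q)" .
    obtain u q' where u: "q = u @ q'" "length q' = length r" "valid q'"
      using split_valid[OF q(1), of "length r"] q by (auto simp: n_def)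
    have "prefix (stem q') (stem q)" using stem_append u q by simp
    moreover have "prefix (stem r) (stem q)" using ps q prefix_order.trans by blast
    ultimately have "stem q' = stem r" using len[OF u(3)] len[OF assms] u by (intro prefix_eq[of _ "stem q"]) auto
    then have "q' = r" using stem_inj[OF u(3) assms] u by simp
    then have "stem q \<in> tree r" using T[OF q(1)] tree_append[of u r] u q by auto
    then show ?thesis using PT_prefix T[OF assms] q by blast
  qed
qed

lemma fused_PT: "fused \<in> PT"
proof (rule PT_I)
  have "tree r \<in> PT" "stem r \<in> tree r" if "valid r" for r using st[OF that] by (auto simp: stemmed_def)
  then show "is_tree \<kappa> fused"
    using PT_prefix PT_subset_one unfolding is_tree_def fused_def by (blast intro: prefix_order.trans)
  show "fused \<noteq> {}" using stem_in[OF valid_Nil] by blast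
  show "sc fused t \<noteq> {}" if "t \<in> fused" for t
  proof (cases "length t \<in> range l")
    case True
    then obtain r where "valid r" "t = stem r" using stem_iff[OF \<open>t \<in> fused\<close>] by blast
    then show ?thesis using sc_stem A_ne by simp
  next
    case False then show ?thesis using sc_single[OF that] by auto
  qed
  show "\<exists>t'\<in>fused. prefix t t' \<and> |K n| \<le>o |sc fused t'|" if "t \<in> fused" for n t
  proof -
    obtain r where r: "valid r" "prefix t (stem r)" using \<open>t \<in> fused\<close> by (auto simp: fused_def)
    obtain u where u: "valid (u @ r)" "length u = n" using valid_ex[OF r(1)] by blast
    have "|K n| \<le>o |A (u @ r)|"
      using A_big[OF u(1)] K_le[of n "c + length (u @ r)"] u ordLeq_transitive by fastforce
    then show ?thesis
      using stem_in[OF u(1)] sc_stem[OF u(1)] r stem_append[OF u(1)] prefix_order.trans by (intro bexI[of _ "stem (u @ r)"]) auto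
  qed
qed

lemma fused_subset: "fused \<subseteq> T0"
proof
  fix s assume s: "s \<in> fused"
  then have "s \<in> tr fused (stem [])"
  proof -
    obtain r where r: "valid r" "prefix s (stem r)" using s by (auto simp: fused_def)
    moreover have "prefix (stem []) (stem r)" using stem_append[of r "[]"] r by simp
    ultimately have "prefix s (stem []) \<or> prefix (stem []) s" using prefix_same_cases by blast
    then show ?thesis using s by (auto simp: tr_def)
  qed
  then show "s \<in> T0" using fused_capture[OF valid_Nil] tree_Nil by blast
qed

text \<open>Whatever was arranged for the trees of stage \<open>n\<close> is thereby predense below
  the fusion: every perfect subtree has a cone inside one of them.\<close>

lemma fused_below:
  assumes S: "S \<in> PT" "S \<subseteq> fused"
  obtains r S' where "valid r" "length r = n" "S' \<in> PT" "S' \<subseteq> S" "S' \<subseteq> tree r"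
proof -
  obtain s where s: "s \<in> S" "length s = l n"
    using PT_long[OF S(1) PT_Nil[OF S(1)], of "l n"] by auto
  then obtain r where r: "valid r" "length r = n" "s = stem r" using stem_iff S(2) by blast
  have "tr S s \<subseteq> tree r" using tr_mono[OF S(2), of s] fused_capture[OF r(1)] r by blast
  then show ?thesis using that r tr_PT[OF S(1) s(1)] tr_subset by blast
qed

end

section \<open>A fusion game\<close>

text \<open>
  In stage \<open>n\<close> player I demands \<open>d \<in> D n\<close> and forbids fewer than \<open>\<kappa>\<^sub>n\<close> successors of the
  current stem; player II moves to an allowed successor and to a smaller stemmed tree on which
  the demand is answered in the colour prescribed by \<open>y n\<close>, with a stem of the prescribed length.
  Since there are few sequences \<open>y\<close>, player I cannot have a winning strategy for all of them:
  II would play against all the strategies at once and read off \<open>y\<close> from the run.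
\<close>

locale fusion_game = singular_card \<kappa> for \<kappa> :: "nat \<Rightarrow> 'k::wellorder" +
  fixes T :: "'k list set" and Q :: "'q set" and D :: "nat \<Rightarrow> 'd set"
    and Resp :: "nat \<Rightarrow> 'q \<Rightarrow> 'd \<Rightarrow> 'k list set \<Rightarrow> bool"
  assumes T_PT: "T \<in> PT"
    and Q_small: "|Q| <o |UNIV :: 'k set|"
    and D_ne: "\<And>n. D n \<noteq> {}"
    and Resp_mono: "\<And>n q d V V'. Resp n q d V \<Longrightarrow> V' \<in> PT \<Longrightarrow> V' \<subseteq> V \<Longrightarrow> Resp n q d V'"
    and directed: "\<And>n q F. q \<in> Q \<Longrightarrow> (\<And>x :: nat \<Rightarrow> 'q \<times> nat. \<forall>n. fst (x n) \<in> Q \<Longrightarrow> F x \<in> D n) \<Longrightarrow>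
      \<exists>d\<in>D n. \<forall>V\<in>PT. V \<subseteq> T \<longrightarrow> Resp n q d V \<longrightarrow> (\<forall>x. (\<forall>n. fst (x n) \<in> Q) \<longrightarrow> Resp n q (F x) V)"
    and progress: "\<And>n V dd. V \<in> PT \<Longrightarrow> V \<subseteq> T \<Longrightarrow> (\<And>q. q \<in> Q \<Longrightarrow> dd q \<in> D n) \<Longrightarrow>
      \<exists>q\<in>Q. \<exists>V'\<in>PT. V' \<subseteq> V \<and> Resp n q (dd q) V'"
begin

definition Xs :: "(nat \<Rightarrow> 'q \<times> nat) set" where "Xs = {x. \<forall>n. fst (x n) \<in> Q}"

lemma Xs_small: "|Xs| <o |UNIV :: 'k set|"
proof -
  have "|Q \<times> (UNIV :: nat set)| <o |UNIV :: 'k set|"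
  proof -
    obtain n where n: "|Q| \<le>o |K n|" using Q_small small_iff by blast
    have "|Q \<times> (UNIV :: nat set)| \<le>o |K n \<times> (UNIV :: nat set)|" by (rule card_of_Times_mono1[OF n])
    also have "|K n \<times> (UNIV :: nat set)| =o |K n|"
      by (rule card_of_Times_infinite[THEN conjunct1]) (auto intro: ordLess_imp_ordLeq[OF natLeq_K])
    finally (ordLeq_ordIso_trans) show ?thesis using K_subset_UNIV ordLeq_ordLess_trans by blast
  qed
  moreover have "Xs = {x. range x \<subseteq> Q \<times> UNIV}" by (simp add: Xs_def image_subset_iff mem_Times_iff)
  ultimately show ?thesis using seqs_small_fun by metis
qed

text \<open>An offset for the stages. With \<open>cc = Suc c\<close> there are fewer than
  \<open>\<kappa> (cc + n)\<close> sequences \<open>y\<close>, and regularity keeps the union of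
  what the strategies for all of them forbid below that cardinal.\<close>

definition c :: nat where "c = (SOME c. |Xs| \<le>o |K c| )"

lemma Xs_K: "|Xs| \<le>o |K c|"
  unfolding c_def using Xs_small small_iff someI_ex[of "\<lambda>c. |Xs| \<le>o |K c|"] by blast

lemma Xs_lt: "|Xs| <o |K (Suc c + n)|"
  using Xs_K K_lt[of c "Suc c + n"] ordLeq_ordLess_trans by force

abbreviation cc :: nat where "cc \<equiv> Suc c"

definition legal :: "(nat \<Rightarrow> 'q \<times> nat) \<Rightarrow> nat \<Rightarrow> 'd \<Rightarrow> 'k set \<Rightarrow> 'k list set \<times> 'k list
    \<Rightarrow> 'k \<times> 'k list set \<times> 'k list \<Rightarrow> bool" where
  "legal y n d E s m \<longleftrightarrow> fst m \<in> sc (fst s) (snd s) - E \<and>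
     fst (snd m) \<subseteq> tr (fst s) (snd s @ [fst m]) \<and> stemmed (cc + Suc n) (fst (snd m)) (snd (snd m)) \<and>
     prefix (snd s @ [fst m]) (snd (snd m)) \<and> length (snd (snd m)) = snd (y n) \<and>
     Resp n (fst (y n)) d (fst (snd m))"

definition position :: "'s \<Rightarrow> (nat \<Rightarrow> 'm \<times> 's) \<Rightarrow> nat \<Rightarrow> 's" where
  "position s m i = (case i of 0 \<Rightarrow> s | Suc j \<Rightarrow> snd (m j))"

text \<open>A strategy of player I sees the moves of II so far. Its replies must obey the rules on
  every list, also on lists that arise in no legal run.\<close>

definition strategy :: "nat \<Rightarrow> ('m list \<Rightarrow> 'd \<times> 'k set) \<Rightarrow> bool" where
  "strategy n \<sigma> \<longleftrightarrow> (\<forall>h. fst (\<sigma> h) \<in> D (n + length h) \<and> |snd (\<sigma> h)| <o |K (cc + n + length h)| )"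

definition defeats :: "(nat \<Rightarrow> 'q \<times> nat) \<Rightarrow> nat \<Rightarrow> 'k list set \<times> 'k list
    \<Rightarrow> (('k \<times> 'k list set \<times> 'k list) list \<Rightarrow> 'd \<times> 'k set) \<Rightarrow> (nat \<Rightarrow> 'k \<times> 'k list set \<times> 'k list) \<Rightarrow> bool" where
  "defeats y n s \<sigma> m \<longleftrightarrow> (\<forall>i. legal y (n + i) (fst (\<sigma> (map m [0..<i]))) (snd (\<sigma> (map m [0..<i]))) (position s m i) (m i))"

definition wins :: "(nat \<Rightarrow> 'q \<times> nat) \<Rightarrow> nat \<Rightarrow> 'k list set \<times> 'k list \<Rightarrow> bool" where
  "wins y n s \<longleftrightarrow> (\<exists>\<sigma>. strategy n \<sigma> \<and> \<not> (\<exists>m. defeats y n s \<sigma> m))"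

definition moves where
  "moves y n d s = {a. \<exists>s'. legal y n d {} s (a, s') \<and> \<not> wins y (Suc n) s'}"

lemma empty_lt: "|{} :: 'k set| <o |K n|"
  by (metis card_of_empty3 infinite_K infinite_imp_nonempty ordLeq_not_ordLess)

text \<open>If only few successors led II to positions not won by I, then I could forbid exactly
  these and continue with a winning strategy for whatever position is reached. No determinacy is
  involved: the fusion only needs that I does not win.\<close>

lemma not_wins_step:
  assumes nw: "\<not> wins y n s" and d: "d \<in> D n"
  shows "|K (cc + n)| \<le>o |moves y n d s|"
proof (rule ccontr)
  let ?E = "moves y n d s"
  assume "\<not> |K (cc + n)| \<le>o |?E|"
  then have E: "|?E| <o |K (cc + n)|" using ordLeq_not_ordLess by blast
  have w: "wins y (Suc n) (snd m)" if "legal y n d ?E s m" for m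
  proof (rule ccontr)
    assume "\<not> wins y (Suc n) (snd m)"
    moreover have "legal y n d {} s (fst m, snd m)" using that by (auto simp: legal_def)
    ultimately have "fst m \<in> ?E" unfolding moves_def by blast
    then show False using that by (auto simp: legal_def)
  qed
  then have "\<exists>\<sigma>. legal y n d ?E s m \<longrightarrow> strategy (Suc n) \<sigma> \<and> \<not> (\<exists>m'. defeats y (Suc n) (snd m) \<sigma> m')" for m
    unfolding wins_def by blast
  then obtain \<Sigma> where \<Sigma>: "legal y n d ?E s m \<Longrightarrow> strategy (Suc n) (\<Sigma> m)"
    "legal y n d ?E s m \<Longrightarrow> \<not> defeats y (Suc n) (snd m) (\<Sigma> m) m'" for m m' by metis
  have "\<forall>k. \<exists>d. d \<in> D k" using D_ne by blast
  then obtain d0 where d0: "d0 k \<in> D k" for k by metis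
  \<comment> \<open>The first reply is the demand \<open>d\<close> with the set \<open>?E\<close>
    forbidden; after a legal move of II the strategy for the new position takes over. After an
    illegal move any demand will do, with nothing forbidden.\<close>
  define \<sigma> where "\<sigma> h = (case h of [] \<Rightarrow> (d, ?E) | m # h' \<Rightarrow>
     if legal y n d ?E s m then \<Sigma> m h' else (d0 (n + length h), {}))" for h
  have "strategy n \<sigma>"
    unfolding strategy_def
  proof
    fix h show "fst (\<sigma> h) \<in> D (n + length h) \<and> |snd (\<sigma> h)| <o |K (cc + n + length h)|"
    proof (cases h)
      case Nil then show ?thesis using d E by (simp add: \<sigma>_def)
    next
      case (Cons m h')
      show ?thesis
      proof (cases "legal y n d ?E s m")
        case True
        then show ?thesis using \<Sigma>(1)[OF True] Cons unfolding strategy_def by (auto simp: \<sigma>_def)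
      next
        case False
        then show ?thesis using d0 Cons empty_lt by (simp add: \<sigma>_def)
      qed
    qed
  qed
  moreover have "\<not> defeats y n s \<sigma> m" for m
  proof
    assume m: "defeats y n s \<sigma> m"
    then have m0: "legal y n d ?E s (m 0)"
      unfolding defeats_def by (auto dest: spec[of _ 0] simp: \<sigma>_def position_def)
    define m' where "m' i = m (Suc i)" for i
    have "legal y (Suc n + i) (fst (\<Sigma> (m 0) (map m' [0..<i]))) (snd (\<Sigma> (m 0) (map m' [0..<i]))) (position (snd (m 0)) m' i) (m' i)" for i
    proof -
      have 1: "map m [0..<Suc i] = m 0 # map m' [0..<i]"
        unfolding m'_def by (rule nth_equalityI) (auto simp: nth_Cons nth_append less_Suc_eq_0_disj split: nat.splits simp del: upt_Suc)
      have 2: "position s m (Suc i) = position (snd (m 0)) m' i"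
        by (auto simp: position_def m'_def split: nat.splits)
      have 3: "\<sigma> (m 0 # map m' [0..<i]) = \<Sigma> (m 0) (map m' [0..<i])" using m0 by (simp add: \<sigma>_def)
      show ?thesis using m[unfolded defeats_def, rule_format, of "Suc i"] unfolding 1 2 3 by (simp add: m'_def)
    qed
    then have "defeats y (Suc n) (snd (m 0)) (\<Sigma> (m 0)) m'" unfolding defeats_def by blast
    then show False using \<Sigma>(2)[OF m0] by blast
  qed
  ultimately show False using nw unfolding wins_def by blast
qed

text \<open>One answer to all strategies at once. The successors they forbid are too few to exhaust
  those of the stem; \<open>directed\<close> merges their demands into one for each colour, and
  \<open>progress\<close> selects the colour \<open>q\<close>. The answer is legal against the
  strategies of all \<open>y\<close> whose entry at \<open>n\<close> is this colour with the length
  of the new stem.\<close>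

lemma Resp_step:
  assumes st: "stemmed (cc + n) V t" and V: "V \<subseteq> T" and len: "length h = n"
    and \<sigma>: "\<And>y. y \<in> Xs \<Longrightarrow> strategy 0 (\<sigma> y)"
  shows "\<exists>q m. q \<in> Q \<and> stemmed (cc + Suc n) (fst (snd m)) (snd (snd m)) \<and> fst (snd m) \<subseteq> T \<and>
    (\<forall>y\<in>Xs. y n = (q, length (snd (snd m))) \<longrightarrow> legal y n (fst (\<sigma> y h)) (snd (\<sigma> y h)) (V, t) m)"
proof -
  have VP: "V \<in> PT" and tV: "t \<in> V" and big: "|K (cc + n)| \<le>o |sc V t|" using st by (auto simp: stemmed_def)
  define E where "E = (\<Union>y\<in>Xs. snd (\<sigma> y h))"
  have "|E| <o |K (cc + n)|"
    unfolding E_def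
    by (rule UN_lt_K[OF Xs_lt]) (use \<sigma> len in \<open>auto simp: strategy_def\<close>)
  then have "|E| <o |sc V t|" using big ordLess_ordLeq_trans by blast
  then have "\<not> sc V t \<subseteq> E" using card_of_mono1 not_ordLess_ordLeq by blast
  then obtain a where a: "a \<in> sc V t" "a \<notin> E" by blast
  then have ta: "t @ [a] \<in> V" by (simp add: sc_def)
  let ?V1 = "tr V (t @ [a])"
  have V1: "?V1 \<in> PT" by (rule tr_PT[OF VP ta])
  have F: "fst (\<sigma> y h) \<in> D n" if "y \<in> Xs" for y using \<sigma>[OF that] len by (auto simp: strategy_def)
  have "\<exists>d\<in>D n. \<forall>V\<in>PT. V \<subseteq> T \<longrightarrow> Resp n q d V \<longrightarrow> (\<forall>x\<in>Xs. Resp n q (fst (\<sigma> x h)) V)" if "q \<in> Q" for q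
  proof -
    have "fst (\<sigma> y h) \<in> D n" if "\<forall>n. fst (y n) \<in> Q" for y using F that by (simp add: Xs_def)
    from directed[OF \<open>q \<in> Q\<close> this] show ?thesis by (simp add: Xs_def)
  qed
  then have "\<forall>q. \<exists>d. q \<in> Q \<longrightarrow> d \<in> D n \<and> (\<forall>V\<in>PT. V \<subseteq> T \<longrightarrow> Resp n q d V \<longrightarrow> (\<forall>x\<in>Xs. Resp n q (fst (\<sigma> x h)) V))"
    by blast
  then obtain dd where "\<forall>q. q \<in> Q \<longrightarrow> dd q \<in> D n \<and> (\<forall>V\<in>PT. V \<subseteq> T \<longrightarrow> Resp n q (dd q) V \<longrightarrow> (\<forall>x\<in>Xs. Resp n q (fst (\<sigma> x h)) V))"
    by (rule choice[THEN exE])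
  then have dd: "q \<in> Q \<Longrightarrow> dd q \<in> D n"
    "q \<in> Q \<Longrightarrow> V \<in> PT \<Longrightarrow> V \<subseteq> T \<Longrightarrow> Resp n q (dd q) V \<Longrightarrow> x \<in> Xs \<Longrightarrow> Resp n q (fst (\<sigma> x h)) V" for q V x
    by blast+
  obtain q V2 where q: "q \<in> Q" and V2: "V2 \<in> PT" "V2 \<subseteq> ?V1" "Resp n q (dd q) V2"
    using progress[OF V1 order_trans[OF tr_subset V], of dd n] dd(1) by blast
  \<comment> \<open>All nodes of \<open>V2\<close> are comparable with \<open>t @ [a]\<close>, so a
    node of this length must be \<open>t @ [a]\<close> itself. Hence \<open>V2\<close> still
    contains the chosen successor.\<close>
  obtain s where s: "s \<in> V2" "length s = Suc (length t)"
    using PT_long[OF V2(1) PT_Nil[OF V2(1)], of "Suc (length t)"] by auto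
  then have "prefix s (t @ [a]) \<or> prefix (t @ [a]) s" "length s = length (t @ [a])"
    using V2(2) by (auto simp: tr_def)
  then have "s = t @ [a]" by (metis append_Nil2 append_eq_append_conv prefix_def)
  then obtain V3 t3 where V3: "stemmed (cc + Suc n) V3 t3" "V3 \<subseteq> tr V2 (t @ [a])" "prefix (t @ [a]) t3"
    using stemmed_ex[OF V2(1), of s "cc + Suc n"] s by metis
  have V3': "V3 \<in> PT" "V3 \<subseteq> V2" using V3 tr_subset by (auto simp: stemmed_def)
  have V3T: "V3 \<subseteq> T" "V3 \<subseteq> ?V1" using V3' V2 V tr_subset by blast+
  have "Resp n q (fst (\<sigma> y h)) V3" if "y \<in> Xs" for y
    using dd(2)[OF q V3'(1) V3T(1) Resp_mono[OF V2(3) V3'] that] .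
  then have "legal y n (fst (\<sigma> y h)) (snd (\<sigma> y h)) (V, t) (a, V3, t3)" if "y \<in> Xs" "y n = (q, length t3)" for y
    using a that V3T V3 by (auto simp: legal_def E_def)
  then show ?thesis using q V3 V3T by (intro exI[of _ q] exI[of _ "(a, V3, t3)"]) auto
qed

lemma ex_not_wins:
  assumes s0: "stemmed cc (fst s0) (snd s0)" "fst s0 \<subseteq> T"
  shows "\<exists>y\<in>Xs. \<not> wins y 0 s0"
proof (rule ccontr)
  assume "\<not> (\<exists>y\<in>Xs. \<not> wins y 0 s0)"
  then have "\<forall>y\<in>Xs. \<exists>\<sigma>. strategy 0 \<sigma> \<and> \<not> (\<exists>m. defeats y 0 s0 \<sigma> m)" unfolding wins_def by blast
  then obtain \<sigma> where \<sigma>: "y \<in> Xs \<Longrightarrow> strategy 0 (\<sigma> y)" "y \<in> Xs \<Longrightarrow> \<not> defeats y 0 s0 (\<sigma> y) m" for y m by metis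
  define cur where "cur h = (if h = [] then s0 else snd (snd (last h)))" for h :: "('q \<times> 'k \<times> 'k list set \<times> 'k list) list"
  define good where "good h x \<longleftrightarrow> fst x \<in> Q \<and> stemmed (cc + Suc (length h)) (fst (snd (snd x))) (snd (snd (snd x))) \<and>
    fst (snd (snd x)) \<subseteq> T \<and>
    (\<forall>y\<in>Xs. y (length h) = (fst x, length (snd (snd (snd x)))) \<longrightarrow>
       legal y (length h) (fst (\<sigma> y (map snd h))) (snd (\<sigma> y (map snd h))) (cur h) (snd x))"
    for h and x :: "'q \<times> 'k \<times> 'k list set \<times> 'k list"
  have ex: "\<exists>x. good h x" if "stemmed (cc + length h) (fst (cur h)) (snd (cur h))" "fst (cur h) \<subseteq> T" for h
    using Resp_step[OF that(1,2) _ \<sigma>(1), of "map snd h"] unfolding good_def by fastforce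
  define H where "H = rec_nat [] (\<lambda>_ h. h @ [SOME x. good h x])"
  define x where "x n = (SOME x. good (H n) x)" for n
  have H0: "H 0 = []" and HS: "H (Suc n) = H n @ [x n]" for n by (auto simp: H_def x_def)
  have lenH: "length (H n) = n" for n by (induction n) (auto simp: H0 HS)
  have HH: "stemmed (cc + n) (fst (cur (H n))) (snd (cur (H n))) \<and> fst (cur (H n)) \<subseteq> T" for n
  proof (induction n)
    case 0 then show ?case using s0 by (simp add: cur_def H0)
  next
    case (Suc n)
    then have "\<exists>x. good (H n) x" using ex[of "H n"] lenH by simp
    then have "good (H n) (x n)" unfolding x_def by (rule someI_ex)
    then show ?case using lenH by (simp add: good_def cur_def HS)
  qed
  have gx: "good (H n) (x n)" for n
  proof -
    have "\<exists>x. good (H n) x" using ex[of "H n"] HH[of n] lenH[of n] by simp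
    then show ?thesis unfolding x_def by (rule someI_ex)
  qed
  define y where "y n = (fst (x n), length (snd (snd (snd (x n)))))" for n
  have y: "y \<in> Xs" using gx by (auto simp: Xs_def y_def good_def)
  define m where "m n = snd (x n)" for n
  have Hm: "map snd (H n) = map m [0..<n]" for n by (induction n) (auto simp: H0 HS m_def)
  have curm: "cur (H n) = position s0 m n" for n by (cases n) (auto simp: cur_def H0 HS position_def m_def)
  have "defeats y 0 s0 (\<sigma> y) m"
    unfolding defeats_def using gx y lenH by (auto simp: good_def curm Hm y_def m_def)
  then show False using \<sigma>(2)[OF y] by blast
qed

context
  fixes y :: "nat \<Rightarrow> 'q \<times> nat" and s0 :: "'k list set \<times> 'k list"
begin

primrec pos :: "(nat \<Rightarrow> 'd) \<Rightarrow> 'k list \<Rightarrow> 'k list set \<times> 'k list" where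
  "pos dd [] = s0"
| "pos dd (a # r) = (SOME s'. legal y (length r) (dd (length r)) {} (pos dd r) (a, s') \<and> \<not> wins y (Suc (length r)) s')"

primrec okpos :: "(nat \<Rightarrow> 'd) \<Rightarrow> 'k list \<Rightarrow> bool" where
  "okpos dd [] \<longleftrightarrow> True"
| "okpos dd (a # r) \<longleftrightarrow> okpos dd r \<and> a \<in> moves y (length r) (dd (length r)) (pos dd r)"

text \<open>A position uses only as many demands as it is long; for this reason the family
  \<open>Sg\<close> in \<open>run\<close> can depend on a finite list of demands.\<close>

lemma pos_cong: "(\<And>i. i < length r \<Longrightarrow> dd i = dd' i) \<Longrightarrow> pos dd r = pos dd' r"
  by (induction r) auto

lemma okpos_cong: "(\<And>i. i < length r \<Longrightarrow> dd i = dd' i) \<Longrightarrow> okpos dd r = okpos dd' r"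
  by (induction r) (auto cong: pos_cong)

lemma pos_step:
  assumes "okpos dd (a # r)"
  shows "legal y (length r) (dd (length r)) {} (pos dd r) (a, pos dd (a # r))" "\<not> wins y (Suc (length r)) (pos dd (a # r))"
proof -
  have "\<exists>s'. legal y (length r) (dd (length r)) {} (pos dd r) (a, s') \<and> \<not> wins y (Suc (length r)) s'"
    using assms by (auto simp: moves_def)
  from someI_ex[OF this] show "legal y (length r) (dd (length r)) {} (pos dd r) (a, pos dd (a # r))" "\<not> wins y (Suc (length r)) (pos dd (a # r))"
    by auto
qed

end

definition levels :: "(nat \<Rightarrow> 'q \<times> nat) \<Rightarrow> 'k list set \<times> 'k list \<Rightarrow> nat \<Rightarrow> nat" where
  "levels y s0 n = (case n of 0 \<Rightarrow> length (snd s0) | Suc m \<Rightarrow> snd (y m))"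

lemma fusion_pos:
  assumes s0: "stemmed cc (fst s0) (snd s0)" "fst s0 \<subseteq> T" and nw: "\<not> wins y 0 s0"
    and dd: "\<And>n. dd n \<in> D n"
  shows "fusion \<kappa> T (\<lambda>r. fst (pos y s0 dd r)) (\<lambda>r. snd (pos y s0 dd r))
    (\<lambda>r. moves y (length r) (dd (length r)) (pos y s0 dd r)) (okpos y s0 dd) (levels y s0) cc"
proof unfold_locales
  have nwr: "\<not> wins y (length r) (pos y s0 dd r)" if "okpos y s0 dd r" for r
    using that nw pos_step(2)[of y s0 dd] by (cases r) auto
  show "okpos y s0 dd []" by simp
  show "okpos y s0 dd (a # r) \<longleftrightarrow> okpos y s0 dd r \<and> a \<in> moves y (length r) (dd (length r)) (pos y s0 dd r)" for a r
    by simp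
  show "fst (pos y s0 dd []) \<subseteq> T" using s0 by simp
  show "stemmed (cc + length r) (fst (pos y s0 dd r)) (snd (pos y s0 dd r))" if "okpos y s0 dd r" for r
  proof (cases r)
    case Nil then show ?thesis using s0 by simp
  next
    case (Cons a r')
    show ?thesis using pos_step(1)[of y s0 dd a r'] that unfolding Cons by (simp add: legal_def del: pos.simps)
  qed
  show "|K (cc + length r)| \<le>o |moves y (length r) (dd (length r)) (pos y s0 dd r)|" if "okpos y s0 dd r" for r
    using not_wins_step[OF nwr[OF that]] dd by simp
  show "fst (pos y s0 dd (a # r)) \<subseteq> tr (fst (pos y s0 dd r)) (snd (pos y s0 dd r) @ [a])" if "okpos y s0 dd (a # r)" for a r
    using pos_step(1)[OF that] by (simp add: legal_def del: pos.simps)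
  show "prefix (snd (pos y s0 dd r) @ [a]) (snd (pos y s0 dd (a # r)))" if "okpos y s0 dd (a # r)" for a r
    using pos_step(1)[OF that] by (simp add: legal_def del: pos.simps)
  show "length (snd (pos y s0 dd r)) = levels y s0 (length r)" if "okpos y s0 dd r" for r
  proof (cases r)
    case Nil then show ?thesis by (simp add: levels_def)
  next
    case (Cons a r')
    show ?thesis using pos_step(1)[of y s0 dd a r'] that unfolding Cons by (simp add: legal_def levels_def del: pos.simps)
  qed
qed

lemma card_lists: "|{r :: 'k list. length r = n}| \<le>o |UNIV :: 'k set|"
proof (induction n)
  case 0
  have "{r :: 'k list. length r = 0} = {[]}" by auto
  then show ?case by (simp add: card_of_singl_ordLeq)
next
  case (Suc n)
  have "{r :: 'k list. length r = Suc n} = (\<lambda>(a, r). a # r) ` (UNIV \<times> {r. length r = n})"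
    by (auto simp: length_Suc_conv)
  then have "|{r :: 'k list. length r = Suc n}| \<le>o |(UNIV :: 'k set) \<times> {r :: 'k list. length r = n}|"
    using card_of_image by metis
  also have "|(UNIV :: 'k set) \<times> {r :: 'k list. length r = n}| \<le>o |(UNIV :: 'k set) \<times> (UNIV :: 'k set)|"
    by (rule card_of_Times_mono2[OF Suc])
  also have "|(UNIV :: 'k set) \<times> (UNIV :: 'k set)| =o |UNIV :: 'k set|"
    by (rule card_of_Times_same_infinite) simp
  finally (ordLeq_transitive ordLeq_ordIso_trans) show ?case .
qed

text \<open>The order of the quantifiers matters: \<open>x\<close>, \<open>l\<close> and
  \<open>Sg\<close> precede \<open>dd\<close>, and \<open>Sg\<close> sees only an initial part of
  \<open>dd\<close>. Colours are thus known from the start, and each demand may be chosen with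
  knowledge of the trees that answer the earlier ones. The trees of stage \<open>n\<close> are
  predense below \<open>T'\<close>.\<close>

theorem run:
  "\<exists>x l Sg. (\<forall>n. x n \<in> Q) \<and> strict_mono l \<and> (\<forall>ds. |Sg ds :: 'k list set set| \<le>o |UNIV :: 'k set| ) \<and>
     (\<forall>dd. (\<forall>n. dd n \<in> D n) \<longrightarrow> (\<exists>T'\<in>PT. T' \<subseteq> T \<and> uniform T' l \<and>
        (\<forall>n. \<forall>S\<in>PT. S \<subseteq> T' \<longrightarrow> (\<exists>S'\<in>PT. S' \<subseteq> S \<and> (\<exists>V\<in>Sg (map dd [0..<Suc n]). S' \<subseteq> V))) \<and>
        (\<forall>n. \<forall>V\<in>Sg (map dd [0..<Suc n]). V \<in> PT \<and> V \<subseteq> T \<and> Resp n (x n) (dd n) V)))"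
proof -
  obtain V0 t0 where "stemmed cc V0 t0" "V0 \<subseteq> tr T []"
    using stemmed_ex[OF T_PT PT_Nil[OF T_PT]] by metis
  then obtain s0 where s0: "stemmed cc (fst s0) (snd s0)" "fst s0 \<subseteq> T" using tr_subset by (metis fst_conv order_trans snd_conv)
  obtain y where y: "y \<in> Xs" "\<not> wins y 0 s0" using ex_not_wins[OF s0] by blast
  define Sg where "Sg ds = {fst (pos y s0 (nth ds) r) | r. okpos y s0 (nth ds) r \<and> length r = length ds}" for ds
  have Sg: "Sg (map dd [0..<n]) = {fst (pos y s0 dd r) | r. okpos y s0 dd r \<and> length r = n}" for dd n
  proof -
    have "pos y s0 (nth (map dd [0..<n])) r = pos y s0 dd r \<and> okpos y s0 (nth (map dd [0..<n])) r = okpos y s0 dd r"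
      if "length r = n" for r
      using that by (auto intro!: pos_cong okpos_cong)
    then show ?thesis unfolding Sg_def by auto metis+
  qed
  have card: "|Sg ds| \<le>o |UNIV :: 'k set|" for ds
  proof -
    have "Sg ds \<subseteq> (\<lambda>r. fst (pos y s0 (nth ds) r)) ` {r. length r = length ds}" by (auto simp: Sg_def)
    then have "|Sg ds| \<le>o |{r :: 'k list. length r = length ds}|" by (rule surj_imp_ordLeq)
    then show ?thesis using card_lists ordLeq_transitive by blast
  qed
  have main: "\<exists>T'\<in>PT. T' \<subseteq> T \<and> uniform T' (levels y s0) \<and>
        (\<forall>n. \<forall>S\<in>PT. S \<subseteq> T' \<longrightarrow> (\<exists>S'\<in>PT. S' \<subseteq> S \<and> (\<exists>V\<in>Sg (map dd [0..<Suc n]). S' \<subseteq> V))) \<and>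
        (\<forall>n. \<forall>V\<in>Sg (map dd [0..<Suc n]). V \<in> PT \<and> V \<subseteq> T \<and> Resp n (fst (y n)) (dd n) V)"
    if dd: "\<forall>n. dd n \<in> D n" for dd
  proof -
    interpret f: fusion \<kappa> T "\<lambda>r. fst (pos y s0 dd r)" "\<lambda>r. snd (pos y s0 dd r)"
      "\<lambda>r. moves y (length r) (dd (length r)) (pos y s0 dd r)" "okpos y s0 dd" "levels y s0" cc
      by (rule fusion_pos[OF s0 y(2)]) (use dd in blast)
    have "\<exists>S'\<in>PT. S' \<subseteq> S \<and> (\<exists>V\<in>Sg (map dd [0..<Suc n]). S' \<subseteq> V)" if "S \<in> PT" "S \<subseteq> f.fused" for n S
      unfolding Sg by (rule f.fused_below[OF that, of "Suc n"]) blast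
    moreover have "V \<in> PT \<and> V \<subseteq> T \<and> Resp n (fst (y n)) (dd n) V" if V: "V \<in> Sg (map dd [0..<Suc n])" for n V
    proof -
      obtain r where r: "V = fst (pos y s0 dd r)" "okpos y s0 dd r" "length r = Suc n" using V unfolding Sg by blast
      then obtain a r' where ar: "r = a # r'" "length r' = n" by (cases r) auto
      have "V \<in> PT" using f.st[OF r(2)] r by (simp add: stemmed_def)
      moreover have "V \<subseteq> T" using f.tree_append[of r "[]"] r s0 by auto
      moreover have "Resp n (fst (y n)) (dd n) V" using pos_step(1)[of y s0 dd a r'] r ar by (simp add: legal_def del: pos.simps)
      ultimately show ?thesis by blast
    qed
    ultimately show ?thesis using f.fused_PT f.fused_subset f.fused_uniform
      by (intro bexI[of _ f.fused] conjI) simp_all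
  qed
  have "\<forall>k. \<exists>d. d \<in> D k" using D_ne by blast
  then obtain dd where dd: "dd n \<in> D n" for n by metis
  have "strict_mono (levels y s0)" using main[of dd] dd by (auto simp: uniform_def)
  then show ?thesis using y main card by (intro exI[of _ "\<lambda>n. fst (y n)"] exI[of _ "levels y s0"] exI[of _ Sg]) (auto simp: Xs_def simp del: upt_Suc)
qed

end

section \<open>Sparse trees\<close>

text \<open>The type \<open>'a\<close> in an arbitrarily chosen well-order, with a greatest element added.\<close>

datatype 'a wtop = El 'a | Tp

definition wtop_ord :: "'a rel" where
  "wtop_ord = (SOME r. well_order_on UNIV r)"

lemma wtop_ord: "well_order_on UNIV wtop_ord"
  unfolding wtop_ord_def by (rule someI_ex) (rule well_order_on)

instantiation wtop :: (type) wellorder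
begin

definition less_eq_wtop :: "'a wtop \<Rightarrow> 'a wtop \<Rightarrow> bool" where
  "less_eq_wtop a b \<longleftrightarrow> (case b of Tp \<Rightarrow> True | El y \<Rightarrow> (case a of Tp \<Rightarrow> False | El x \<Rightarrow> (x, y) \<in> wtop_ord))"

definition less_wtop :: "'a wtop \<Rightarrow> 'a wtop \<Rightarrow> bool" where
  "less_wtop a b \<longleftrightarrow> a \<le> b \<and> \<not> b \<le> a"

instance
proof
  have le: "El x \<le> El y \<longleftrightarrow> (x, y) \<in> wtop_ord" "x' \<le> Tp" "\<not> Tp \<le> El y" for x y :: 'a and x'
    by (simp_all add: less_eq_wtop_def)
  have W: "refl (wtop_ord :: 'a rel)" "trans (wtop_ord :: 'a rel)" "antisym (wtop_ord :: 'a rel)"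
    "total_on UNIV (wtop_ord :: 'a rel)" "wf ((wtop_ord :: 'a rel) - Id)"
    using wtop_ord[where 'a = 'a]
    by (auto simp: well_order_on_def linear_order_on_def partial_order_on_def preorder_on_def)
  fix x y z :: "'a wtop"
  show "x < y \<longleftrightarrow> x \<le> y \<and> \<not> y \<le> x" by (rule less_wtop_def)
  show "x \<le> x" using W(1) by (cases x) (auto simp: le refl_on_def)
  show "x \<le> z" if "x \<le> y" "y \<le> z"
    using that W(2) by (cases x; cases y; cases z) (auto simp: le dest: transD)
  show "x = y" if "x \<le> y" "y \<le> x"
    using that W(3) by (cases x; cases y) (auto simp: le dest: antisymD)
  show "x \<le> y \<or> y \<le> x"
    using W(4,1) by (cases x; cases y) (auto simp: le total_on_def refl_on_def, metis)
  show "P a" if step: "\<And>x. (\<And>y. y < x \<Longrightarrow> P y) \<Longrightarrow> P x" for P and a :: "'a wtop"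
  proof -
    have El: "P (El x)" for x
    proof (induction x rule: wf_induct_rule[OF W(5)])
      case (1 x)
      show ?case
      proof (rule step)
        fix y assume "y < El x"
        then obtain y' where "y = El y'" "(y', x) \<in> wtop_ord - Id"
          using W(1) by (cases y) (auto simp: less_wtop_def le refl_on_def)
        then show "P y" using 1 by blast
      qed
    qed
    have "P Tp"
    proof (rule step)
      fix y :: "'a wtop" assume "y < Tp"
      then show "P y" using El by (cases y) (auto simp: less_wtop_def le)
    qed
    with El show ?thesis by (cases a) auto
  qed
qed

end

lemma El_less_Tp [simp]: "El x < Tp"
  by (simp add: less_wtop_def less_eq_wtop_def)

text \<open>Zorn's lemma for antichains of trees and for almost disjoint families alike.
  \<open>R\<close> may be asymmetric, hence both directions in the conclusion.\<close>

lemma ex_maximal_pairwise: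
  "\<exists>M\<subseteq>E. (\<forall>v\<in>M. \<forall>w\<in>M. v \<noteq> w \<longrightarrow> R v w) \<and> (\<forall>v\<in>E - M. \<exists>w\<in>M. \<not> R v w \<or> \<not> R w v)"
proof -
  define F where "F = {W. W \<subseteq> E \<and> (\<forall>v\<in>W. \<forall>w\<in>W. v \<noteq> w \<longrightarrow> R v w)}"
  have "\<exists>M\<in>F. \<forall>X\<in>F. M \<subseteq> X \<longrightarrow> X = M"
  proof (rule subset_Zorn')
    fix C assume C: "subset.chain F C"
    show "\<Union>C \<in> F"
      unfolding F_def
    proof (intro CollectI conjI ballI impI)
      show "\<Union>C \<subseteq> E" using C by (auto simp: subset.chain_def F_def)
      fix v w assume vw: "v \<in> \<Union>C" "w \<in> \<Union>C" "v \<noteq> w"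
      then obtain A B where "A \<in> C" "v \<in> A" "B \<in> C" "w \<in> B" by blast
      then obtain D where "D \<in> C" "v \<in> D" "w \<in> D"
        using C unfolding subset.chain_def by blast
      then show "R v w" using C vw(3) unfolding subset.chain_def F_def by blast
    qed
  qed
  then obtain M where M: "M \<in> F" "\<And>X. X \<in> F \<Longrightarrow> M \<subseteq> X \<Longrightarrow> X = M" by blast
  have "\<exists>w\<in>M. \<not> R v w \<or> \<not> R w v" if "v \<in> E - M" for v
  proof (rule ccontr)
    assume "\<not> ?thesis"
    then have "insert v M \<in> F" using M(1) that unfolding F_def by blast
    then show False using M(2) that by blast
  qed
  then show ?thesis using M(1) unfolding F_def by blast
qed

lemma card_of_Diff_ge:
  assumes "infinite B" "|B| \<le>o |A|" "|C| <o |B|"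
  shows "|B| \<le>o |A - C|"
proof (rule ccontr)
  assume "\<not> |B| \<le>o |A - C|"
  then have "|A - C| <o |B|" using ordLeq_not_ordLess by blast
  then have "|(A - C) \<union> C| <o |B|" using card_of_Un_ordLess_infinite[OF assms(1)] assms(3) by blast
  moreover have "|A| \<le>o |(A - C) \<union> C|" by (rule card_of_mono1) auto
  ultimately show False using assms(2) ordLeq_not_ordLess ordLeq_ordLess_trans by blast
qed

section \<open>Thinning of trees, and maximal antichains of sparse trees\<close>

context singular_card
begin

definition compat :: "'k list set \<Rightarrow> 'k list set \<Rightarrow> bool" where
  "compat S T \<longleftrightarrow> (\<exists>R\<in>PT. R \<subseteq> S \<and> R \<subseteq> T)"

lemma compat_mono: "compat S T \<Longrightarrow> T \<subseteq> T' \<Longrightarrow> compat S T'"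
  by (auto simp: compat_def)

lemma compat_sym: "compat S T \<Longrightarrow> compat T S"
  by (auto simp: compat_def)

definition maxanti :: "'k list set set \<Rightarrow> bool" where
  "maxanti W \<longleftrightarrow> W \<subseteq> PT \<and> (\<forall>v\<in>W. \<forall>w\<in>W. compat v w \<longrightarrow> v = w) \<and> (\<forall>T\<in>PT. \<exists>w\<in>W. compat w T)"

lemma ex_maxanti:
  assumes E: "E \<subseteq> PT" and dense: "\<And>T. T \<in> PT \<Longrightarrow> \<exists>w\<in>E. w \<subseteq> T"
  shows "\<exists>W. maxanti W \<and> W \<subseteq> E"
proof -
  obtain M where M: "M \<subseteq> E" "\<forall>v\<in>M. \<forall>w\<in>M. v \<noteq> w \<longrightarrow> \<not> compat v w"
    "\<forall>v\<in>E - M. \<exists>w\<in>M. \<not> \<not> compat v w \<or> \<not> \<not> compat w v"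
    using ex_maximal_pairwise[of E "\<lambda>v w. \<not> compat v w"] by blast
  have "\<exists>w\<in>M. compat w T" if T: "T \<in> PT" for T
  proof -
    obtain v where v: "v \<in> E" "v \<subseteq> T" using dense[OF T] by blast
    have "compat v v" using v E by (auto simp: compat_def)
    then have "\<exists>w\<in>M. compat w v" using M(3) v(1) compat_sym by (cases "v \<in> M") blast+
    then show ?thesis using v compat_mono by blast
  qed
  moreover have "\<forall>v\<in>M. \<forall>w\<in>M. compat v w \<longrightarrow> v = w" using M(2) by blast
  ultimately have "maxanti M" using M(1) E unfolding maxanti_def by auto
  then show ?thesis using M(1) by blast
qed

definition thin :: "'k list set \<Rightarrow> ('k list \<Rightarrow> 'k set) \<Rightarrow> 'k list set" where
  "thin T B = {t \<in> T. \<forall>i < length t. t ! i \<in> B (take i t)}"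

lemma thin_subset: "thin T B \<subseteq> T" by (auto simp: thin_def)

lemma thin_snoc: "t @ [a] \<in> thin T B \<longleftrightarrow> t @ [a] \<in> T \<and> (\<forall>i < length t. t ! i \<in> B (take i t)) \<and> a \<in> B t"
  by (auto simp: thin_def nth_append less_Suc_eq)

lemma sc_thin: "t \<in> thin T B \<Longrightarrow> sc (thin T B) t = sc T t \<inter> B t"
  by (auto simp: sc_def thin_snoc) (auto simp: thin_def)

lemma thin_PT:
  assumes T: "T \<in> PT" and B: "\<And>t. t \<in> T \<Longrightarrow> B t \<noteq> {} \<and> B t \<subseteq> sc T t"
    and big: "\<And>n k. \<exists>j\<ge>k. \<forall>t\<in>T. length t = j \<longrightarrow> |K n| \<le>o |B t|"
  shows "thin T B \<in> PT"
proof (rule PT_I)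
  show "is_tree \<kappa> (thin T B)"
    unfolding is_tree_def
  proof (intro conjI ballI allI impI)
    show "thin T B \<subseteq> seqs \<kappa>" using thin_subset PT_subset_one[OF T] by blast
    fix t s assume t: "t \<in> thin T B" and "prefix s t"
    then obtain u where u: "t = s @ u" by (auto simp: prefix_def)
    have "s ! i \<in> B (take i s)" if "i < length s" for i
      using t that unfolding thin_def u by (auto dest!: spec[of _ i] simp: nth_append)
    then show "s \<in> thin T B" using PT_prefix[OF T _ \<open>prefix s t\<close>] t by (simp add: thin_def)
  qed
  show "thin T B \<noteq> {}" using PT_Nil[OF T] by (auto simp: thin_def)
  have sc: "sc (thin T B) t = B t" if "t \<in> thin T B" for t
    using sc_thin[OF that] B[of t] that thin_subset by blast
  show ne: "sc (thin T B) t \<noteq> {}" if "t \<in> thin T B" for t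
    using sc[OF that] B[of t] that thin_subset by blast
  have long: "\<exists>s\<in>thin T B. prefix t s \<and> length s = length t + n" if "t \<in> thin T B" for t n
  proof (induction n)
    case (Suc n)
    then obtain s a where "s \<in> thin T B" "prefix t s" "length s = length t + n" "a \<in> sc (thin T B) s" using ne by blast
    then show ?case by (intro bexI[of _ "s @ [a]"]) (auto simp: sc_def)
  qed (use that in auto)
  show "\<exists>t'\<in>thin T B. prefix t t' \<and> |K n| \<le>o |sc (thin T B) t'|" if t: "t \<in> thin T B" for n t
  proof -
    obtain j where j: "j \<ge> length t" "\<forall>t\<in>T. length t = j \<longrightarrow> |K n| \<le>o |B t|" using big by blast
    obtain s where s: "s \<in> thin T B" "prefix t s" "length s = j" using long[OF t, of "j - length t"] j by auto
    then show ?thesis using sc[OF s(1)] j(2) subsetD[OF thin_subset s(1)] by (intro bexI[of _ s]) auto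
  qed
qed

text \<open>The game with a single colour and a single demand; what it still prescribes are the stem
  lengths, which become the common splitting levels.\<close>

lemma uniform_ex:
  assumes "T \<in> PT"
  obtains T' l where "T' \<in> PT" "T' \<subseteq> T" "uniform T' l"
proof -
  interpret fusion_game \<kappa> T "{()}" "\<lambda>_. {()}" "\<lambda>_ _ _ _. True"
  proof unfold_locales
    show "|{()}| <o |UNIV :: 'k set|"
      by (metis card_of_ordLeq_finite finite.emptyI finite_insert infinite_UNIV_k ordLeq_not_ordLess)
  qed (use assms in auto)
  show ?thesis using run that by auto
qed

lemma ex_subset_K: "|K n| \<le>o |A| \<Longrightarrow> \<exists>B\<subseteq>A. |B| =o |K n|"
  by (metis card_of_ordLeq card_of_ordIsoI inj_on_imp_bij_betw ordIso_symmetric)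

definition sparse :: "(nat \<Rightarrow> nat) \<Rightarrow> 'k list set set" where
  "sparse g = {w \<in> PT. \<forall>t\<in>w. |sc w t| <o |K (g (length t))| }"

lemma singleton_lt: "|{a}| <o |K n|"
  by (metis card_of_ordLeq_finite finite.emptyI finite_insert infinite_K ordLeq_not_ordLess)

lemma sparse_dense:
  assumes g: "\<And>m. \<exists>N. \<forall>k\<ge>N. m \<le> g k" and T: "T \<in> PT"
  shows "\<exists>w\<in>sparse g. w \<subseteq> T"
proof -
  obtain T1 l where T1: "T1 \<in> PT" "T1 \<subseteq> T" and u: "uniform T1 l" using uniform_ex[OF T] .
  have l: "strict_mono l" using u by (simp add: uniform_def)
  \<comment> \<open>The splitting to be kept on level \<open>l n\<close>. Subtracting one makes
    \<open>\<kappa> (p n)\<close> smaller than the bound \<open>\<kappa> (g (l n))\<close>, and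
    \<open>p\<close> tends to infinity because \<open>g\<close> does. Where \<open>g (l n)\<close>
    is zero, a single successor is kept.\<close>
  define p where "p n = min n (g (l n) - 1)" for n
  have ex: "\<exists>B. B \<noteq> {} \<and> B \<subseteq> sc T1 t \<and> |B| <o |K (g (length t))| \<and>
      (\<forall>n. length t = l n \<and> g (l n) > 0 \<longrightarrow> |K (p n)| \<le>o |B| )" if t: "t \<in> T1" for t
  proof (cases "\<exists>n. length t = l n \<and> g (l n) > 0")
    case True
    then obtain n where n: "length t = l n" "g (l n) > 0" by blast
    have "|K (p n)| \<le>o |K n|" using K_le by (simp add: p_def)
    also have "|K n| \<le>o |sc T1 t|" using u t n by (simp add: uniform_def)
    finally (ordLeq_transitive) obtain B where B: "B \<subseteq> sc T1 t" "|B| =o |K (p n)|" using ex_subset_K by blast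
    have "p n < g (l n)" using n by (simp add: p_def)
    then have "|B| <o |K (g (length t))|" using B n K_lt ordIso_ordLess_trans by fastforce
    moreover have "B \<noteq> {}"
      using B(2) infinite_K by (metis card_of_ordIso_finite finite.emptyI)
    moreover have "|K (p n')| \<le>o |B|" if "length t = l n'" for n'
    proof -
      have "n' = n" using that n l by (simp add: strict_mono_eq)
      then show ?thesis using B(2) ordIso_iff_ordLeq by blast
    qed
    ultimately show ?thesis using B(1) by blast
  next
    case False
    obtain a where "a \<in> sc T1 t" using PT_succ[OF T1(1) t] by blast
    then show ?thesis using False singleton_lt by (intro exI[of _ "{a}"]) auto
  qed
  then obtain B where B: "\<And>t. t \<in> T1 \<Longrightarrow> B t \<noteq> {} \<and> B t \<subseteq> sc T1 t \<and> |B t| <o |K (g (length t))| \<and>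
      (\<forall>n. length t = l n \<and> g (l n) > 0 \<longrightarrow> |K (p n)| \<le>o |B t| )" by metis
  have PT: "thin T1 B \<in> PT"
  proof (rule thin_PT[OF T1(1)])
    fix n k
    obtain N where N: "\<forall>k\<ge>N. Suc n \<le> g k" using g by blast
    define j where "j = Max {N, k, n}"
    have lj: "j \<le> l j" by (rule strict_mono_imp_increasing[OF l])
    have j: "N \<le> j" "k \<le> j" "n \<le> j" by (simp_all add: j_def)
    have "N \<le> l j" using j lj by linarith
    then have "Suc n \<le> g (l j)" using N by blast
    then have "n \<le> p j" "g (l j) > 0" using j by (auto simp: p_def)
    then have "|K n| \<le>o |B t|" if "t \<in> T1" "length t = l j" for t
      using B that K_le ordLeq_transitive by blast
    then show "\<exists>j\<ge>k. \<forall>t\<in>T1. length t = j \<longrightarrow> |K n| \<le>o |B t|" using j lj by (intro exI[of _ "l j"]) auto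
  qed (use B in blast)
  moreover have "|sc (thin T1 B) t| <o |K (g (length t))|" if t: "t \<in> thin T1 B" for t
  proof -
    have "|sc (thin T1 B) t| \<le>o |B t|" unfolding sc_thin[OF t] by (rule card_of_mono1) auto
    then show ?thesis using B t thin_subset ordLeq_ordLess_trans by blast
  qed
  ultimately have "thin T1 B \<in> sparse g" by (simp add: sparse_def)
  then show ?thesis using order_trans[OF thin_subset T1(2)] by blast
qed

text \<open>If \<open>g\<close> does not tend to infinity, the sparse trees need not be dense;
  \<open>W g\<close> is then just some maximal antichain, which keeps \<open>W\<close> total in
  \<open>g\<close>.\<close>

definition W :: "(nat \<Rightarrow> nat) \<Rightarrow> 'k list set set" where
  "W g = (SOME W. maxanti W \<and> ((\<forall>m. \<exists>N. \<forall>k\<ge>N. m \<le> g k) \<longrightarrow> W \<subseteq> sparse g))"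

lemma W: "maxanti (W g)" "(\<forall>m. \<exists>N. \<forall>k\<ge>N. m \<le> g k) \<Longrightarrow> W g \<subseteq> sparse g"
proof -
  have "\<exists>W. maxanti W \<and> ((\<forall>m. \<exists>N. \<forall>k\<ge>N. m \<le> g k) \<longrightarrow> W \<subseteq> sparse g)"
  proof (cases "\<forall>m. \<exists>N. \<forall>k\<ge>N. m \<le> g k")
    case True
    have "sparse g \<subseteq> PT" by (auto simp: sparse_def)
    then show ?thesis using ex_maxanti sparse_dense True by metis
  next
    case False
    then show ?thesis using ex_maxanti[of PT] by blast
  qed
  then have "maxanti (W g) \<and> ((\<forall>m. \<exists>N. \<forall>k\<ge>N. m \<le> g k) \<longrightarrow> W g \<subseteq> sparse g)" unfolding W_def by (rule someI_ex)
  then show "maxanti (W g)" "(\<forall>m. \<exists>N. \<forall>k\<ge>N. m \<le> g k) \<Longrightarrow> W g \<subseteq> sparse g" by blast+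
qed

definition KK :: "(nat \<Rightarrow> nat) \<Rightarrow> 'k list set \<Rightarrow> 'k list set set" where
  "KK g T = {w \<in> W g. compat w T}"

definition KU :: "'k list set \<Rightarrow> 'k list set set" where "KU T = (\<Union>g. KK g T)"

lemma KK_ne: "T \<in> PT \<Longrightarrow> KK g T \<noteq> {}"
  using W(1)[of g] by (auto simp: maxanti_def KK_def)

lemma KK_mono: "T \<subseteq> T' \<Longrightarrow> KK g T \<subseteq> KK g T'"
  using compat_mono by (auto simp: KK_def)

lemma KU_mono: "T \<subseteq> T' \<Longrightarrow> KU T \<subseteq> KU T'"
  unfolding KU_def by (intro UN_mono KK_mono) auto

text \<open>
  Given \<open>\<kappa>\<close> many members of the antichains, all of them that lie in \<open>W g\<close> for a suitable \<open>g\<close>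
  become incompatible with \<open>T\<close> once their nodes on the splitting levels have been removed from \<open>T\<close>.
\<close>

lemma KU_not_covered:
  assumes T: "T \<in> PT" and X: "|X| \<le>o |UNIV :: 'k set|"
  shows "\<not> KU T \<subseteq> X"
proof -
  obtain F where F: "X = (\<Union>n. F n)" "\<And>n. |F n| \<le>o |K n|" using small_UNION_K[OF X] by metis
  obtain T1 l where T1: "T1 \<in> PT" "T1 \<subseteq> T" and u: "uniform T1 l" using uniform_ex[OF T] .
  have l: "strict_mono l" using u by (simp add: uniform_def)
  \<comment> \<open>Chosen such that \<open>g (l n) = n\<close>: a tree sparse for \<open>g\<close>
    has fewer than \<open>\<kappa> n\<close> successors at its nodes on the n-th splitting level of
    \<open>T1\<close>.\<close>
  define g where "g k = (LEAST n. k \<le> l n)" for k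
  have gl: "g (l n) = n" for n
    unfolding g_def by (rule Least_equality) (use l in \<open>auto simp: strict_mono_less_eq\<close>)
  have g: "\<forall>m. \<exists>N. \<forall>k\<ge>N. m \<le> g k"
  proof (intro allI exI impI)
    fix m k assume k: "l m \<le> k"
    have "k \<le> l (g k)" unfolding g_def
      by (rule LeastI[of _ k]) (rule strict_mono_imp_increasing[OF l])
    then have "l m \<le> l (g k)" using k by linarith
    then show "m \<le> g k" using l by (simp add: strict_mono_less_eq)
  qed
  \<comment> \<open>The trees in \<open>F n\<close> are dealt with on level
    \<open>l (Suc n)\<close>: there are at most \<open>\<kappa> n\<close> of them, each has fewer
    than \<open>\<kappa> (Suc n)\<close> successors there, and regularity of
    \<open>\<kappa> (Suc n)\<close> leaves enough successors in \<open>T1\<close>. The factor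
    \<open>{a. t \<in> w}\<close> is there because sparseness only speaks of nodes of
    \<open>w\<close>.\<close>
  define R where "R n t = (\<Union>w\<in>F n \<inter> sparse g. sc w t \<inter> {a. t \<in> w})" for n t
  define B where "B t = (if length t \<in> l ` range Suc then sc T1 t - R (g (length t) - 1) t else sc T1 t)" for t
  have B_level: "|K (Suc n)| \<le>o |B t|" if t: "t \<in> T1" "length t = l (Suc n)" for t n
  proof -
    have "|R n t| <o |K (Suc n)|"
      unfolding R_def
    proof (rule UN_lt_K)
      have "|F n \<inter> sparse g| \<le>o |F n|" by (rule card_of_mono1) auto
      then show "|F n \<inter> sparse g| <o |K (Suc n)|" using F(2)[of n] K_lt[of n "Suc n"]
        by (meson lessI ordLeq_ordLess_trans ordLeq_transitive)
      fix w assume w: "w \<in> F n \<inter> sparse g"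
      show "|sc w t \<inter> {a. t \<in> w}| <o |K (Suc n)|"
      proof (cases "t \<in> w")
        case True
        then show ?thesis using w t gl unfolding sparse_def by auto
      next
        case False
        then have "sc w t \<inter> {a. t \<in> w} \<subseteq> {undefined}" by simp
        then show ?thesis by (rule ordLeq_ordLess_trans[OF card_of_mono1 singleton_lt])
      qed
    qed
    moreover have "|K (Suc n)| \<le>o |sc T1 t|" using u t by (simp add: uniform_def)
    ultimately have "|K (Suc n)| \<le>o |sc T1 t - R n t|" by (intro card_of_Diff_ge) auto
    then show ?thesis using t gl by (simp add: B_def)
  qed
  have PT: "thin T1 B \<in> PT"
  proof (rule thin_PT[OF T1(1)])
    fix t assume t: "t \<in> T1"
    have "B t \<noteq> {}"
    proof (cases "length t \<in> l ` range Suc")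
      case True
      then obtain n where "length t = l (Suc n)" by auto
      then show ?thesis using B_level[OF t] infinite_K card_of_ordLeq_infinite by force
    next
      case False
      then show ?thesis using PT_succ[OF T1(1) t] by (simp add: B_def)
    qed
    then show "B t \<noteq> {} \<and> B t \<subseteq> sc T1 t" by (auto simp: B_def split: if_splits)
  next
    fix n k :: nat
    define j where "j = max n k"
    have "j < l (Suc j)" using strict_mono_imp_increasing[OF l, of "Suc j"] by linarith
    moreover have "|K n| \<le>o |B t|" if "t \<in> T1" "length t = l (Suc j)" for t
      using B_level[OF that] K_le[of n "Suc j"] ordLeq_transitive by (force simp: j_def)
    ultimately show "\<exists>j\<ge>k. \<forall>t\<in>T1. length t = j \<longrightarrow> |K n| \<le>o |B t|"
      by (intro exI[of _ "l (Suc j)"]) (auto simp: j_def)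
  qed
  obtain w where w: "w \<in> KK g (thin T1 B)" using KK_ne[OF PT] by blast
  then have wg: "w \<in> sparse g" "w \<in> KU T"
    using W(2)[OF g] KK_mono[OF order_trans[OF thin_subset T1(2)]] by (auto simp: KK_def KU_def)
  have "w \<notin> X"
  proof
    assume "w \<in> X"
    then obtain n where n: "w \<in> F n" using F(1) by blast
    obtain S where S: "S \<in> PT" "S \<subseteq> w" "S \<subseteq> thin T1 B" using w by (auto simp: KK_def compat_def)
    obtain t where t: "t \<in> S" "length t = l (Suc n)" using PT_long[OF S(1) PT_Nil[OF S(1)], of "l (Suc n)"] by auto
    obtain a where a: "a \<in> sc S t" using PT_succ[OF S(1) t(1)] by blast
    have "a \<in> B t" using sc_mono[OF S(3), of t] a sc_thin[of t T1 B] t S by blast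
    then have "a \<notin> R n t" using t gl by (simp add: B_def)
    moreover have "a \<in> sc w t" "t \<in> w" using sc_mono[OF S(2)] a t S by blast+
    ultimately show False using n wg by (auto simp: R_def)
  qed
  then show ?thesis using wg by blast
qed

end

section \<open>Ordinals in which the indices of compatible members accumulate\<close>

context singular_card
begin

text \<open>Zero and the successors are excluded as well: \<open>\<beta>\<close> has cofinality above \<open>\<kappa>\<close>.\<close>

definition nonreach :: "'o::wellorder \<Rightarrow> bool" where
  "nonreach \<beta> \<longleftrightarrow> (\<forall>C\<subseteq>{..<\<beta>}. |C| \<le>o |UNIV :: 'k set| \<longrightarrow> (\<exists>i<\<beta>. \<forall>c\<in>C. c < i))"

lemma single_le_k: "|{a}| \<le>o |UNIV :: 'k set|"
  using singleton_lt[of a 0] card_of_mono1[of "K 0" UNIV] by (meson ordLess_imp_ordLeq ordLeq_transitive subset_UNIV)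

lemma nat_lt_k: "|UNIV :: nat set| <o |UNIV :: 'k set|"
  using natLeq_K[of 0] K_subset_UNIV[of 0] by (rule ordLess_transitive)

lemma countable_lt_k: "countable X \<Longrightarrow> |X| <o |UNIV :: 'k set|"
  using ordLeq_ordLess_trans[OF _ nat_lt_k] card_of_ordLeq[of X "UNIV :: nat set"] by (auto simp: countable_def)

text \<open>No cofinality equals the singular \<kappa>: split a cofinal set of size \<kappa> into
  countably many smaller pieces. Either one piece is cofinal, or strict bounds of the pieces form a
  countable cofinal set.\<close>

lemma reach_small:
  assumes "\<not> nonreach (\<beta> :: 'o::wellorder)"
  shows "\<exists>C\<subseteq>{..<\<beta>}. |C| <o |UNIV :: 'k set| \<and> (\<forall>i<\<beta>. \<exists>c\<in>C. i \<le> c)"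
proof -
  obtain C where C: "C \<subseteq> {..<\<beta>}" "|C| \<le>o |UNIV :: 'k set|" "\<And>i. i < \<beta> \<Longrightarrow> \<exists>c\<in>C. i \<le> c"
    using assms unfolding nonreach_def by (metis not_le)
  obtain F where F: "C = (\<Union>n. F n)" "\<And>n. |F n| \<le>o |K n|" "\<And>m n. m \<le> n \<Longrightarrow> F m \<subseteq> F n"
    using small_UNION_K[OF C(2)] by metis
  show ?thesis
  proof (cases "\<exists>n. \<forall>i<\<beta>. \<exists>c\<in>F n. i \<le> c")
    case True
    then obtain n where "\<forall>i<\<beta>. \<exists>c\<in>F n. i \<le> c" by blast
    moreover have "F n \<subseteq> {..<\<beta>}" using C F by blast
    moreover have "|F n| <o |UNIV :: 'k set|" using F(2) small_iff by blast
    ultimately show ?thesis by blast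
  next
    case False
    then have "\<forall>n. \<exists>i. i < \<beta> \<and> (\<forall>c\<in>F n. c < i)" by (meson not_le)
    then obtain b where b: "\<And>n. b n < \<beta>" "\<And>n c. c \<in> F n \<Longrightarrow> c < b n" by metis
    have "\<exists>c\<in>range b. i \<le> c" if "i < \<beta>" for i
    proof -
      obtain c where "c \<in> C" "i \<le> c" using C(3)[OF \<open>i < \<beta>\<close>] by blast
      then obtain n where "c \<in> F n" using F by blast
      then have "i \<le> b n" using b(2) \<open>i \<le> c\<close> by (meson less_imp_le order_trans)
      then show ?thesis by blast
    qed
    moreover have "|range b| <o |UNIV :: 'k set|" by (rule countable_lt_k) simp
    ultimately show ?thesis using b(1) by (intro exI[of _ "range b"]) auto
  qed
qed

text \<open>\<open>El w\<close> is the index of \<open>w\<close> in a well-order of all sets of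
  sequences. What is wanted is the failure of \<open>bdd\<close>: some \<open>\<beta>\<close> in
  \<open>\<C>\<close> of cofinality above \<kappa> in which the indices of members compatible with
  \<open>V\<close> are cofinal.\<close>

definition bdd :: "'k list set \<Rightarrow> 'k list set wtop set \<Rightarrow> bool" where
  "bdd V \<C> \<longleftrightarrow> (\<forall>\<beta>\<in>\<C>. nonreach \<beta> \<longrightarrow> (\<exists>c<\<beta>. \<forall>w\<in>KU V. El w < \<beta> \<longrightarrow> El w \<le> c))"

lemma bdd_mono: "bdd V \<C> \<Longrightarrow> V' \<subseteq> V \<Longrightarrow> \<C>' \<subseteq> \<C> \<Longrightarrow> bdd V' \<C>'"
  unfolding bdd_def using KU_mono[of V' V] by (meson subsetD)

lemma Un_le_K: "|A| \<le>o |K n| \<Longrightarrow> |B| \<le>o |K n| \<Longrightarrow> |A \<union> B| \<le>o |K n|"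
  by (rule card_of_Un_ordLeq_infinite_Field[OF _ _ _ card_of_Card_order]) (simp_all only: Field_card_of infinite_K not_False_eq_True)

text \<open>
  If this fails, a fusion closes off a set of \<open>\<kappa>\<close> many ordinals under bounds and under cofinal sequences;
  the least member above an index of \<open>KU T'\<close> would then have a smaller one above the index,
  so all indices belong to that set and \<open>KU T'\<close> is too small.
\<close>

lemma container:
  assumes T0: "T0 \<in> PT"
  shows "\<exists>T2\<in>PT. T2 \<subseteq> T0 \<and> (\<exists>\<C>. |\<C>| <o |UNIV :: 'k set| \<and> (\<forall>V\<in>PT. V \<subseteq> T2 \<longrightarrow> \<not> bdd V \<C>))"
proof (rule ccontr)
  assume contra: "\<not> ?thesis"
  have bd: "\<exists>V\<in>PT. V \<subseteq> T2 \<and> bdd V \<C>" if "T2 \<in> PT" "T2 \<subseteq> T0" "|\<C>| <o |UNIV :: 'k set|" for T2 \<C>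
  proof (rule ccontr)
    assume "\<not> ?thesis"
    then have "\<exists>\<C>. |\<C>| <o |UNIV :: 'k set| \<and> (\<forall>V\<in>PT. V \<subseteq> T2 \<longrightarrow> \<not> bdd V \<C>)" using that(3) by auto
    then show False using contra that(1,2) by blast
  qed
  have "|{x :: nat \<Rightarrow> unit \<times> nat. range x \<subseteq> UNIV}| <o |UNIV :: 'k set|"
    by (rule seqs_small_fun[OF countable_lt_k]) simp
  \<comment> \<open>Demands at stage \<open>n\<close> will be sets of size at most
    \<open>\<kappa> (m + n)\<close>. With this \<open>m\<close>, the union of one demand for each
    sequence of colours and lengths is again so small, as \<open>directed\<close> requires.\<close>
  then obtain m where m: "|UNIV :: (nat \<Rightarrow> unit \<times> nat) set| \<le>o |K m|" using small_iff by auto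
  interpret fusion_game \<kappa> T0 "{()}" "\<lambda>n. {\<C>. |\<C>| \<le>o |K (m + n)| }" "\<lambda>n q \<C> V. bdd V \<C>"
  proof unfold_locales
    show "|{()}| <o |UNIV :: 'k set|" by (rule countable_lt_k) simp
    show "{\<C> :: 'k list set wtop set. |\<C>| \<le>o |K (m + n)| } \<noteq> {}" for n
      using card_of_empty[of "K (m + n)"] by blast
    show "bdd V' \<C>" if "bdd V \<C>" "V' \<subseteq> V" for V V' \<C> using bdd_mono that by blast
    show "\<exists>d\<in>{\<C>. |\<C>| \<le>o |K (m + n)| }. \<forall>V\<in>PT. V \<subseteq> T0 \<longrightarrow> bdd V d \<longrightarrow> (\<forall>x. (\<forall>n. fst (x n) \<in> {()}) \<longrightarrow> bdd V (F x))"
      if F: "\<And>x. \<forall>n. fst (x n) \<in> {()} \<Longrightarrow> F x \<in> {\<C>. |\<C>| \<le>o |K (m + n)| }"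
      for n and F :: "(nat \<Rightarrow> unit \<times> nat) \<Rightarrow> 'k list set wtop set"
    proof (rule bexI[of _ "\<Union>x. F x"])
      show "(\<Union>x. F x) \<in> {\<C>. |\<C>| \<le>o |K (m + n)| }"
        using F m K_le[of m "m + n"] by (auto intro!: card_of_UN_le intro: ordLeq_transitive)
      show "\<forall>V\<in>PT. V \<subseteq> T0 \<longrightarrow> bdd V (\<Union>x. F x) \<longrightarrow> (\<forall>x. (\<forall>n. fst (x n) \<in> {()}) \<longrightarrow> bdd V (F x))"
        using bdd_mono by blast
    qed
    show "\<exists>q\<in>{()}. \<exists>V'\<in>PT. V' \<subseteq> V \<and> bdd V' (dd q)"
      if "V \<in> PT" "V \<subseteq> T0" "\<And>q. q \<in> {()} \<Longrightarrow> dd q \<in> {\<C>. |\<C>| \<le>o |K (m + n)| }" for n V and dd :: "unit \<Rightarrow> 'k list set wtop set"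
      using bd[OF that(1,2), of "dd ()"] that(3) small_iff by blast
  qed (use T0 in auto)
  obtain l and Sg :: "'k list set wtop set list \<Rightarrow> 'k list set set" where Sg: "\<And>ds. |Sg ds| \<le>o |UNIV :: 'k set|"
    and fuse: "\<And>dd. (\<And>n. |dd n| \<le>o |K (m + n)| ) \<Longrightarrow> (\<exists>T'\<in>PT. T' \<subseteq> T0 \<and> uniform T' l \<and>
        (\<forall>n. \<forall>S\<in>PT. S \<subseteq> T' \<longrightarrow> (\<exists>S'\<in>PT. S' \<subseteq> S \<and> (\<exists>V\<in>Sg (map dd [0..<Suc n]). S' \<subseteq> V))) \<and>
        (\<forall>n. \<forall>V\<in>Sg (map dd [0..<Suc n]). V \<in> PT \<and> V \<subseteq> T0 \<and> bdd V (dd n)))"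
    using run by (auto simp del: upt_Suc)
  define cf where "cf \<beta> = (SOME C. C \<subseteq> {..<\<beta>} \<and> |C| <o |UNIV :: 'k set| \<and> (\<forall>i<\<beta>. \<exists>c\<in>C. i \<le> c))" for \<beta> :: "'k list set wtop"
  have cf: "cf \<beta> \<subseteq> {..<\<beta>} \<and> |cf \<beta>| <o |UNIV :: 'k set| \<and> (\<forall>i<\<beta>. \<exists>c\<in>cf \<beta>. i \<le> c)" if "\<not> nonreach \<beta>" for \<beta>
    unfolding cf_def by (rule someI_ex) (rule reach_small[OF that])
  \<comment> \<open>One bound for all trees of a stage. It exists because there are at most \<kappa>
    of them and \<open>\<beta>\<close> has cofinality above \<kappa>. It becomes part of the next
    demand, which therefore depends on the trees answering the previous ones.\<close>
  define bb where "bb \<beta> ds = (SOME c. c < \<beta> \<and> (\<forall>V\<in>Sg ds. \<forall>w\<in>KU V. El w < \<beta> \<longrightarrow> El w \<le> c))" for \<beta> ds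
  \<comment> \<open>A cofinal set \<open>cf \<beta>\<close> has size below \<kappa>, but perhaps
    more than the current stage admits; it is added once \<open>\<kappa> (m + length ds)\<close> has
    caught up with its size.\<close>
  define nxt where "nxt ds = (if ds = [] then {Tp} else last ds \<union>
     (\<Union>\<beta>\<in>last ds. {c \<in> cf \<beta>. \<not> nonreach \<beta> \<and> |cf \<beta>| \<le>o |K (m + length ds)| }) \<union> (\<lambda>\<beta>. bb \<beta> ds) ` last ds)" for ds
  define L where "L = rec_nat [] (\<lambda>_ ds. ds @ [nxt ds])"
  define dd where "dd n = nxt (L n)" for n
  have L0: "L 0 = []" and LS: "L (Suc n) = L n @ [dd n]" for n by (auto simp: L_def dd_def)
  have Lmap: "L n = map dd [0..<n]" for n by (induction n) (auto simp: L0 LS)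
  have dd0: "dd 0 = {Tp}" by (simp add: dd_def L0 nxt_def)
  have ddS: "dd (Suc n) = dd n \<union>
     (\<Union>\<beta>\<in>dd n. {c \<in> cf \<beta>. \<not> nonreach \<beta> \<and> |cf \<beta>| \<le>o |K (m + Suc n)| }) \<union> (\<lambda>\<beta>. bb \<beta> (map dd [0..<Suc n])) ` dd n" for n
    unfolding dd_def[of "Suc n"] nxt_def by (simp add: LS) (simp add: Lmap)
  have dd_card: "|dd n| \<le>o |K (m + n)|" for n
  proof (induction n)
    case 0 show ?case unfolding dd0 by (rule ordLess_imp_ordLeq[OF singleton_lt])
  next
    case (Suc n)
    have 1: "|dd n| \<le>o |K (m + Suc n)|" using Suc K_le[of "m + n" "m + Suc n"] ordLeq_transitive by force
    have 2: "|{c \<in> cf \<beta>. \<not> nonreach \<beta> \<and> |cf \<beta>| \<le>o |K (m + Suc n)| }| \<le>o |K (m + Suc n)|" for \<beta>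
    proof (cases "|cf \<beta>| \<le>o |K (m + Suc n)|")
      case True
      have "|{c \<in> cf \<beta>. \<not> nonreach \<beta> \<and> |cf \<beta>| \<le>o |K (m + Suc n)| }| \<le>o |cf \<beta>|" by (rule card_of_mono1) auto
      then show ?thesis using True ordLeq_transitive by blast
    next
      case False
      then have "{c \<in> cf \<beta>. \<not> nonreach \<beta> \<and> |cf \<beta>| \<le>o |K (m + Suc n)| } = {}" by blast
      then show ?thesis by (metis card_of_empty)
    qed
    have 3: "|(\<lambda>\<beta>. bb \<beta> (map dd [0..<Suc n])) ` dd n| \<le>o |K (m + Suc n)|"
      by (rule ordLeq_transitive[OF card_of_image 1])
    show ?case unfolding ddS
      by (intro Un_le_K 1 3 card_of_UN_le[OF infinite_K 1] 2)
  qed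
  have dd_mono: "m' \<le> n \<Longrightarrow> dd m' \<subseteq> dd n" for m' n
    by (rule lift_Suc_mono_le[of dd]) (auto simp: ddS)
  obtain T' where T0': "T' \<in> PT" "T' \<subseteq> T0"
    "\<forall>n. \<forall>S\<in>PT. S \<subseteq> T' \<longrightarrow> (\<exists>S'\<in>PT. S' \<subseteq> S \<and> (\<exists>V\<in>Sg (map dd [0..<Suc n]). S' \<subseteq> V))"
    "\<forall>n. \<forall>V\<in>Sg (map dd [0..<Suc n]). V \<in> PT \<and> V \<subseteq> T0 \<and> bdd V (dd n)"
    using fuse[of dd, OF dd_card] by (elim bexE conjE)
  have T': "T' \<in> PT" "T' \<subseteq> T0"
    "S \<in> PT \<Longrightarrow> S \<subseteq> T' \<Longrightarrow> (\<exists>S'\<in>PT. S' \<subseteq> S \<and> (\<exists>V\<in>Sg (map dd [0..<Suc n]). S' \<subseteq> V))"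
    "V \<in> Sg (map dd [0..<Suc n]) \<Longrightarrow> bdd V (dd n)" for n S V
    using T0'(3)[THEN spec, of n] T0'(4)[THEN spec, of n] T0'(1,2) by (simp_all del: upt_Suc)
  have bb: "bb \<beta> (map dd [0..<Suc n]) < \<beta>"
    "\<And>V w. V \<in> Sg (map dd [0..<Suc n]) \<Longrightarrow> w \<in> KU V \<Longrightarrow> El w < \<beta> \<Longrightarrow> El w \<le> bb \<beta> (map dd [0..<Suc n])"
    if \<beta>: "\<beta> \<in> dd n" "nonreach \<beta>" for \<beta> n
  proof -
    have "\<forall>V\<in>Sg (map dd [0..<Suc n]). \<exists>c<\<beta>. \<forall>w\<in>KU V. El w < \<beta> \<longrightarrow> El w \<le> c"
      using T'(4) \<beta> unfolding bdd_def by blast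
    then obtain b where b: "\<And>V. V \<in> Sg (map dd [0..<Suc n]) \<Longrightarrow> b V < \<beta>"
      "\<And>V w. V \<in> Sg (map dd [0..<Suc n]) \<Longrightarrow> w \<in> KU V \<Longrightarrow> El w < \<beta> \<Longrightarrow> El w \<le> b V" by metis
    have "|b ` Sg (map dd [0..<Suc n])| \<le>o |UNIV :: 'k set|"
      by (rule ordLeq_transitive[OF card_of_image Sg])
    moreover have "b ` Sg (map dd [0..<Suc n]) \<subseteq> {..<\<beta>}" using b(1) by blast
    ultimately obtain i where i: "i < \<beta>" "\<And>V. V \<in> Sg (map dd [0..<Suc n]) \<Longrightarrow> b V < i"
      using \<beta>(2) unfolding nonreach_def by (metis (no_types, lifting) image_eqI)
    have "\<exists>c. c < \<beta> \<and> (\<forall>V\<in>Sg (map dd [0..<Suc n]). \<forall>w\<in>KU V. El w < \<beta> \<longrightarrow> El w \<le> c)"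
      using i b(2) by (meson less_imp_le order_trans)
    from someI_ex[OF this] show "bb \<beta> (map dd [0..<Suc n]) < \<beta>"
      "\<And>V w. V \<in> Sg (map dd [0..<Suc n]) \<Longrightarrow> w \<in> KU V \<Longrightarrow> El w < \<beta> \<Longrightarrow> El w \<le> bb \<beta> (map dd [0..<Suc n])"
      unfolding bb_def[symmetric] by blast+
  qed
  let ?D = "\<Union>n. dd n"
  have cover: "El w \<in> ?D" if w: "w \<in> KU T'" for w
  proof (rule ccontr)
    assume nin: "El w \<notin> ?D"
    define \<beta> where "\<beta> = (LEAST \<beta>. \<beta> \<in> ?D \<and> El w < \<beta>)"
    have "Tp \<in> ?D \<and> El w < Tp" using dd0 by auto
    then have \<beta>: "\<beta> \<in> ?D \<and> El w < \<beta>" unfolding \<beta>_def by (rule LeastI)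
    have least: "\<not> (c \<in> ?D \<and> El w \<le> c \<and> c < \<beta>)" for c
    proof
      assume c: "c \<in> ?D \<and> El w \<le> c \<and> c < \<beta>"
      then have "El w < c" using nin by (metis order_le_less)
      then show False using c not_less_Least[of c "\<lambda>\<beta>. \<beta> \<in> ?D \<and> El w < \<beta>"] unfolding \<beta>_def by blast
    qed
    obtain n where n: "\<beta> \<in> dd n" using \<beta> by blast
    show False
    proof (cases "nonreach \<beta>")
      case False
      obtain p where p: "|cf \<beta>| \<le>o |K p|" using cf[OF False] small_iff by blast
      define n' where "n' = max n p"
      have "|cf \<beta>| \<le>o |K (m + Suc n')|" using p K_le[of p "m + Suc n'"] ordLeq_transitive by (force simp: n'_def)
      moreover have "\<beta> \<in> dd n'" using n dd_mono[of n n'] by (auto simp: n'_def)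
      ultimately have "cf \<beta> \<subseteq> dd (Suc n')" unfolding ddS using False by blast
      moreover obtain c where "c \<in> cf \<beta>" "El w \<le> c" "c < \<beta>" using cf[OF False] \<beta> by blast
      ultimately show False using least[of c] by blast
    next
      case True
      obtain R where R: "R \<in> PT" "R \<subseteq> w" "R \<subseteq> T'" using w by (auto simp: KU_def KK_def compat_def)
      obtain S V where S: "S \<in> PT" "S \<subseteq> R" "V \<in> Sg (map dd [0..<Suc n])" "S \<subseteq> V" using T'(3)[OF R(1,3)] by blast
      obtain g where "w \<in> W g" using w by (auto simp: KU_def KK_def)
      moreover have "compat w V" unfolding compat_def
        by (intro bexI[OF _ S(1)] conjI S(4) order_trans[OF S(2) R(2)])
      ultimately have "w \<in> KU V" by (auto simp: KU_def KK_def)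
      then have "El w \<le> bb \<beta> (map dd [0..<Suc n])" using bb(2)[OF n True S(3)] \<beta> by blast
      moreover have "bb \<beta> (map dd [0..<Suc n]) \<in> ?D" using ddS[of n] n by blast
      ultimately show False using least bb(1)[OF n True] by blast
    qed
  qed
  have "|?D| \<le>o |UNIV :: 'k set|"
  proof (rule UN_le_k)
    show "|UNIV :: nat set| \<le>o |UNIV :: 'k set|" by (rule ordLess_imp_ordLeq[OF nat_lt_k])
    show "|dd n| \<le>o |UNIV :: 'k set|" for n by (rule ordLeq_transitive[OF dd_card card_of_mono1]) simp
  qed
  moreover have "|{w. El w \<in> ?D}| \<le>o |?D|"
    by (intro card_of_ordLeq[THEN iffD1] exI[of _ El]) (auto simp: inj_on_def)
  ultimately have "\<not> KU T' \<subseteq> {w. El w \<in> ?D}" using KU_not_covered[OF T'(1)] ordLeq_transitive by blast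
  then show False using cover by blast
qed

end

section \<open>Scales and ladders\<close>

lemma (in singular_card) nonreach_bound:
  assumes "nonreach (\<beta> :: 'o::wellorder)" "|X| \<le>o |UNIV :: 'k set|"
  shows "\<exists>i<\<beta>. \<forall>x\<in>X. x < \<beta> \<longrightarrow> x < i"
proof -
  have "|X \<inter> {..<\<beta>}| \<le>o |X|" by (rule card_of_mono1) auto
  then have "|X \<inter> {..<\<beta>}| \<le>o |UNIV :: 'k set|" using assms(2) ordLeq_transitive by blast
  then have "\<exists>i<\<beta>. \<forall>x\<in>X \<inter> {..<\<beta>}. x < i"
    using assms(1)[unfolded nonreach_def, THEN spec, of "X \<inter> {..<\<beta>}"] by auto
  then show ?thesis by auto
qed

locale scale = singular_card \<kappa> for \<kappa> :: "nat \<Rightarrow> 'k::wellorder" +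
  fixes \<beta> :: "nat \<Rightarrow> 'o::wellorder"
  assumes nonreach_\<beta>: "\<And>n. nonreach (\<beta> n)"
begin

definition Pr :: "(nat \<Rightarrow> 'o) set" where "Pr = {f. \<forall>n. f n < \<beta> n}"

definition le :: "(nat \<Rightarrow> 'o) \<Rightarrow> (nat \<Rightarrow> 'o) \<Rightarrow> bool" where
  "le f g \<longleftrightarrow> (\<exists>m. \<forall>n\<ge>m. f n \<le> g n)"

lemma le_refl: "le f f" by (auto simp: le_def)

lemma le_trans: "le f g \<Longrightarrow> le g h \<Longrightarrow> le f h"
  unfolding le_def by (meson max.boundedE order_trans)

lemma Pr_directed:
  assumes X: "X \<subseteq> Pr" "|X| \<le>o |UNIV :: 'k set|"
  shows "\<exists>h\<in>Pr. \<forall>x\<in>X. \<forall>n. x n < h n"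
proof -
  have "\<exists>i<\<beta> n. \<forall>x\<in>X. x n < i" for n
  proof -
    have "|(\<lambda>x. x n) ` X| \<le>o |UNIV :: 'k set|" by (rule ordLeq_transitive[OF card_of_image X(2)])
    from nonreach_bound[OF nonreach_\<beta>[of n] this] show ?thesis using X(1) by (auto simp: Pr_def)
  qed
  then obtain h where "\<And>n. h n < \<beta> n \<and> (\<forall>x\<in>X. x n < h n)" by metis
  then show ?thesis by (intro bexI[of _ h]) (auto simp: Pr_def)
qed

definition unbounded :: "((nat \<Rightarrow> 'o) wtop \<Rightarrow> nat \<Rightarrow> 'o) \<Rightarrow> (nat \<Rightarrow> 'o) wtop \<Rightarrow> bool" where
  "unbounded F a \<longleftrightarrow> (\<forall>x<a. F x \<in> Pr) \<and> \<not> (\<exists>h\<in>Pr. \<forall>x<a. le (F x) h)"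

text \<open>The whole product, indexed by itself. The carrier
  \<open>(nat \<Rightarrow> 'o) wtop\<close> of the lengths is chosen to have room for this
  family.\<close>

lemma ex_unbounded: "\<exists>F. unbounded F Tp"
proof -
  obtain h0 where h0: "h0 \<in> Pr" using Pr_directed[of "{}"] card_of_empty[of "UNIV :: 'k set"] by auto
  define F where "F x = (case x of El f \<Rightarrow> if f \<in> Pr then f else h0 | Tp \<Rightarrow> h0)" for x
  have "\<not> (\<forall>x<Tp. le (F x) h)" if h: "h \<in> Pr" for h
  proof
    assume *: "\<forall>x<Tp. le (F x) h"
    obtain g where g: "g \<in> Pr" "\<And>n. h n < g n"
      using Pr_directed[of "{h}"] h single_le_k[of h] by auto
    have "le g h" using *[THEN spec, of "El g"] g(1) by (simp add: F_def)
    then show False using g(2) unfolding le_def by (meson le_refl not_le order_refl)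
  qed
  then show ?thesis using h0 by (intro exI[of _ F]) (auto simp: unbounded_def F_def split: wtop.splits)
qed

text \<open>
  The least length of an unbounded family modulo finite sets. It plays the role of a regular
  cardinal above \<open>\<kappa>\<close>, see \<open>bound_small\<close> and \<open>bound_seg\<close>.
\<close>

definition \<theta> :: "(nat \<Rightarrow> 'o) wtop" where "\<theta> = (LEAST a. \<exists>F. unbounded F a)"

definition F0 where "F0 = (SOME F. unbounded F \<theta>)"

lemma F0: "unbounded F0 \<theta>"
proof -
  have "\<exists>F. unbounded F \<theta>"
    unfolding \<theta>_def by (rule LeastI_ex[of "\<lambda>a. \<exists>F. unbounded F a"]) (use ex_unbounded in blast)
  then show ?thesis unfolding F0_def by (rule someI_ex)
qed

lemma below_\<theta>:
  assumes "a < \<theta>" "\<And>x. x < a \<Longrightarrow> F x \<in> Pr"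
  shows "\<exists>h\<in>Pr. \<forall>x<a. le (F x) h"
  using not_less_Least[of a "\<lambda>a. \<exists>F. unbounded F a"] assms unfolding \<theta>_def unbounded_def by blast

text \<open>An unbounded family of least length can be made increasing modulo finite sets: at each
  step the values so far form a shorter family, which is bounded.\<close>

lemma ex_chain: "\<exists>f. \<forall>a. a < \<theta> \<longrightarrow> f a \<in> Pr \<and> le (F0 a) (f a) \<and> (\<forall>x<a. le (f x) (f a))"
proof (rule dependent_wf_choice[of "{(x, y). x < y}"])
  show "wf {(x :: (nat \<Rightarrow> 'o) wtop, y). x < y}" by (rule wf)
  fix f and a :: "(nat \<Rightarrow> 'o) wtop"
  assume IH: "\<And>y. (y, a) \<in> {(x, y). x < y} \<Longrightarrow> y < \<theta> \<longrightarrow> f y \<in> Pr \<and> le (F0 y) (f y) \<and> (\<forall>x<y. le (f x) (f y))"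
  show "\<exists>r. a < \<theta> \<longrightarrow> r \<in> Pr \<and> le (F0 a) r \<and> (\<forall>x<a. le (f x) r)"
  proof (cases "a < \<theta>")
    case True
    then have "f x \<in> Pr" if "x < a" for x using IH[of x] that by auto
    then obtain h where h: "h \<in> Pr" "\<And>x. x < a \<Longrightarrow> le (f x) h" using below_\<theta>[OF True] by blast
    have "F0 a \<in> Pr" using F0 True by (auto simp: unbounded_def)
    then have "(\<lambda>n. max (F0 a n) (h n)) \<in> Pr" using h(1) by (auto simp: Pr_def)
    moreover have "le (F0 a) (\<lambda>n. max (F0 a n) (h n))" "le h (\<lambda>n. max (F0 a n) (h n))" by (auto simp: le_def)
    ultimately show ?thesis using h(2) le_trans by blast
  qed simp
qed simp

definition f where "f = (SOME f. \<forall>a. a < \<theta> \<longrightarrow> f a \<in> Pr \<and> le (F0 a) (f a) \<and> (\<forall>x<a. le (f x) (f a)))"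

lemma f: "a < \<theta> \<Longrightarrow> f a \<in> Pr" "a < \<theta> \<Longrightarrow> le (F0 a) (f a)" "a < \<theta> \<Longrightarrow> x \<le> a \<Longrightarrow> le (f x) (f a)"
  using someI_ex[OF ex_chain] unfolding f_def[symmetric] by (auto simp: le_refl order_le_less)

lemma f_unbounded: "h \<in> Pr \<Longrightarrow> \<exists>a<\<theta>. \<not> le (f a) h"
  using F0 f(2) le_trans unfolding unbounded_def by blast

text \<open>Some \<open>f a\<close> is not below \<open>h\<close> modulo finite sets; as
  \<open>f\<close> increases, this \<open>a\<close> exceeds every member of \<open>X\<close>. Bounds
  in the product thus become bounds in \<open>\<theta>\<close>.\<close>

lemma bound_\<theta>:
  assumes X: "X \<subseteq> {..<\<theta>}" and h: "h \<in> Pr" "\<And>x. x \<in> X \<Longrightarrow> le (f x) h"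
  shows "\<exists>a<\<theta>. \<forall>x\<in>X. x < a"
proof -
  obtain a where a: "a < \<theta>" "\<not> le (f a) h" using f_unbounded[OF h(1)] by blast
  have "x < a" if "x \<in> X" for x
  proof (rule ccontr)
    assume "\<not> x < a"
    then have "le (f a) (f x)" using f(3)[of x a] X that by auto
    then show False using a h(2)[OF that] le_trans by blast
  qed
  then show ?thesis using a by blast
qed

lemma bound_small:
  assumes X: "X \<subseteq> {..<\<theta>}" "|X| \<le>o |UNIV :: 'k set|"
  shows "\<exists>a<\<theta>. \<forall>x\<in>X. x < a"
proof -
  have "f ` X \<subseteq> Pr" "|f ` X| \<le>o |UNIV :: 'k set|"
    using X f(1) ordLeq_transitive[OF card_of_image X(2)] by auto
  then obtain h where h: "h \<in> Pr" "\<forall>x\<in>f ` X. \<forall>n. x n < h n" using Pr_directed by blast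
  then have "le (f x) h" if "x \<in> X" for x using that unfolding le_def by (meson image_eqI less_imp_le)
  then show ?thesis using bound_\<theta>[OF X(1) h(1)] by blast
qed

lemma bound_nat: "(\<And>n :: nat. u n < \<theta>) \<Longrightarrow> \<exists>a<\<theta>. \<forall>n. u n < a"
  using bound_small[of "range u"] countable_lt_k[of "range u"] ordLess_imp_ordLeq by auto

lemma bound_1: "c < \<theta> \<Longrightarrow> \<exists>a<\<theta>. c < a"
  using bound_nat[of "\<lambda>_. c"] by blast

text \<open>The substitute for regularity of \<open>\<theta>\<close>: the functions
  \<open>f (u x)\<close> form a family of length below \<open>\<theta>\<close> and are bounded by
  its minimality.\<close>

lemma bound_seg:
  assumes "c < \<theta>" "\<And>x. x \<le> c \<Longrightarrow> u x < \<theta>"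
  shows "\<exists>a<\<theta>. \<forall>x\<le>c. u x < a"
proof -
  obtain c' where c': "c < c'" "c' < \<theta>" using bound_1[OF assms(1)] by blast
  \<comment> \<open>Minimality of \<open>\<theta>\<close> speaks of all \<open>x\<close> below
    \<open>c'\<close>, so \<open>u\<close> gets the harmless value \<open>c\<close> beyond
    \<open>c\<close>.\<close>
  define v where "v x = (if x \<le> c then u x else c)" for x
  have v: "v x < \<theta>" for x using assms by (auto simp: v_def)
  obtain h where h: "h \<in> Pr" "\<forall>x<c'. le (f (v x)) h" using below_\<theta>[OF c'(2), of "\<lambda>x. f (v x)"] f(1) v by blast
  have "\<exists>a<\<theta>. \<forall>x\<in>v ` {..<c'}. x < a" by (rule bound_\<theta>[OF _ h(1)]) (use v h in auto)
  then obtain a where a: "a < \<theta>" "\<And>x. x < c' \<Longrightarrow> v x < a" by auto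
  have "u x < a" if "x \<le> c" for x using a(2)[of x] that c' by (simp add: v_def)
  then show ?thesis using a by blast
qed

section \<open>Ladders, and rungs that are hit stationarily often\<close>

definition ladder :: "(nat \<Rightarrow> 'o) wtop \<Rightarrow> (nat \<Rightarrow> (nat \<Rightarrow> 'o) wtop) \<Rightarrow> bool" where
  "ladder d l \<longleftrightarrow> (\<forall>m. l m < d) \<and> (\<forall>a<d. \<exists>m. a \<le> l m)"

text \<open>A ladder system; the value is arbitrary where \<open>d\<close> has no ladder. Rungs need
  not increase.\<close>

definition lad :: "(nat \<Rightarrow> 'o) wtop \<Rightarrow> nat \<Rightarrow> (nat \<Rightarrow> 'o) wtop" where
  "lad d = (SOME l. ladder d l)"

definition closed :: "((nat \<Rightarrow> 'o) wtop \<Rightarrow> (nat \<Rightarrow> 'o) wtop) \<Rightarrow> (nat \<Rightarrow> 'o) wtop \<Rightarrow> bool" where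
  "closed h d \<longleftrightarrow> (\<forall>a<d. h a < d)"

text \<open>The \<open>c\<close> for which the points \<open>d\<close> with n-th rung
  \<open>c\<close> are stationary in \<open>\<theta>\<close>; the points closed under a function
  \<open>h\<close> stand for a closed unbounded set.\<close>

definition hits :: "nat \<Rightarrow> (nat \<Rightarrow> 'o) wtop set" where
  "hits n = {c. c < \<theta> \<and> (\<forall>h. (\<forall>a<\<theta>. h a < \<theta>) \<longrightarrow> (\<exists>d<\<theta>. closed h d \<and> ladder d (lad d) \<and> lad d n = c))}"

text \<open>
  As in Fodor's lemma: if no coordinate \<open>n\<close> hit many \<open>c\<close> stationarily often, a diagonal intersection
  of the witnessing closed unbounded sets would contain a \<open>d\<close> whose ladder contradicts their choice.
\<close>

lemma ex_hits: "\<exists>n. |UNIV :: 'k set| \<le>o |hits n|"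
proof (rule ccontr)
  assume "\<not> ?thesis"
  then have small: "|hits n| \<le>o |UNIV :: 'k set|" for n
    using ordLeq_not_ordLess ordLess_imp_ordLeq by blast
  have "\<exists>a<\<theta>. \<forall>x\<in>hits n. x < a" for n by (rule bound_small[OF _ small]) (auto simp: hits_def)
  then obtain b where b: "\<And>n. b n < \<theta>" "\<And>n x. x \<in> hits n \<Longrightarrow> x < b n" by metis
  obtain b' where b': "b' < \<theta>" "\<And>n. b n < b'" using bound_nat[of b, OF b(1)] by blast
  have nh: "\<exists>h. (\<forall>a<\<theta>. h a < \<theta>) \<and> \<not> (\<exists>d<\<theta>. closed h d \<and> ladder d (lad d) \<and> lad d n = c)"
    if "b' \<le> c" "c < \<theta>" for n c
  proof -
    have "c \<notin> hits n" using b(2) b'(2) that by (meson less_trans not_le)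
    then show ?thesis using that(2) unfolding hits_def by blast
  qed
  \<comment> \<open>For each rung number \<open>n\<close> and each \<open>c\<close> from
    \<open>b'\<close> on, a function none of whose closure points has \<open>c\<close> as its n-th
    rung. The constant \<open>b'\<close> elsewhere keeps all values below
    \<open>\<theta>\<close>.\<close>
  define H where "H n c = (if b' \<le> c \<and> c < \<theta> then SOME h. (\<forall>a<\<theta>. h a < \<theta>) \<and> \<not> (\<exists>d<\<theta>. closed h d \<and> ladder d (lad d) \<and> lad d n = c) else (\<lambda>_. b'))" for n c
  have H1: "H n c a < \<theta>" if "a < \<theta>" for n c a
    using someI_ex[OF nh[of c n]] that b'(1) by (auto simp: H_def)
  have H2: "\<not> (\<exists>d<\<theta>. closed (H n c) d \<and> ladder d (lad d) \<and> lad d n = c)" if "b' \<le> c" "c < \<theta>" for n c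
    using someI_ex[OF nh[OF that, of n]] that by (auto simp: H_def)
  have "\<exists>e<\<theta>. a < e \<and> (\<forall>n. \<forall>c\<le>a. \<forall>x\<le>a. H n c x < e)" if a: "a < \<theta>" for a
  proof -
    have "\<exists>e<\<theta>. \<forall>x\<le>a. H n c x < e" for n c by (rule bound_seg[OF a]) (use H1 a in auto)
    then obtain e1 where e1: "\<And>n c. e1 n c < \<theta>" "\<And>n c x. x \<le> a \<Longrightarrow> H n c x < e1 n c" by metis
    have "\<exists>e<\<theta>. \<forall>c\<le>a. e1 n c < e" for n by (rule bound_seg[OF a, of "e1 n"]) (rule e1(1))
    then obtain e2 where e2: "\<And>n. e2 n < \<theta>" "\<And>n c. c \<le> a \<Longrightarrow> e1 n c < e2 n" by metis
    obtain e3 where e3: "e3 < \<theta>" "\<And>n. e2 n < e3" using bound_nat[of e2, OF e2(1)] by blast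
    have "max e3 a < \<theta>" using e3(1) a by simp
    then obtain e where e: "e < \<theta>" "max e3 a < e" using bound_1 by blast
    have "H n c x < e" if "c \<le> a" "x \<le> a" for n c x
      using e1(2)[OF that(2), of n c] e2(2)[OF that(1), of n] e3(2)[of n] e(2) by (meson less_trans max_less_iff_conj)
    then show ?thesis using e by auto
  qed
  then obtain h where h: "\<And>a. a < \<theta> \<Longrightarrow> h a < \<theta>" "\<And>a. a < \<theta> \<Longrightarrow> a < h a"
    "\<And>a n c x. a < \<theta> \<Longrightarrow> c \<le> a \<Longrightarrow> x \<le> a \<Longrightarrow> H n c x < h a" by metis
  define s where "s k = (h ^^ k) b'" for k
  have s0: "s 0 = b'" and sS: "s (Suc k) = h (s k)" for k by (auto simp: s_def)
  have s: "s k < \<theta>" for k by (induction k) (auto simp: s0 sS b' h)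
  define d where "d = (LEAST d. \<forall>k. s k < d)"
  obtain d1 where d1: "d1 < \<theta>" "\<forall>k. s k < d1" using bound_nat[of s, OF s] by blast
  have sd: "s k < d" for k using LeastI[of "\<lambda>d. \<forall>k. s k < d", OF d1(2)] unfolding d_def by blast
  have d\<theta>: "d < \<theta>" using Least_le[of "\<lambda>d. \<forall>k. s k < d", OF d1(2)] d1(1) unfolding d_def by simp
  have cof: "\<exists>k. a \<le> s k" if "a < d" for a
    using not_less_Least[of a "\<lambda>d. \<forall>k. s k < d"] that unfolding d_def by (auto simp: not_less)
  have cl: "closed (H n c) d" if "c < d" for n c
    unfolding closed_def
  proof (intro allI impI)
    fix a assume "a < d"
    then obtain k where "max a c \<le> s k" using cof[of "max a c"] \<open>c < d\<close> by auto
    then have "H n c a < h (s k)" using h(3)[OF s] by auto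
    then show "H n c a < d" using sd[of "Suc k"] by (simp add: sS)
  qed
  have "ladder d s" using sd cof by (auto simp: ladder_def)
  then have ld: "ladder d (lad d)" unfolding lad_def by (rule someI[of "ladder d"])
  \<comment> \<open>\<open>d\<close> is the supremum of the iterates starting at \<open>b'\<close>,
    so its ladder reaches \<open>b'\<close>. For the rung found, \<open>d\<close> is closed under
    the very function that was to exclude it.\<close>
  obtain n where "b' \<le> lad d n" using ld sd[of 0] unfolding ladder_def by (auto simp: s0)
  moreover have "lad d n < d" using ld unfolding ladder_def by blast
  ultimately show False using H2[OF _ less_trans[OF _ d\<theta>], of "lad d n" n] cl d\<theta> ld by blast
qed

definition nstar :: nat where "nstar = (SOME n. |UNIV :: 'k set| \<le>o |hits n| )"

lemma nstar: "|UNIV :: 'k set| \<le>o |hits nstar|"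
  unfolding nstar_def by (rule someI_ex[OF ex_hits])

definition lab :: "(nat \<Rightarrow> 'o) wtop \<Rightarrow> 'k" where
  "lab = (SOME lab. lab ` hits nstar = UNIV)"

lemma lab: "lab ` hits nstar = UNIV"
proof -
  have "\<exists>lab. lab ` hits nstar = (UNIV :: 'k set)"
    using nstar card_of_ordLeq2[of "UNIV :: 'k set" "hits nstar"] by simp
  then show ?thesis unfolding lab_def by (rule someI_ex)
qed

text \<open>The position of \<open>i\<close> in the scale. If \<open>i\<close> does not dominate the
  whole scale, \<open>f a\<close> is below \<open>i\<close> modulo finite sets exactly for the
  \<open>a\<close> below \<open>\<rho> i\<close>.\<close>

definition \<rho> :: "(nat \<Rightarrow> 'o) \<Rightarrow> (nat \<Rightarrow> 'o) wtop" where
  "\<rho> i = (LEAST a. a < \<theta> \<and> \<not> le (f a) i)"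

definition Lab :: "(nat \<Rightarrow> 'o) \<Rightarrow> 'k" where
  "Lab i = lab (lad (\<rho> i) nstar)"

text \<open>Induction on the length of the list, bounding one entry at a time;
  \<open>bound_seg\<close> handles the ordinals and \<open>bound_nat\<close> the numbers.\<close>

lemma list_bound:
  assumes "a < \<theta>" "\<And>sch. u sch < \<theta>"
  shows "\<exists>b<\<theta>. \<forall>sch :: ((nat \<Rightarrow> 'o) wtop \<times> nat) list. (\<forall>p\<in>set sch. fst p \<le> a) \<longrightarrow> u sch < b"
proof -
  have "\<exists>b<\<theta>. \<forall>sch :: ((nat \<Rightarrow> 'o) wtop \<times> nat) list. length sch = k \<and> (\<forall>p\<in>set sch. fst p \<le> a) \<longrightarrow> u sch < b"
    if "\<And>sch. u sch < \<theta>" for k u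
    using that
  proof (induction k arbitrary: u)
    case 0
    then show ?case using bound_1[of "u []"] by auto
  next
    case (Suc k)
    have "\<exists>b<\<theta>. \<forall>sch. length sch = k \<and> (\<forall>p\<in>set sch. fst p \<le> a) \<longrightarrow> u ((x, m) # sch) < b" for x m
      by (rule Suc.IH) (rule Suc.prems)
    then obtain b1 where b1: "\<And>x m. b1 x m < \<theta>"
      "\<And>x m sch. length sch = k \<Longrightarrow> \<forall>p\<in>set sch. fst p \<le> a \<Longrightarrow> u ((x, m) # sch) < b1 x m" by metis
    have "\<exists>b<\<theta>. \<forall>x\<le>a. b1 x m < b" for m by (rule bound_seg[OF assms(1), of "\<lambda>x. b1 x m"]) (rule b1(1))
    then obtain b2 where b2: "\<And>m. b2 m < \<theta>" "\<And>m x. x \<le> a \<Longrightarrow> b1 x m < b2 m" by metis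
    obtain b where b: "b < \<theta>" "\<And>m. b2 m < b" using bound_nat[of b2, OF b2(1)] by blast
    have "u sch < b" if "length sch = Suc k" "\<forall>p\<in>set sch. fst p \<le> a" for sch
    proof -
      obtain x m sch' where sch: "sch = (x, m) # sch'" using \<open>length sch = Suc k\<close> by (cases sch) auto
      have "u sch < b1 x m" using b1(2)[of sch'] sch that by simp
      also have "\<dots> < b2 m" using b2(2) sch that by simp
      also have "\<dots> < b" by (rule b(2))
      finally show ?thesis .
    qed
    then show ?case using b(1) by blast
  qed
  then have "\<exists>b<\<theta>. \<forall>sch. length sch = k \<and> (\<forall>p\<in>set sch. fst p \<le> a) \<longrightarrow> u sch < b" for k using assms(2) by blast
  then obtain b1 where b1: "\<And>k. b1 k < \<theta>" "\<And>k sch. length sch = k \<Longrightarrow> \<forall>p\<in>set sch. fst p \<le> a \<Longrightarrow> u sch < b1 k" by metis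
  obtain b where b: "b < \<theta>" "\<And>k. b1 k < b" using bound_nat[of b1, OF b1(1)] by blast
  then show ?thesis using b1(2) by (meson less_trans)
qed

text \<open>A pair \<open>(a, m)\<close> of a schedule asks to stay above \<open>f a\<close> from coordinate \<open>m\<close> on; \<open>LEAST x. True\<close> is the default.\<close>

definition dem :: "((nat \<Rightarrow> 'o) wtop \<times> nat) list \<Rightarrow> nat \<Rightarrow> 'o" where
  "dem sch n = Max (insert (LEAST x. True) ((\<lambda>p. f (fst p) n) ` {p \<in> set sch. snd p \<le> n}))"

lemma dem_less:
  assumes "\<And>p. p \<in> set sch \<Longrightarrow> fst p < \<theta>"
  shows "dem sch n < \<beta> n"
proof -
  have "(LEAST x. True) < \<beta> n"
    using nonreach_bound[OF nonreach_\<beta>[of n], of "{}"] card_of_empty[of "UNIV :: 'k set"]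
    by (auto intro: le_less_trans[OF Least_le])
  then show ?thesis using assms f(1) by (auto simp: dem_def Pr_def)
qed

lemma dem_ge: "p \<in> set sch \<Longrightarrow> snd p \<le> n \<Longrightarrow> f (fst p) n \<le> dem sch n"
  by (auto simp: dem_def)

lemma dem_cong: "{p \<in> set sch. snd p \<le> n} = {p \<in> set sch'. snd p \<le> n} \<Longrightarrow> dem sch n = dem sch' n"
  by (simp add: dem_def)

text \<open>\<open>B\<close> says how large the index at a coordinate may be once the demands up to
  there are made. For a point \<open>d\<close> with the right rung, \<open>\<rho> i = d\<close> is
  achieved from both sides. The demands take up one rung of \<open>d\<close> after another, so that
  \<open>i\<close> finally dominates \<open>f a\<close> for every \<open>a < d\<close>. Between two
  rungs the schedule is kept until a coordinate where \<open>B\<close> falls below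
  \<open>f d\<close>, so \<open>i\<close> does not dominate \<open>f d\<close>.\<close>

theorem Lab_realized:
  assumes B: "\<And>ds n. length ds = Suc n \<Longrightarrow> B ds < \<beta> n"
  shows "\<exists>dd. (\<forall>n. dd n < \<beta> n) \<and>
    (\<forall>i. (\<forall>n. dd n \<le> i n \<and> i n < B (map dd [0..<Suc n])) \<longrightarrow> Lab i = \<xi>)"
proof -
  obtain c where c: "c \<in> hits nstar" "lab c = \<xi>" using lab by (metis UNIV_I imageE)
  \<comment> \<open>The bounds that would result if the schedule \<open>sch\<close> were never
    changed. They lie in the product, hence miss some member of the scale.\<close>
  define Hs where "Hs sch n = B (map (dem sch) [0..<Suc n])" for sch n
  have "Hs sch \<in> Pr" for sch unfolding Pr_def Hs_def using B by simp
  then have "\<exists>a<\<theta>. \<not> le (f a) (Hs sch)" for sch using f_unbounded by blast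
  then obtain al where al: "\<And>sch. al sch < \<theta>" "\<And>sch. \<not> le (f (al sch)) (Hs sch)" by metis
  have "\<exists>b<\<theta>. \<forall>sch. (\<forall>p\<in>set sch. fst p \<le> a) \<longrightarrow> al sch < b" if "a < \<theta>" for a
    by (rule list_bound[OF that al(1)])
  then obtain h where h: "\<And>a. a < \<theta> \<Longrightarrow> h a < \<theta>" "\<And>a sch. a < \<theta> \<Longrightarrow> \<forall>p\<in>set sch. fst p \<le> a \<Longrightarrow> al sch < h a"
    by metis
  obtain d where d: "d < \<theta>" "closed h d" "ladder d (lad d)" "lad d nstar = c"
    using c(1) h(1) unfolding hits_def by blast
  have ld: "lad d k < d" for k using d(3) by (auto simp: ladder_def)
  \<comment> \<open>\<open>d\<close> is closed under \<open>h\<close>, so \<open>al sch < d\<close>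
    for every schedule with ordinals below \<open>d\<close>. Hence \<open>f d\<close> dominates
    \<open>f (al sch)\<close>, which exceeds \<open>Hs sch\<close> at arbitrarily large
    coordinates.\<close>
  have step: "\<exists>n\<ge>m. Hs sch n < f d n" if sch: "\<forall>p\<in>set sch. fst p < d" for sch m
  proof -
    define a where "a = Max (insert (lad d 0) (fst ` set sch))"
    have a: "a < d" "\<forall>p\<in>set sch. fst p \<le> a" unfolding a_def using sch ld by auto
    then have "a < \<theta>" using d(1) by simp
    then have "al sch < d" using h(2)[OF _ a(2)] d(2) a(1) unfolding closed_def by (meson less_trans)
    then have "le (f (al sch)) (f d)" using f(3)[OF d(1)] by simp
    then obtain m' where m': "\<forall>n\<ge>m'. f (al sch) n \<le> f d n" by (auto simp: le_def)
    have "\<not> (\<forall>n\<ge>max m m'. f (al sch) n \<le> Hs sch n)" using al(2)[of sch] unfolding le_def by blast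
    then obtain n where "n \<ge> max m m'" "Hs sch n < f (al sch) n" by (auto simp: not_le)
    then show ?thesis using m' by (intro exI[of _ n]) (auto intro: less_le_trans)
  qed
  define nx where "nx m sch = (SOME n. n \<ge> m \<and> Hs sch n < f d n)" for m sch
  have nx: "nx m sch \<ge> m \<and> Hs sch (nx m sch) < f d (nx m sch)" if "\<forall>p\<in>set sch. fst p < d" for m sch
    unfolding nx_def using someI_ex[OF step[OF that, of m]] .
  \<comment> \<open>The next rung becomes active right after the coordinate supplied by
    \<open>nx\<close>, so the demands up to that coordinate, and with them the bound there, are
    those of the old schedule.\<close>
  define St where "St = rec_nat ([(lad d 0, 0)], 0 :: nat) (\<lambda>k (sch, m).
      let m' = Suc (nx m sch) in (sch @ [(lad d (Suc k), m')], m'))"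
  define SC where "SC k = fst (St k)" for k
  define M where "M k = snd (St k)" for k
  have SC0: "SC 0 = [(lad d 0, 0)]" and M0: "M 0 = 0" by (auto simp: SC_def M_def St_def)
  have MS: "M (Suc k) = Suc (nx (M k) (SC k))" and SCS: "SC (Suc k) = SC k @ [(lad d (Suc k), M (Suc k))]" for k
    by (auto simp: SC_def M_def St_def Let_def split: prod.splits)
  have SCset: "set (SC k) = (\<lambda>j. (lad d j, M j)) ` {..k}" for k
    by (induction k) (auto simp: SC0 M0 SCS atMost_Suc)
  have SCd: "\<forall>p\<in>set (SC k). fst p < d" for k by (auto simp: SCset ld)
  have Mlt: "M k < M (Suc k)" for k using nx[OF SCd, of "M k" k] MS[of k] by simp
  have Mmono: "strict_mono M" using Mlt by (simp add: strict_mono_Suc_iff)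
  define dd where "dd n = dem (SC n) n" for n
  \<comment> \<open>Rung \<open>j\<close> is active from \<open>M j\<close> on and
    \<open>M j \<ge> j\<close>, so \<open>SC n\<close> contains every rung active at
    \<open>n\<close>; before \<open>M (Suc k)\<close> no rung beyond \<open>k\<close> is
    active.\<close>
  have ddk: "dd n = dem (SC k) n" if "n < M (Suc k)" for n k
    unfolding dd_def
  proof (rule dem_cong)
    have "j \<le> n" if "M j \<le> n" for j using strict_mono_imp_increasing[OF Mmono, of j] that by linarith
    moreover have "j \<le> k" if "M j \<le> n" for j
    proof -
      have "M j < M (Suc k)" using \<open>n < M (Suc k)\<close> that by linarith
      then show ?thesis using strict_mono_less[OF Mmono] by auto
    qed
    ultimately show "{p \<in> set (SC n). snd p \<le> n} = {p \<in> set (SC k). snd p \<le> n}"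
      unfolding SCset by auto
  qed
  have "Lab i = \<xi>" if i: "\<And>n. dd n \<le> i n \<and> i n < B (map dd [0..<Suc n])" for i
  proof -
    have below: "le (f a) i" if "a < d" for a
    proof -
      obtain k where k: "a \<le> lad d k" using d(3) \<open>a < d\<close> by (auto simp: ladder_def)
      have "f (lad d k) n \<le> i n" if "n \<ge> max k (M k)" for n
      proof -
        have "f (fst (lad d k, M k)) n \<le> dem (SC n) n" by (rule dem_ge) (use that in \<open>auto simp: SCset\<close>)
        then show ?thesis using i[of n] unfolding dd_def[of n] by (auto intro: order_trans)
      qed
      then have "le (f (lad d k)) i" unfolding le_def by blast
      moreover have "le (f a) (f (lad d k))" using f(3)[OF _ k] ld[of k] d(1) by auto
      ultimately show ?thesis using le_trans by blast
    qed
    have "\<exists>n\<ge>m. i n < f d n" for m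
    proof -
      define n where "n = nx (M m) (SC m)"
      have n: "M m \<le> n" "Hs (SC m) n < f d n" using nx[OF SCd, of "M m" m] by (auto simp: n_def)
      have "dd x = dem (SC m) x" if "x \<le> n" for x using ddk[of x m] that MS[of m] by (simp add: n_def)
      then have "map dd [0..<Suc n] = map (dem (SC m)) [0..<Suc n]" by (auto simp del: upt_Suc)
      then have "i n < Hs (SC m) n" using i[of n] by (simp only: Hs_def)
      moreover have "m \<le> n" using strict_mono_imp_increasing[OF Mmono, of m] n by simp
      ultimately show ?thesis using n by (meson less_trans)
    qed
    then have nd: "\<not> le (f d) i" unfolding le_def by (meson not_le)
    have "\<rho> i = d"
      unfolding \<rho>_def by (rule Least_equality) (use d(1) nd below in \<open>auto simp: not_less[symmetric]\<close>)
    then show ?thesis using c d(4) by (simp add: Lab_def)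
  qed
  moreover have "dd n < \<beta> n" for n
    unfolding dd_def by (rule dem_less) (use SCd d(1) in force)
  ultimately show ?thesis by blast
qed

end

section \<open>Label systems\<close>

context singular_card
begin

definition label_system :: "('a \<Rightarrow> 'b \<Rightarrow> 'k list set set) \<Rightarrow> bool" where
  "label_system A \<longleftrightarrow>
    (\<forall>i x. A i x \<subseteq> PT) \<and>
    (\<forall>i x. \<forall>T\<in>A i x. \<forall>T'\<in>PT. T' \<subseteq> T \<longrightarrow> T' \<in> A i x) \<and>
    (\<forall>i x y. A i x \<inter> A i y \<noteq> {} \<longrightarrow> x = y) \<and>
    (\<forall>T\<in>PT. \<forall>x. \<exists>i. \<exists>T'\<in>A i x. T' \<subseteq> T)"

lemma label_systemD:
  assumes "label_system A"
  shows "T \<in> A i x \<Longrightarrow> T \<in> PT" "T \<in> A i x \<Longrightarrow> T' \<in> PT \<Longrightarrow> T' \<subseteq> T \<Longrightarrow> T' \<in> A i x"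
    "T \<in> A i x \<Longrightarrow> T \<in> A i y \<Longrightarrow> x = y" "T \<in> PT \<Longrightarrow> \<exists>i. \<exists>T'\<in>A i x. T' \<subseteq> T"
  using assms unfolding label_system_def by blast+

lemma natnat_small: "|UNIV :: (nat \<Rightarrow> nat) set| <o |UNIV :: 'k set|"
  using seqs_small_fun[OF countable_lt_k[of "UNIV :: nat set"]] by simp

lemma natnatnat_small: "|UNIV :: (nat \<Rightarrow> nat \<Rightarrow> nat) set| <o |UNIV :: 'k set|"
  using seqs_small_fun[OF natnat_small] by simp

lemma Times_small:
  assumes "|A| <o |UNIV :: 'k set|" "|B| <o |UNIV :: 'k set|"
  shows "|A \<times> B| <o |UNIV :: 'k set|"
proof -
  obtain m n where mn: "|A| \<le>o |K m|" "|B| \<le>o |K n|"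
    using assms(1)[unfolded small_iff] assms(2)[unfolded small_iff] by blast
  have "|A| \<le>o |K (max m n)|" "|B| \<le>o |K (max m n)|"
    by (rule ordLeq_transitive[OF mn(1) K_le], simp) (rule ordLeq_transitive[OF mn(2) K_le], simp)
  then have "|A \<times> B| \<le>o |K (max m n) \<times> K (max m n)|"
    by (rule ordLeq_transitive[OF card_of_Times_mono1 card_of_Times_mono2])
  also have "|K (max m n) \<times> K (max m n)| =o |K (max m n)|" by (rule card_of_Times_same_infinite) simp
  finally (ordLeq_ordIso_trans) show ?thesis using K_subset_UNIV ordLeq_ordLess_trans by blast
qed

lemma W_unique: "v \<in> W g \<Longrightarrow> w \<in> W g \<Longrightarrow> compat v w \<Longrightarrow> v = w"
  using W(1)[of g] by (auto simp: maxanti_def)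

text \<open>In the extension \<open>w n\<close> would be the member of \<open>W (\<rho> n)\<close>
  in the generic filter. \<open>T'\<close> leaves several candidates for it, and the label has to be
  the same for all of them.\<close>

definition labels :: "'k list set \<Rightarrow> ((nat \<Rightarrow> 'k list set) \<Rightarrow> 'k) \<Rightarrow> bool" where
  "labels T2 Lb \<longleftrightarrow> (\<forall>T\<in>PT. T \<subseteq> T2 \<longrightarrow> (\<forall>\<xi>. \<exists>\<rho>. \<exists>T'\<in>PT. T' \<subseteq> T \<and>
     (\<forall>w. (\<forall>n. w n \<in> KK (\<rho> n) T') \<longrightarrow> Lb w = \<xi>)))"

text \<open>One function \<open>Lb\<close> must serve all conditions below \<open>T2\<close>,
  although the ordinals \<open>\<beta> n\<close>, and with them the scale, vary with the condition.
  \<open>nxt\<close> recovers them from the indices: an index is always picked above all smaller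
  members of \<open>\<C>\<close>. As \<open>\<C>\<close> is small, the colours
  \<open>(g, \<beta>)\<close> are few enough for the game.\<close>

lemma ex_labels:
  assumes T0: "T0 \<in> PT"
  shows "\<exists>T2\<in>PT. T2 \<subseteq> T0 \<and> (\<exists>Lb. labels T2 Lb)"
proof -
  obtain T2 \<C> where T2: "T2 \<in> PT" "T2 \<subseteq> T0" and \<C>: "|\<C>| <o |UNIV :: 'k set|"
    and nb: "\<And>V. V \<in> PT \<Longrightarrow> V \<subseteq> T2 \<Longrightarrow> \<not> bdd V \<C>"
    using container[OF T0] by (elim bexE exE conjE) blast
  define nxt where "nxt i = (LEAST \<beta>. \<beta> \<in> \<C> \<and> i < \<beta>)" for i
  define Lb where "Lb w = (scale.Lab (\<lambda>n. nxt (El (w n))) (\<lambda>n. El (w n)) :: 'k)" for w :: "nat \<Rightarrow> 'k list set"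
  define Q where "Q = (UNIV :: (nat \<Rightarrow> nat) set) \<times> {\<beta> \<in> \<C>. nonreach \<beta>}"
  \<comment> \<open>All colours share the same set of demands, so a demand \<open>\<gamma>\<close>
    that is not below the \<open>\<beta>\<close> of the colour is void.\<close>
  define Resp where "Resp n q \<gamma> V \<longleftrightarrow> (\<exists>w\<in>W (fst q). V \<subseteq> w \<and> El w < snd q \<and> nxt (El w) = snd q \<and>
    (\<gamma> < snd q \<longrightarrow> \<gamma> \<le> El w))" for n :: nat and q :: "(nat \<Rightarrow> nat) \<times> 'k list set wtop" and \<gamma> V
  have C_le: "|{\<beta> \<in> \<C>. nonreach \<beta>}| \<le>o |\<C>|" by (rule card_of_mono1) auto
  have Q_small: "|Q| <o |UNIV :: 'k set|"
    unfolding Q_def by (rule Times_small[OF natnat_small ordLeq_ordLess_trans[OF C_le \<C>]])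
  have X_small: "|{x :: nat \<Rightarrow> ((nat \<Rightarrow> nat) \<times> 'k list set wtop) \<times> nat. \<forall>n. fst (x n) \<in> Q}| \<le>o |UNIV :: 'k set|"
  proof -
    have "|Q \<times> (UNIV :: nat set)| <o |UNIV :: 'k set|" by (rule Times_small[OF Q_small nat_lt_k])
    from seqs_small_fun[OF this] have "|{x :: nat \<Rightarrow> ((nat \<Rightarrow> nat) \<times> 'k list set wtop) \<times> nat. range x \<subseteq> Q \<times> UNIV}| <o |UNIV :: 'k set|" .
    moreover have "{x :: nat \<Rightarrow> ((nat \<Rightarrow> nat) \<times> 'k list set wtop) \<times> nat. range x \<subseteq> Q \<times> UNIV} = {x. \<forall>n. fst (x n) \<in> Q}"
      by (simp add: image_subset_iff mem_Times_iff)
    ultimately show ?thesis by (simp only: ordLess_imp_ordLeq)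
  qed
  have "\<exists>\<rho>. \<exists>T'\<in>PT. T' \<subseteq> T \<and> (\<forall>w. (\<forall>n. w n \<in> KK (\<rho> n) T') \<longrightarrow> Lb w = \<xi>)" if T: "T \<in> PT" "T \<subseteq> T2" for T \<xi>
  proof -
    interpret g: fusion_game \<kappa> T Q "\<lambda>_. UNIV" Resp
    proof unfold_locales
      show "\<exists>d\<in>UNIV. \<forall>V\<in>PT. V \<subseteq> T \<longrightarrow> Resp n q d V \<longrightarrow> (\<forall>x. (\<forall>n. fst (x n) \<in> Q) \<longrightarrow> Resp n q (F x) V)"
        if q: "q \<in> Q" for n q and F :: "(nat \<Rightarrow> ((nat \<Rightarrow> nat) \<times> 'k list set wtop) \<times> nat) \<Rightarrow> 'k list set wtop"
      proof -
        have "nonreach (snd q)" using q by (auto simp: Q_def)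
        from nonreach_bound[OF this ordLeq_transitive[OF card_of_image[of F] X_small]]
        obtain i where i: "i < snd q" "\<And>x. \<forall>n. fst (x n) \<in> Q \<Longrightarrow> F x < snd q \<Longrightarrow> F x < i" by blast
        then have "Resp n q (F x) V" if "Resp n q i V" "\<forall>n. fst (x n) \<in> Q" for V x
          using that unfolding Resp_def by (meson less_imp_le order_trans)
        then show ?thesis by blast
      qed
      show "\<exists>q\<in>Q. \<exists>V'\<in>PT. V' \<subseteq> V \<and> Resp n q (dd q) V'" if V: "V \<in> PT" "V \<subseteq> T" for n V dd
      proof -
        have "\<not> bdd V \<C>" using nb V T by blast
        then obtain \<beta> where \<beta>: "\<beta> \<in> \<C>" "nonreach \<beta>" and un: "\<And>c. c < \<beta> \<Longrightarrow> \<exists>w\<in>KU V. El w < \<beta> \<and> c < El w"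
          unfolding bdd_def by (meson not_le)
        have "|\<C>| \<le>o |UNIV :: 'k set|" using \<C> ordLess_imp_ordLeq by blast
        then obtain i1 where i1: "i1 < \<beta>" "\<forall>x\<in>\<C>. x < \<beta> \<longrightarrow> x < i1" using nonreach_bound[OF \<beta>(2)] by blast
        \<comment> \<open>\<open>g\<close> is known only after \<open>w\<close> has been found in
          \<open>KU V\<close>. So \<open>w\<close> is taken above the demands for all colours
          \<open>(g, \<beta>)\<close> at once, of which there are few.\<close>
        have "|(\<lambda>g. dd (g, \<beta>)) ` UNIV| \<le>o |UNIV :: 'k set|"
          by (rule ordLeq_transitive[OF card_of_image ordLess_imp_ordLeq[OF natnat_small]])
        then obtain i2 where i2: "i2 < \<beta>" "\<And>g. dd (g, \<beta>) < \<beta> \<Longrightarrow> dd (g, \<beta>) < i2" using nonreach_bound[OF \<beta>(2)] by blast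
        obtain w where w: "w \<in> KU V" "El w < \<beta>" "max i1 i2 < El w" using un[of "max i1 i2"] i1 i2 by auto
        then obtain g V' where g: "w \<in> W g" and V': "V' \<in> PT" "V' \<subseteq> w" "V' \<subseteq> V" by (auto simp: KU_def KK_def compat_def)
        have "nxt (El w) = \<beta>"
          unfolding nxt_def
        proof (rule Least_equality)
          fix y assume y: "y \<in> \<C> \<and> El w < y"
          then have "\<not> y < \<beta>" using i1(2) w(3) by auto
          then show "\<beta> \<le> y" by simp
        qed (use \<beta> w in simp)
        then have "Resp n (g, \<beta>) (dd (g, \<beta>)) V'"
          unfolding Resp_def using g V'(2) w i2(2)[of g] by (intro bexI[of _ w]) auto
        moreover have "(g, \<beta>) \<in> Q" using \<beta> by (simp add: Q_def)
        ultimately show ?thesis using V' by blast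
      qed
      show "Resp n q d V'" if "Resp n q d V" "V' \<subseteq> V" for n q d V V'
        using that unfolding Resp_def by blast
    qed (use T Q_small in auto)
    obtain x l and Sg :: "'k list set wtop list \<Rightarrow> 'k list set set" where x: "\<And>n. x n \<in> Q"
      and Sg: "\<And>ds. |Sg ds| \<le>o |UNIV :: 'k set|"
      and fuse: "\<And>dd. \<exists>T'\<in>PT. T' \<subseteq> T \<and> uniform T' l \<and>
        (\<forall>n. \<forall>S\<in>PT. S \<subseteq> T' \<longrightarrow> (\<exists>S'\<in>PT. S' \<subseteq> S \<and> (\<exists>V\<in>Sg (map dd [0..<Suc n]). S' \<subseteq> V))) \<and>
        (\<forall>n. \<forall>V\<in>Sg (map dd [0..<Suc n]). V \<in> PT \<and> V \<subseteq> T \<and> Resp n (x n) (dd n) V)"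
      using g.run by (auto simp del: upt_Suc)
    define \<beta> where "\<beta> n = snd (x n)" for n
    define \<rho> where "\<rho> n = fst (x n)" for n
    interpret s: scale \<kappa> \<beta>
    proof
      show "nonreach (\<beta> n)" for n using x[of n] by (auto simp: Q_def \<beta>_def)
    qed
    \<comment> \<open>The members of the antichain decided by the trees of a stage. A perfect tree
      lies below at most one member, so there are at most \<kappa> of them, and their indices have a
      bound \<open>B ds\<close> below the ordinal of that stage. A list of \<open>Suc n\<close>
      demands belongs to stage \<open>n\<close>, whence \<open>length ds - 1\<close>.\<close>
    define below where "below ds = (\<Union>V\<in>{V \<in> Sg ds. V \<in> PT}. {w \<in> W (\<rho> (length ds - 1)). V \<subseteq> w})" for ds
    have "|below ds| \<le>o |UNIV :: 'k set|" for ds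
      unfolding below_def
    proof (rule UN_le_k)
      have "|{V \<in> Sg ds. V \<in> PT}| \<le>o |Sg ds|" by (rule card_of_mono1) auto
      then show "|{V \<in> Sg ds. V \<in> PT}| \<le>o |UNIV :: 'k set|" using Sg ordLeq_transitive by blast
      fix V assume V: "V \<in> {V \<in> Sg ds. V \<in> PT}"
      show "|{w \<in> W (\<rho> (length ds - 1)). V \<subseteq> w}| \<le>o |UNIV :: 'k set|"
      proof (cases "{w \<in> W (\<rho> (length ds - 1)). V \<subseteq> w} = {}")
        case True then show ?thesis by (simp only: card_of_empty)
      next
        case False
        then obtain w where "w \<in> W (\<rho> (length ds - 1))" "V \<subseteq> w" by blast
        then have "{w \<in> W (\<rho> (length ds - 1)). V \<subseteq> w} \<subseteq> {w}"
          using V W_unique unfolding compat_def by blast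
        then show ?thesis by (rule ordLeq_transitive[OF card_of_mono1 single_le_k])
      qed
    qed
    then have "|El ` below ds| \<le>o |UNIV :: 'k set|" for ds
      by (rule ordLeq_transitive[OF card_of_image])
    then have "\<exists>i<\<beta> (length ds - 1). \<forall>w\<in>below ds. El w < \<beta> (length ds - 1) \<longrightarrow> El w < i" for ds
      using nonreach_bound[OF s.nonreach_\<beta>, of "El ` below ds"] by simp
    then obtain B where B: "\<And>ds. B ds < \<beta> (length ds - 1)"
      "\<And>ds w. w \<in> below ds \<Longrightarrow> El w < \<beta> (length ds - 1) \<Longrightarrow> El w < B ds" by metis
    have "B ds < \<beta> n" if "length ds = Suc n" for ds n using B(1)[of ds] that by simp
    then obtain dd where dd: "\<And>n. dd n < \<beta> n"
      "\<And>i. (\<forall>n. dd n \<le> i n \<and> i n < B (map dd [0..<Suc n])) \<Longrightarrow> s.Lab i = \<xi>"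
      using s.Lab_realized[of B \<xi>] by blast
    obtain T' where T': "T' \<in> PT" "T' \<subseteq> T"
      "\<forall>n. \<forall>S\<in>PT. S \<subseteq> T' \<longrightarrow> (\<exists>S'\<in>PT. S' \<subseteq> S \<and> (\<exists>V\<in>Sg (map dd [0..<Suc n]). S' \<subseteq> V))"
      "\<forall>n. \<forall>V\<in>Sg (map dd [0..<Suc n]). V \<in> PT \<and> V \<subseteq> T \<and> Resp n (x n) (dd n) V"
      using fuse[of dd] by (elim bexE conjE)
    have "Lb w = \<xi>" if w: "\<And>n. w n \<in> KK (\<rho> n) T'" for w
    proof -
      have *: "nxt (El (w n)) = \<beta> n \<and> dd n \<le> El (w n) \<and> El (w n) < B (map dd [0..<Suc n])" for n
      proof -
        obtain R where R: "w n \<in> W (\<rho> n)" "R \<in> PT" "R \<subseteq> w n" "R \<subseteq> T'" using w[of n] by (auto simp: KK_def compat_def)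
        obtain S V where S: "S \<in> PT" "S \<subseteq> R" and V: "V \<in> Sg (map dd [0..<Suc n])" "S \<subseteq> V"
          using T'(3)[THEN spec, of n, THEN bspec, OF R(2), THEN mp, OF R(4)] by blast
        have VP: "V \<in> PT" and "Resp n (x n) (dd n) V" using T'(4)[THEN spec, of n, THEN bspec, OF V(1)] by blast+
        then obtain v where v: "v \<in> W (\<rho> n)" "V \<subseteq> v" "El v < \<beta> n" "nxt (El v) = \<beta> n" "dd n \<le> El v"
          using dd(1)[of n] unfolding Resp_def \<rho>_def \<beta>_def by blast
        have "compat (w n) v" unfolding compat_def
          by (intro bexI[OF _ S(1)] conjI order_trans[OF S(2) R(3)] order_trans[OF V(2) v(2)])
        then have wv: "w n = v" by (rule W_unique[OF R(1) v(1)])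
        have "v \<in> below (map dd [0..<Suc n])" unfolding below_def using v V(1) VP by auto
        then have "El v < B (map dd [0..<Suc n])" using B(2)[of v "map dd [0..<Suc n]"] v(3) by simp
        then show ?thesis using v wv by simp
      qed
      have "(\<lambda>n. nxt (El (w n))) = \<beta>" using * by auto
      then have "Lb w = s.Lab (\<lambda>n. El (w n))" by (simp add: Lb_def)
      then show ?thesis using dd(2)[of "\<lambda>n. El (w n)"] * by simp
    qed
    then show ?thesis by (intro exI[of _ \<rho>] bexI[OF _ T'(1)] conjI T'(2) allI impI) simp
  qed
  then have "labels T2 Lb" unfolding labels_def by (intro ballI impI allI)
  then show ?thesis using T2 by blast
qed

text \<open>A label function is only available below a suitable tree; a maximal antichain of such
  trees tells in the extension which function to use.\<close>

definition W2 :: "'k list set set" where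
  "W2 = (SOME X. maxanti X \<and> X \<subseteq> {T2 \<in> PT. \<exists>Lb. labels T2 Lb})"

lemma W2: "maxanti W2" "W2 \<subseteq> {T2 \<in> PT. \<exists>Lb. labels T2 Lb}"
proof -
  have "\<exists>X. maxanti X \<and> X \<subseteq> {T2 \<in> PT. \<exists>Lb. labels T2 Lb}"
  proof (rule ex_maxanti)
    show "\<exists>w\<in>{T2 \<in> PT. \<exists>Lb. labels T2 Lb}. w \<subseteq> T" if "T \<in> PT" for T
      using ex_labels[OF that] by auto
  qed auto
  from someI_ex[OF this] show "maxanti W2" "W2 \<subseteq> {T2 \<in> PT. \<exists>Lb. labels T2 Lb}" unfolding W2_def by blast+
qed

definition LB :: "'k list set \<Rightarrow> (nat \<Rightarrow> 'k list set) \<Rightarrow> 'k" where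
  "LB T2 = (SOME Lb. labels T2 Lb)"

lemma LB: "T2 \<in> W2 \<Longrightarrow> labels T2 (LB T2)"
  unfolding LB_def by (rule someI_ex[of "labels T2"]) (use W2 in blast)

definition A1 :: "(nat \<Rightarrow> nat \<Rightarrow> nat) \<Rightarrow> 'k \<Rightarrow> 'k list set set" where
  "A1 \<rho> \<xi> = {T \<in> PT. \<exists>T2\<in>W2. T \<subseteq> T2 \<and> (\<forall>w. (\<forall>n. w n \<in> KK (\<rho> n) T) \<longrightarrow> LB T2 w = \<xi>)}"

lemma A1: "label_system A1"
  unfolding label_system_def
proof (intro conjI allI ballI impI)
  show "A1 i x \<subseteq> PT" for i x by (auto simp: A1_def)
  fix i x T T' assume T: "T \<in> A1 i x" "T' \<in> PT" "T' \<subseteq> T"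
  have "w n \<in> KK (i n) T' \<Longrightarrow> w n \<in> KK (i n) T" for w n using KK_mono[OF T(3)] by blast
  then have all: "\<forall>w. (\<forall>n. w n \<in> KK (i n) T') \<longrightarrow> (\<forall>n. w n \<in> KK (i n) T)" by blast
  obtain T2 where T2: "T2 \<in> W2" "T \<subseteq> T2" "\<And>w. (\<forall>n. w n \<in> KK (i n) T) \<Longrightarrow> LB T2 w = x"
    using T(1) unfolding A1_def by blast
  show "T' \<in> A1 i x" unfolding A1_def
    using T(2) T2(1) order_trans[OF T(3) T2(2)] T2(3) all by blast
next
  fix i x y assume "A1 i x \<inter> A1 i y \<noteq> {}"
  then obtain T where T: "T \<in> A1 i x" "T \<in> A1 i y" by blast
  obtain T2 where T2: "T \<in> PT" "T2 \<in> W2" "T \<subseteq> T2" "\<And>w. (\<forall>n. w n \<in> KK (i n) T) \<Longrightarrow> LB T2 w = x"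
    using T(1) unfolding A1_def by blast
  obtain T3 where T3: "T3 \<in> W2" "T \<subseteq> T3" "\<And>w. (\<forall>n. w n \<in> KK (i n) T) \<Longrightarrow> LB T3 w = y"
    using T(2) unfolding A1_def by blast
  have "compat T2 T3" using T2 T3 unfolding compat_def by blast
  then have "T2 = T3" using W2(1) T2 T3 unfolding maxanti_def by blast
  moreover have "\<forall>n. \<exists>w. w \<in> KK (i n) T" using KK_ne[OF T2(1)] by blast
  then obtain w where "\<forall>n. w n \<in> KK (i n) T" by metis
  ultimately show "x = y" using T2(4) T3(3) by metis
next
  fix T x assume "T \<in> PT"
  then obtain T2 where T2: "T2 \<in> W2" "compat T2 T" using W2(1) unfolding maxanti_def by blast
  then obtain R where R: "R \<in> PT" "R \<subseteq> T2" "R \<subseteq> T" by (auto simp: compat_def)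
  then obtain i T' where T': "T' \<in> PT" "T' \<subseteq> R" "\<forall>w. (\<forall>n. w n \<in> KK (i n) T') \<longrightarrow> LB T2 w = x"
    using LB[OF T2(1), unfolded labels_def, THEN bspec, OF R(1)] by blast
  have "T' \<in> A1 i x" unfolding A1_def using T' order_trans[OF T'(2) R(2)] T2(1) by blast
  then show "\<exists>i. \<exists>T'\<in>A1 i x. T' \<subseteq> T" using order_trans[OF T'(2) R(3)] by blast
qed

lemmas A1D = label_systemD[OF A1]

text \<open>Membership in \<open>A1\<close> is asked only densely below \<open>T\<close>: a fusion
  decides stage \<open>n\<close> at its nodes, and \<open>T\<close> itself need not lie in any
  \<open>A1 (z n) (x n)\<close>.\<close>

definition A2 :: "(nat \<Rightarrow> nat \<Rightarrow> nat \<Rightarrow> nat) \<Rightarrow> (nat \<Rightarrow> 'k) \<Rightarrow> 'k list set set" where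
  "A2 z x = {T \<in> PT. \<forall>n. \<forall>S\<in>PT. S \<subseteq> T \<longrightarrow> (\<exists>S'\<in>A1 (z n) (x n). S' \<subseteq> S)}"

text \<open>For density, the game is played with the index of the label \<open>x n\<close> as the
  colour of stage \<open>n\<close>. These indices are fewer than \<kappa>, so all nodes of a stage
  can be made to use the same one, and the run supplies \<open>z\<close>.\<close>

lemma A2: "label_system A2"
  unfolding label_system_def
proof (intro conjI allI ballI impI)
  show "A2 i x \<subseteq> PT" for i x by (auto simp: A2_def)
  show "T' \<in> A2 i x" if "T \<in> A2 i x" "T' \<in> PT" "T' \<subseteq> T" for i x T T'
    using that unfolding A2_def by blast
next
  fix i x y assume "A2 i x \<inter> A2 i y \<noteq> {}"
  then obtain T where T: "T \<in> A2 i x" "T \<in> A2 i y" by blast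
  show "x = y"
  proof
    fix n
    obtain S where S: "S \<in> A1 (i n) (x n)" "S \<subseteq> T" using T(1) unfolding A2_def by blast
    have "S \<in> PT" using A1D(1)[OF S(1)] .
    then obtain S' where S': "S' \<in> A1 (i n) (y n)" "S' \<subseteq> S" using T(2) S unfolding A2_def by blast
    show "x n = y n"
      using A1D(3)[OF A1D(2)[OF S(1) A1D(1)[OF S'(1)] S'(2)] S'(1)] .
  qed
next
  fix T x assume T: "T \<in> PT"
  interpret g: fusion_game \<kappa> T "UNIV" "\<lambda>_. {()}" "\<lambda>n q _ V. V \<in> A1 q (x n)"
  proof unfold_locales
    show "\<exists>q\<in>UNIV. \<exists>V'\<in>PT. V' \<subseteq> V \<and> V' \<in> A1 q (x n)" if "V \<in> PT" for n V
      using A1D(4)[OF that, of "x n"] A1D(1) by blast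
  qed (use T natnatnat_small A1D(2) in auto)
  obtain z l and Sg :: "unit list \<Rightarrow> 'k list set set" where
    fuse: "\<exists>T'\<in>PT. T' \<subseteq> T \<and> uniform T' l \<and>
        (\<forall>n. \<forall>S\<in>PT. S \<subseteq> T' \<longrightarrow> (\<exists>S'\<in>PT. S' \<subseteq> S \<and> (\<exists>V\<in>Sg (map (\<lambda>_. ()) [0..<Suc n]). S' \<subseteq> V))) \<and>
        (\<forall>n. \<forall>V\<in>Sg (map (\<lambda>_. ()) [0..<Suc n]). V \<in> PT \<and> V \<subseteq> T \<and> V \<in> A1 (z n) (x n))"
    using g.run
  proof (elim exE conjE)
    fix z l and Sg :: "unit list \<Rightarrow> 'k list set set"
    assume "\<forall>dd. (\<forall>n :: nat. dd n \<in> {()}) \<longrightarrow> (\<exists>T'\<in>PT. T' \<subseteq> T \<and> uniform T' l \<and>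
        (\<forall>n. \<forall>S\<in>PT. S \<subseteq> T' \<longrightarrow> (\<exists>S'\<in>PT. S' \<subseteq> S \<and> (\<exists>V\<in>Sg (map dd [0..<Suc n]). S' \<subseteq> V))) \<and>
        (\<forall>n. \<forall>V\<in>Sg (map dd [0..<Suc n]). V \<in> PT \<and> V \<subseteq> T \<and> V \<in> A1 (z n) (x n)))"
    from this[THEN spec, of "\<lambda>_. ()"] show thesis by (intro that[of l Sg z]) simp
  qed
  then obtain T' where T': "T' \<in> PT" "T' \<subseteq> T"
      "\<forall>n. \<forall>S\<in>PT. S \<subseteq> T' \<longrightarrow> (\<exists>S'\<in>PT. S' \<subseteq> S \<and> (\<exists>V\<in>Sg (map (\<lambda>_. ()) [0..<Suc n]). S' \<subseteq> V))"
      "\<forall>n. \<forall>V\<in>Sg (map (\<lambda>_. ()) [0..<Suc n]). V \<in> PT \<and> V \<subseteq> T \<and> V \<in> A1 (z n) (x n)"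
    by (elim bexE conjE)
  have "\<exists>S'\<in>A1 (z n) (x n). S' \<subseteq> S" if S: "S \<in> PT" "S \<subseteq> T'" for n S
  proof -
    obtain S' V where S': "S' \<in> PT" "S' \<subseteq> S" "V \<in> Sg (map (\<lambda>_. ()) [0..<Suc n])" "S' \<subseteq> V"
      using T'(3)[THEN spec, of n, THEN bspec, OF S(1), THEN mp, OF S(2)] by blast
    then have "V \<in> A1 (z n) (x n)" using T'(4)[THEN spec, of n] by blast
    then have "S' \<in> A1 (z n) (x n)" by (rule A1D(2)[OF _ S'(1,4)])
    then show ?thesis using S'(2) by blast
  qed
  then have "T' \<in> A2 z x" using T' by (simp add: A2_def)
  then show "\<exists>i. \<exists>T'\<in>A2 i x. T' \<subseteq> T" using T'(2) by blast
qed

end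

section \<open>Base trees\<close>

definition mad :: "nat set set \<Rightarrow> bool" where
  "mad W \<longleftrightarrow> (\<forall>A\<in>W. infinite A) \<and> (\<forall>A\<in>W. \<forall>B\<in>W. A \<noteq> B \<longrightarrow> finite (A \<inter> B)) \<and>
     (\<forall>A. infinite A \<longrightarrow> (\<exists>B\<in>W. infinite (A \<inter> B)))"

definition mad_refines :: "nat set set \<Rightarrow> nat set set \<Rightarrow> bool" where
  "mad_refines R V \<longleftrightarrow> (\<forall>A\<in>R. \<exists>B\<in>V. finite (A - B))"

lemma madD:
  assumes "mad W"
  shows "A \<in> W \<Longrightarrow> infinite A" "A \<in> W \<Longrightarrow> B \<in> W \<Longrightarrow> A \<noteq> B \<Longrightarrow> finite (A \<inter> B)"
    "infinite A \<Longrightarrow> \<exists>B\<in>W. infinite (A \<inter> B)"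
  using assms unfolding mad_def by auto

lemma finite_Diff_trans: "finite (A - B) \<Longrightarrow> finite (B - C) \<Longrightarrow> finite (A - C)"
  by (rule finite_subset[of _ "(A - B) \<union> (B - C)"]) auto

lemma mad_refines_trans: "mad_refines R S \<Longrightarrow> mad_refines S V \<Longrightarrow> mad_refines R V"
  unfolding mad_refines_def by (meson finite_Diff_trans)

lemma infinite_almost_subset: "infinite A \<Longrightarrow> finite (A - B) \<Longrightarrow> infinite (A \<inter> B)"
  by (metis Int_Diff_Un finite_UnI)

lemma mad_unique:
  assumes "mad W" "v \<in> W" "w \<in> W" "infinite A" "finite (A - v)" "finite (A - w)"
  shows "v = w"
proof (rule ccontr)
  assume "v \<noteq> w"
  then have "finite (v \<inter> w)" using assms unfolding mad_def by blast
  moreover have "A \<subseteq> (A - v) \<union> (A - w) \<union> (v \<inter> w)" by blast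
  ultimately show False using assms finite_subset by (metis finite_UnI)
qed

lemma abs_bot: "abs_pow_fin A = bot \<longleftrightarrow> finite A"
  by (simp add: bot_pow_fin_def pow_fin.abs_eq_iff eq_mod_fin_def)

lemma abs_inf: "inf (abs_pow_fin A) (abs_pow_fin B) = abs_pow_fin (A \<inter> B)"
  by (rule inf_pow_fin.abs_eq)

lemma abs_le: "abs_pow_fin A \<le> abs_pow_fin B \<longleftrightarrow> finite (A - B)"
  by (rule less_eq_pow_fin.abs_eq)

lemma abs_rep [simp]: "abs_pow_fin (rep_pow_fin a) = a"
  by (rule Quotient3_abs_rep[OF Quotient3_pow_fin])

lemma maximal_antichain_mad:
  assumes "mad V"
  shows "maximal_antichain (abs_pow_fin ` V)"
  unfolding maximal_antichain_def
proof (intro conjI ballI impI allI)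
  show "bot \<notin> abs_pow_fin ` V" using assms abs_bot unfolding mad_def by (metis imageE)
  show "inf a b = bot" if "a \<in> abs_pow_fin ` V" "b \<in> abs_pow_fin ` V" "a \<noteq> b" for a b
  proof -
    obtain A B where "A \<in> V" "a = abs_pow_fin A" "B \<in> V" "b = abs_pow_fin B" using \<open>a \<in> _\<close> \<open>b \<in> _\<close> by blast
    then show ?thesis using madD(2)[OF assms, of A B] \<open>a \<noteq> b\<close> by (auto simp: abs_inf abs_bot)
  qed
  show "\<exists>a\<in>abs_pow_fin ` V. inf a b \<noteq> bot" if "b \<noteq> bot" for b
  proof -
    have "infinite (rep_pow_fin b)" using that abs_bot[of "rep_pow_fin b"] by simp
    then obtain A where "A \<in> V" "infinite (rep_pow_fin b \<inter> A)" using assms unfolding mad_def by blast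
    then have "inf (abs_pow_fin A) b \<noteq> bot"
      using abs_inf[of A "rep_pow_fin b"] abs_bot[of "A \<inter> rep_pow_fin b"] by (simp add: Int_commute)
    then show ?thesis using \<open>A \<in> V\<close> by blast
  qed
qed

lemma mad_maximal_antichain:
  assumes "maximal_antichain R"
  shows "mad (rep_pow_fin ` R)"
  unfolding mad_def
proof (intro conjI ballI impI allI)
  show "infinite A" if "A \<in> rep_pow_fin ` R" for A
    using that assms abs_bot unfolding maximal_antichain_def by (metis abs_rep imageE)
  show "finite (A \<inter> B)" if "A \<in> rep_pow_fin ` R" "B \<in> rep_pow_fin ` R" "A \<noteq> B" for A B
    using that assms abs_inf abs_bot unfolding maximal_antichain_def by (metis abs_rep imageE)
  show "\<exists>B\<in>rep_pow_fin ` R. infinite (A \<inter> B)" if "infinite A" for A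
  proof -
    have "abs_pow_fin A \<noteq> bot" using that by (simp add: abs_bot)
    then obtain a where a: "a \<in> R" "inf a (abs_pow_fin A) \<noteq> bot" using assms unfolding maximal_antichain_def by blast
    then have "infinite (A \<inter> rep_pow_fin a)"
      using abs_inf[of "rep_pow_fin a" A] abs_bot[of "rep_pow_fin a \<inter> A"] by (simp add: Int_commute)
    then show ?thesis using a by blast
  qed
qed

lemma distributive_law_mad:
  assumes law: "distributive_law TYPE(pow_fin) I" and V: "\<And>i. i \<in> I \<Longrightarrow> mad (V i)"
  shows "\<exists>R. mad R \<and> (\<forall>i\<in>I. mad_refines R (V i))"
proof -
  have "\<forall>i\<in>I. maximal_antichain (abs_pow_fin ` V i)" using V maximal_antichain_mad by blast
  then obtain R where "maximal_antichain R \<and> (\<forall>i\<in>I. refines R (abs_pow_fin ` V i))"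
    using law[unfolded distributive_law_def, THEN spec, of "\<lambda>i. abs_pow_fin ` V i"] by (auto simp only:)
  then have R: "maximal_antichain R" "\<And>i. i \<in> I \<Longrightarrow> refines R (abs_pow_fin ` V i)" by simp_all
  have "mad_refines (rep_pow_fin ` R) (V i)" if "i \<in> I" for i
    unfolding mad_refines_def
  proof
    fix A assume "A \<in> rep_pow_fin ` R"
    then obtain a where a: "a \<in> R" "A = rep_pow_fin a" by blast
    then obtain B where "B \<in> V i" "a \<le> abs_pow_fin B" using R(2)[OF \<open>i \<in> I\<close>] unfolding refines_def by blast
    then show "\<exists>B\<in>V i. finite (A - B)" using abs_le[of A B] a by auto
  qed
  then show ?thesis using mad_maximal_antichain[OF R(1)] by blast
qed

lemma not_distributive_law_mad:
  assumes "\<not> distributive_law TYPE(pow_fin) I"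
  shows "\<exists>V. (\<forall>i\<in>I. mad (V i)) \<and> \<not> (\<exists>R. mad R \<and> (\<forall>i\<in>I. mad_refines R (V i)))"
proof -
  obtain W where W: "\<And>i. i \<in> I \<Longrightarrow> maximal_antichain (W i)"
    "\<not> (\<exists>R :: pow_fin set. maximal_antichain R \<and> (\<forall>i\<in>I. refines R (W i)))"
    using assms unfolding distributive_law_def by blast
  have "\<not> (\<exists>R. mad R \<and> (\<forall>i\<in>I. mad_refines R (rep_pow_fin ` W i)))"
  proof
    assume "\<exists>R. mad R \<and> (\<forall>i\<in>I. mad_refines R (rep_pow_fin ` W i))"
    then obtain R where R: "mad R" "\<And>i. i \<in> I \<Longrightarrow> mad_refines R (rep_pow_fin ` W i)" by blast
    have "refines (abs_pow_fin ` R) (W i)" if "i \<in> I" for i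
      unfolding refines_def
    proof
      fix a assume "a \<in> abs_pow_fin ` R"
      then obtain A where "A \<in> R" "a = abs_pow_fin A" by blast
      then obtain b where "b \<in> W i" "finite (A - rep_pow_fin b)" using R(2)[OF \<open>i \<in> I\<close>] unfolding mad_refines_def by blast
      then show "\<exists>b\<in>W i. a \<le> b" using abs_le[of A "rep_pow_fin b"] \<open>a = abs_pow_fin A\<close> by auto
    qed
    then show False using W(2) maximal_antichain_mad[OF R(1)] by blast
  qed
  then show ?thesis using W(1) mad_maximal_antichain by (intro exI[of _ "\<lambda>i. rep_pow_fin ` W i"]) auto
qed

lemma mad_dense:
  assumes "\<And>A. infinite A \<Longrightarrow> \<exists>B\<in>E. B \<subseteq> A" "\<And>A. A \<in> E \<Longrightarrow> infinite A"
  shows "\<exists>R\<subseteq>E. mad R"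
proof -
  obtain M where M: "M \<subseteq> E" "\<forall>v\<in>M. \<forall>w\<in>M. v \<noteq> w \<longrightarrow> finite (v \<inter> w)"
    "\<forall>v\<in>E - M. \<exists>w\<in>M. \<not> finite (v \<inter> w) \<or> \<not> finite (w \<inter> v)"
    using ex_maximal_pairwise[of E "\<lambda>v w. finite (v \<inter> w)"] by blast
  have "\<exists>B\<in>M. infinite (A \<inter> B)" if A: "infinite A" for A
  proof -
    obtain v where v: "v \<in> E" "v \<subseteq> A" using assms(1)[OF A] by blast
    have "\<exists>w\<in>M. infinite (v \<inter> w)"
    proof (cases "v \<in> M")
      case True then show ?thesis using assms(2)[OF v(1)] by (intro bexI[of _ v]) auto
    next
      case False
      then obtain w where "w \<in> M" "\<not> finite (v \<inter> w) \<or> \<not> finite (w \<inter> v)" using M(3) v(1) by blast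
      then show ?thesis by (intro bexI[of _ w]) (auto simp: Int_commute)
    qed
    then show ?thesis using v(2) by (meson Int_mono finite_subset order_refl)
  qed
  moreover have "\<forall>A\<in>M. infinite A" using M(1) assms(2) by blast
  ultimately have "mad M" using M(2) unfolding mad_def by simp
  then show ?thesis using M(1) by blast
qed

lemma mad_meet:
  assumes "mad V" "mad W"
  shows "\<exists>R. mad R \<and> mad_refines R V \<and> mad_refines R W"
proof -
  define R where "R = {A \<inter> B | A B. A \<in> V \<and> B \<in> W \<and> infinite (A \<inter> B)}"
  have "mad R"
    unfolding mad_def
  proof (intro conjI ballI allI impI)
    show "infinite A" if "A \<in> R" for A using that by (auto simp: R_def)
    show "finite (A \<inter> B)" if "A \<in> R" "B \<in> R" "A \<noteq> B" for A B
    proof -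
      obtain A1 A2 where A: "A = A1 \<inter> A2" "A1 \<in> V" "A2 \<in> W" using \<open>A \<in> R\<close> unfolding R_def by blast
      obtain B1 B2 where B: "B = B1 \<inter> B2" "B1 \<in> V" "B2 \<in> W" using \<open>B \<in> R\<close> unfolding R_def by blast
      note * = A B
      have "A1 \<noteq> B1 \<or> A2 \<noteq> B2" using \<open>A \<noteq> B\<close> * by blast
      then have "finite (A1 \<inter> B1) \<or> finite (A2 \<inter> B2)"
        using madD(2)[OF assms(1), of A1 B1] madD(2)[OF assms(2), of A2 B2] * by blast
      then show ?thesis unfolding * by (auto intro: finite_subset[rotated])
    qed
    show "\<exists>B\<in>R. infinite (A \<inter> B)" if A: "infinite A" for A
    proof -
      obtain B where B: "B \<in> V" "infinite (A \<inter> B)" using A assms(1) unfolding mad_def by blast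
      then obtain C where C: "C \<in> W" "infinite (A \<inter> B \<inter> C)" using assms(2) unfolding mad_def by blast
      then have "infinite (B \<inter> C)" by (metis Int_lower2 finite_subset inf_assoc)
      then show ?thesis using B C by (intro bexI[of _ "B \<inter> C"]) (auto simp: R_def Int_assoc)
    qed
  qed
  moreover have "mad_refines R V" "mad_refines R W"
    unfolding mad_refines_def R_def by (force intro: finite_subset[of _ "{}"])+
  ultimately show ?thesis by blast
qed

lemma pseudo_intersection:
  fixes A :: "nat \<Rightarrow> nat set"
  assumes inf: "\<And>n. infinite (A n)" and dec: "\<And>n. A (Suc n) \<subseteq> A n"
  shows "\<exists>B. infinite B \<and> B \<subseteq> A 0 \<and> (\<forall>n. finite (B - A n))"
proof -
  have mono: "A n \<subseteq> A m" if "m \<le> n" for m n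
    using lift_Suc_antimono_le[of A, OF dec that] .
  have "\<exists>x. x \<in> A n \<and> x > y" for n y using inf[of n] by (metis infinite_nat_iff_unbounded)
  then obtain s where s: "\<And>n y. s n y \<in> A n" "\<And>n y. y < s n y" by metis
  define x where "x = rec_nat (s 0 0) (\<lambda>n y. s (Suc n) y)"
  have x0: "x 0 = s 0 0" and xS: "x (Suc n) = s (Suc n) (x n)" for n by (simp_all add: x_def)
  have xA: "x n \<in> A n" for n using s(1) by (cases n) (simp_all add: x0 xS)
  have "strict_mono x" unfolding strict_mono_Suc_iff using s(2) by (simp add: xS)
  then have "infinite (range x)" using range_inj_infinite strict_mono_imp_inj_on by blast
  moreover have "range x \<subseteq> A 0" using xA mono by blast
  moreover have "finite (range x - A n)" for n
  proof (rule finite_subset)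
    show "range x - A n \<subseteq> x ` {..<n}"
    proof
      fix y assume "y \<in> range x - A n"
      then obtain m where m: "y = x m" "x m \<notin> A n" by blast
      then have "m < n" using xA[of m] mono[of n m] by (meson not_le subsetD)
      then show "y \<in> x ` {..<n}" using m by blast
    qed
  qed simp
  ultimately show ?thesis by blast
qed

text \<open>Recursion along a well-order of \<open>I\<close> of least type: each \<open>i\<close>
  has fewer than \<open>|I|\<close> predecessors, so some element of \<open>C i\<close> has not been
  used yet.\<close>

lemma inj_choice:
  assumes I: "|I| \<le>o |UNIV :: 'c set|" and C: "\<And>i. i \<in> I \<Longrightarrow> |UNIV :: 'c set| \<le>o |C i|"
  shows "\<exists>f. inj_on f I \<and> (\<forall>i\<in>I. f i \<in> C i)"
proof -
  have wo: "Well_order |I|" by (rule card_of_Well_order)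
  have "\<exists>f. \<forall>i. i \<in> I \<longrightarrow> f i \<in> C i \<and> (\<forall>j\<in>underS |I| i. f j \<noteq> f i)"
  proof (rule dependent_wf_choice[of "|I| - Id"])
    show "wf ( |I| - Id)" using wo by (simp add: well_order_on_def)
    show "(i \<in> I \<longrightarrow> r \<in> C i \<and> (\<forall>j\<in>underS |I| i. f j \<noteq> r)) \<longleftrightarrow> (i \<in> I \<longrightarrow> r \<in> C i \<and> (\<forall>j\<in>underS |I| i. g j \<noteq> r))"
      if "\<And>j. (j, i) \<in> |I| - Id \<Longrightarrow> f j = g j" for f g i and r
      using that by (auto simp: underS_def)
    show "\<exists>r. i \<in> I \<longrightarrow> r \<in> C i \<and> (\<forall>j\<in>underS |I| i. f j \<noteq> r)" for i and f :: "'a \<Rightarrow> 'b"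
    proof (cases "i \<in> I")
      case True
      have "|underS |I| i| <o |I|" using True by (intro card_of_underS card_of_Card_order) (simp only: Field_card_of)
      then have "|f ` underS |I| i| <o |I|" using card_of_image ordLeq_ordLess_trans by blast
      moreover have "|I| \<le>o |C i|" using I C[OF True] ordLeq_transitive by blast
      ultimately have "|f ` underS |I| i| <o |C i|" using ordLess_ordLeq_trans by blast
      then have "\<not> C i \<subseteq> f ` underS |I| i" using card_of_mono1 not_ordLess_ordLeq by blast
      then show ?thesis by blast
    qed simp
  qed
  then obtain f where f: "\<And>i. i \<in> I \<Longrightarrow> f i \<in> C i" "\<And>i j. i \<in> I \<Longrightarrow> j \<in> underS |I| i \<Longrightarrow> f j \<noteq> f i" by blast
  have "inj_on f I"
  proof (rule inj_onI, rule ccontr)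
    fix i j assume ij: "i \<in> I" "j \<in> I" "f i = f j" "i \<noteq> j"
    then have "i \<in> underS |I| j \<or> j \<in> underS |I| i"
      using wo unfolding well_order_on_def linear_order_on_def total_on_def underS_def by (auto simp: Field_card_of)
    then show False using f(2) ij by metis
  qed
  then show ?thesis using f(1) by blast
qed

section \<open>A refining matrix of height \<open>h\<close>, and labels for its pieces\<close>

locale distributivity_number =
  fixes h :: "'h rel"
  assumes dn: "is_distributivity_number h"
begin

lemma card_h: "Card_order h" and wo_h: "Well_order h"
  using dn card_order_on_well_order_on unfolding is_distributivity_number_def by blast+

lemma total_h: "a \<in> Field h \<Longrightarrow> b \<in> Field h \<Longrightarrow> a = b \<or> a \<in> underS h b \<or> b \<in> underS h a"
  using wo_h unfolding well_order_on_def linear_order_on_def total_on_def underS_def by auto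

text \<open>The failure of the law is localised below one set: if below every infinite set there
  were one almost included in a member of each family, such sets would be dense, and a mad family of
  them would be a common refinement.\<close>

lemma ex_bad: "\<exists>V B0. (\<forall>a\<in>Field h. mad (V a)) \<and> infinite B0 \<and>
   \<not> (\<exists>A\<subseteq>B0. infinite A \<and> (\<forall>a\<in>Field h. \<exists>B\<in>V a. finite (A - B)))"
proof -
  obtain V where V: "\<forall>a\<in>Field h. mad (V a)" "\<not> (\<exists>R. mad R \<and> (\<forall>i\<in>Field h. mad_refines R (V i)))"
    using not_distributive_law_mad[of "Field h"] dn unfolding is_distributivity_number_def by blast
  let ?E = "{A. infinite A \<and> (\<forall>a\<in>Field h. \<exists>B\<in>V a. finite (A - B))}"
  have "\<exists>B0. infinite B0 \<and> \<not> (\<exists>A\<in>?E. A \<subseteq> B0)"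
  proof (rule ccontr)
    assume "\<not> ?thesis"
    then have "\<exists>R\<subseteq>?E. mad R" by (intro mad_dense) auto
    then show False using V(2) unfolding mad_refines_def by blast
  qed
  then obtain B0 where "infinite B0" "\<not> (\<exists>A\<in>?E. A \<subseteq> B0)" by (elim exE conjE)
  then show ?thesis using V(1) by (intro exI[of _ V] exI[of _ B0]) auto
qed

text \<open>By minimality of \<open>h\<close> the law holds for the levels below any
  \<open>a\<close>, so each new level can refine all earlier ones as well as
  \<open>V a\<close>.\<close>

lemma ex_matrix: "\<exists>W B0. infinite B0 \<and> (\<forall>a\<in>Field h. mad (W a)) \<and>
   (\<forall>a\<in>Field h. \<forall>b\<in>underS h a. mad_refines (W a) (W b)) \<and>
   \<not> (\<exists>A\<subseteq>B0. infinite A \<and> (\<forall>a\<in>Field h. \<exists>B\<in>W a. finite (A - B)))"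
proof -
  obtain V B0 where V: "\<And>a. a \<in> Field h \<Longrightarrow> mad (V a)" and B0: "infinite B0"
    "\<not> (\<exists>A\<subseteq>B0. infinite A \<and> (\<forall>a\<in>Field h. \<exists>B\<in>V a. finite (A - B)))"
    using ex_bad by (elim exE conjE) (rule that, blast+)
  have "\<exists>W. \<forall>a. a \<in> Field h \<longrightarrow> mad (W a) \<and> mad_refines (W a) (V a) \<and> (\<forall>b\<in>underS h a. mad_refines (W a) (W b))"
  proof (rule dependent_wf_choice[of "h - Id"])
    show "wf (h - Id)" using wo_h by (simp add: well_order_on_def)
    show "(a \<in> Field h \<longrightarrow> mad r \<and> mad_refines r (V a) \<and> (\<forall>b\<in>underS h a. mad_refines r (f b))) \<longleftrightarrow>
        (a \<in> Field h \<longrightarrow> mad r \<and> mad_refines r (V a) \<and> (\<forall>b\<in>underS h a. mad_refines r (g b)))"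
      if "\<And>b. (b, a) \<in> h - Id \<Longrightarrow> f b = g b" for f g a r
      using that by (auto simp: underS_def)
    fix W a assume IH: "\<And>b. (b, a) \<in> h - Id \<Longrightarrow> b \<in> Field h \<longrightarrow> mad (W b) \<and> mad_refines (W b) (V b) \<and> (\<forall>c\<in>underS h b. mad_refines (W b) (W c))"
    show "\<exists>r. a \<in> Field h \<longrightarrow> mad r \<and> mad_refines r (V a) \<and> (\<forall>b\<in>underS h a. mad_refines r (W b))"
    proof (cases "a \<in> Field h")
      case True
      have "|underS h a| <o h" by (rule card_of_underS[OF card_h True])
      then have "distributive_law TYPE(pow_fin) (Field |underS h a| )"
        using dn card_of_Card_order unfolding is_distributivity_number_def by blast
      then have law: "distributive_law TYPE(pow_fin) (underS h a)" by (simp only: Field_card_of)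
      have "mad (W b)" if "b \<in> underS h a" for b
        using IH[of b] that by (auto simp: underS_def Field_def)
      then obtain R where R: "mad R" "\<And>b. b \<in> underS h a \<Longrightarrow> mad_refines R (W b)"
        using distributive_law_mad[OF law, of W] by blast
      obtain S where "mad S" "mad_refines S R" "mad_refines S (V a)" using mad_meet[OF R(1) V[OF True]] by blast
      then show ?thesis using R(2) mad_refines_trans by blast
    qed simp
  qed
  then obtain W where W: "\<And>a. a \<in> Field h \<Longrightarrow> mad (W a)" "\<And>a. a \<in> Field h \<Longrightarrow> mad_refines (W a) (V a)"
    "\<And>a b. a \<in> Field h \<Longrightarrow> b \<in> underS h a \<Longrightarrow> mad_refines (W a) (W b)" by blast
  have "\<not> (\<exists>A\<subseteq>B0. infinite A \<and> (\<forall>a\<in>Field h. \<exists>B\<in>W a. finite (A - B)))"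
  proof
    assume "\<exists>A\<subseteq>B0. infinite A \<and> (\<forall>a\<in>Field h. \<exists>B\<in>W a. finite (A - B))"
    then obtain A where A: "A \<subseteq> B0" "infinite A" "\<And>a. a \<in> Field h \<Longrightarrow> \<exists>B\<in>W a. finite (A - B)" by blast
    have "\<exists>B\<in>V a. finite (A - B)" if "a \<in> Field h" for a
      using A(3)[OF that] W(2)[OF that] finite_Diff_trans unfolding mad_refines_def by meson
    then show False using A B0(2) by blast
  qed
  then show ?thesis using B0(1) W(1,3) by (intro exI[of _ W] exI[of _ B0] conjI ballI) auto
qed

definition mx where "mx = (SOME mx. \<exists>B0. infinite B0 \<and> (\<forall>a\<in>Field h. mad (mx a)) \<and>
   (\<forall>a\<in>Field h. \<forall>b\<in>underS h a. mad_refines (mx a) (mx b)) \<and>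
   \<not> (\<exists>A\<subseteq>B0. infinite A \<and> (\<forall>a\<in>Field h. \<exists>B\<in>mx a. finite (A - B))))"

definition B0 where "B0 = (SOME B0. infinite B0 \<and> (\<forall>a\<in>Field h. mad (mx a)) \<and>
   (\<forall>a\<in>Field h. \<forall>b\<in>underS h a. mad_refines (mx a) (mx b)) \<and>
   \<not> (\<exists>A\<subseteq>B0. infinite A \<and> (\<forall>a\<in>Field h. \<exists>B\<in>mx a. finite (A - B))))"

lemma mx: "infinite B0" "a \<in> Field h \<Longrightarrow> mad (mx a)"
   "a \<in> Field h \<Longrightarrow> b \<in> underS h a \<Longrightarrow> mad_refines (mx a) (mx b)"
   "A \<subseteq> B0 \<Longrightarrow> infinite A \<Longrightarrow> \<exists>a\<in>Field h. \<forall>B\<in>mx a. infinite (A - B)"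
proof -
  have "infinite B0 \<and> (\<forall>a\<in>Field h. mad (mx a)) \<and> (\<forall>a\<in>Field h. \<forall>b\<in>underS h a. mad_refines (mx a) (mx b)) \<and>
   \<not> (\<exists>A\<subseteq>B0. infinite A \<and> (\<forall>a\<in>Field h. \<exists>B\<in>mx a. finite (A - B)))"
    unfolding B0_def by (rule someI_ex) (unfold mx_def, rule someI_ex[OF ex_matrix])
  then show "infinite B0" "a \<in> Field h \<Longrightarrow> mad (mx a)"
   "a \<in> Field h \<Longrightarrow> b \<in> underS h a \<Longrightarrow> mad_refines (mx a) (mx b)"
   "A \<subseteq> B0 \<Longrightarrow> infinite A \<Longrightarrow> \<exists>a\<in>Field h. \<forall>B\<in>mx a. infinite (A - B)" by auto
qed

lemma mx_refines:
  assumes "a \<in> Field h" "b = a \<or> b \<in> underS h a" "u \<in> mx a"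
  shows "\<exists>w\<in>mx b. finite (u - w)"
  using assms mx(3)[of a b] unfolding mad_refines_def by (cases "b = a") (auto intro: bexI[of _ u])

text \<open>The tree property of the matrix: \<open>u\<close> is almost included in some member of
  the earlier level, and almost disjointness there leaves only \<open>w\<close>.\<close>

lemma mx_below:
  assumes "a \<in> Field h" "b \<in> Field h" "b = a \<or> b \<in> underS h a" "u \<in> mx a" "w \<in> mx b" "infinite (u \<inter> w)"
  shows "finite (u - w)"
proof -
  obtain v where v: "v \<in> mx b" "finite (u - v)" using mx_refines assms by blast
  have "u \<inter> w - v \<subseteq> u - v" by blast
  then have "finite (u \<inter> w - v)" using v(2) finite_subset by blast
  then have "v = w" using mad_unique[OF mx(2)[OF assms(2)] v(1) assms(5) assms(6)] by (metis Diff_Int Diff_cancel Un_empty_right finite.emptyI Diff_Int_distrib2 Int_Diff Int_absorb Diff_disjoint Int_empty_right)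
  then show ?thesis using v by simp
qed

text \<open>On a level where \<open>A\<close> is almost included in no member, a member
  \<open>u\<close> meets \<open>A\<close>, and the rest \<open>A - u\<close> is infinite and meets
  another one.\<close>

lemma split:
  assumes A: "A \<subseteq> B0" "infinite A"
  shows "\<exists>a\<in>Field h. \<exists>u\<in>mx a. \<exists>v\<in>mx a. u \<noteq> v \<and> infinite (A \<inter> u) \<and> infinite (A \<inter> v)"
proof -
  obtain a where a: "a \<in> Field h" "\<And>B. B \<in> mx a \<Longrightarrow> infinite (A - B)" using mx(4)[OF A] by blast
  note mad = mx(2)[OF a(1)]
  obtain u where u: "u \<in> mx a" "infinite (A \<inter> u)" using mad A(2) unfolding mad_def by blast
  obtain v where v: "v \<in> mx a" "infinite ((A - u) \<inter> v)" using mad a(2)[OF u(1)] unfolding mad_def by blast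
  have "(A - v) \<inter> v = {}" by blast
  then have "u \<noteq> v" using v(2) by auto
  moreover have "infinite (A \<inter> v)" using v(2) by (rule contrapos_nn) (erule finite_subset[rotated], blast)
  ultimately show ?thesis using a u v by blast
qed

text \<open>Otherwise countably many levels are cofinal. Members chosen successively on them have a
  pseudo-intersection inside \<open>B0\<close>, which is almost included in a member of every level,
  against the choice of \<open>B0\<close>.\<close>

lemma countable_bounded:
  assumes X: "\<And>n :: nat. x n \<in> Field h"
  shows "\<exists>a\<in>Field h. \<forall>n. x n = a \<or> x n \<in> underS h a"
proof (rule ccontr)
  assume no: "\<not> ?thesis"
  have cof: "\<exists>n. a \<in> underS h (x n)" if "a \<in> Field h" for a
  proof (rule ccontr)
    assume "\<nexists>n. a \<in> underS h (x n)"
    then have "\<forall>n. x n = a \<or> x n \<in> underS h a" using total_h[OF that X] by metis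
    then show False using no that by blast
  qed
  have "\<exists>w. infinite A \<longrightarrow> w \<in> mx (x n) \<and> infinite (A \<inter> w)" for A n
    using mx(2)[OF X[of n]] unfolding mad_def by blast
  then obtain w where w: "\<And>A n. infinite A \<Longrightarrow> w A n \<in> mx (x n) \<and> infinite (A \<inter> w A n)" by metis
  define A where "A = rec_nat B0 (\<lambda>n B. B \<inter> w B n)"
  have A0: "A 0 = B0" and AS: "A (Suc n) = A n \<inter> w (A n) n" for n by (simp_all add: A_def)
  have Ainf: "infinite (A n)" for n by (induction n) (auto simp: A0 AS mx(1) w)
  obtain B where B: "infinite B" "B \<subseteq> B0" "\<And>n. finite (B - A n)"
    using pseudo_intersection[of A, OF Ainf] by (auto simp: A0 AS)
  have Bw: "w (A n) n \<in> mx (x n)" "finite (B - w (A n) n)" for n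
    using w[OF Ainf] B(3)[of "Suc n"] by (auto simp: AS elim: finite_subset[rotated])
  obtain a where a: "a \<in> Field h" "\<And>C. C \<in> mx a \<Longrightarrow> infinite (B - C)" using mx(4)[OF B(2,1)] by blast
  obtain n where "a \<in> underS h (x n)" using cof[OF a(1)] by blast
  then obtain C where "C \<in> mx a" "finite (w (A n) n - C)" using mx_refines[OF X[of n] _ Bw(1)] by blast
  then show False using a(2) finite_Diff_trans Bw(2) by blast
qed

text \<open>A Cantor scheme of repeated splittings below \<open>A\<close>. Its countably many nodes
  use boundedly many levels; on a common later level \<open>a\<close>, each branch has a
  pseudo-intersection meeting some member, and that member is almost included in all choices along
  the branch. Different branches thus yield different members.\<close>

lemma continuum_split:
  assumes A: "A \<subseteq> B0" "infinite A"
  shows "\<exists>a\<in>Field h. |UNIV :: nat set set| \<le>o |{w \<in> mx a. infinite (A \<inter> w)}|"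
proof -
  have "\<exists>a u v. B \<subseteq> B0 \<longrightarrow> infinite B \<longrightarrow> a \<in> Field h \<and> u \<in> mx a \<and> v \<in> mx a \<and> u \<noteq> v \<and> infinite (B \<inter> u) \<and> infinite (B \<inter> v)" for B
    using split[of B] by blast
  then obtain al u v where sp: "\<And>B. B \<subseteq> B0 \<Longrightarrow> infinite B \<Longrightarrow>
    al B \<in> Field h \<and> u B \<in> mx (al B) \<and> v B \<in> mx (al B) \<and> u B \<noteq> v B \<and> infinite (B \<inter> u B) \<and> infinite (B \<inter> v B)" by metis
  define half where "half b B = (if b then u B else v B)" for b B
  define node where "node = foldl (\<lambda>B b. B \<inter> half b B) A"
  have nN: "node [] = A" and nS: "node (s @ [b]) = node s \<inter> half b (node s)" for s b by (auto simp: node_def)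
  have node: "node s \<subseteq> B0 \<and> infinite (node s)" for s
    by (induction s rule: rev_induct) (use A sp in \<open>auto simp: nN nS half_def\<close>)
  have halfW: "half b (node s) \<in> mx (al (node s))" for b s using sp node by (auto simp: half_def)
  have al: "al (node s) \<in> Field h" for s using sp node by blast
  obtain e :: "nat \<Rightarrow> bool list" where e: "surj e" using surj_from_nat by blast
  obtain a where a: "a \<in> Field h" and ae: "\<And>n. al (node (e n)) = a \<or> al (node (e n)) \<in> underS h a"
    using countable_bounded[of "\<lambda>n. al (node (e n))", OF al] by blast
  have aa: "al (node s) = a \<or> al (node s) \<in> underS h a" for s using ae e by (metis surjD)
  have "\<exists>B. infinite B \<and> B \<subseteq> A \<and> (\<forall>n. finite (B - node (map x [0..<n])))" for x
    using pseudo_intersection[of "\<lambda>n. node (map x [0..<n])"] node by (auto simp: nN nS)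
  then obtain Bx where Bx: "\<And>x. infinite (Bx x)" "\<And>x. Bx x \<subseteq> A" "\<And>x n. finite (Bx x - node (map x [0..<n]))" by metis
  have "\<exists>w\<in>mx a. infinite (Bx x \<inter> w)" for x by (rule madD(3)[OF mx(2)[OF a] Bx(1)])
  then obtain w where w: "\<And>x. w x \<in> mx a" "\<And>x. infinite (Bx x \<inter> w x)" by metis
  have wh: "finite (w x - half (x n) (node (map x [0..<n])))" for x n
  proof (rule mx_below[OF a al aa w(1) halfW])
    let ?H = "half (x n) (node (map x [0..<n]))"
    have "finite (Bx x - ?H)" using Bx(3)[of x "Suc n"] by (auto simp: nS elim: finite_subset[rotated])
    then have "finite (Bx x \<inter> w x - ?H)" by (rule finite_subset[rotated]) blast
    then have "infinite (Bx x \<inter> w x \<inter> ?H)" using infinite_almost_subset[OF w(2)] by blast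
    then show "infinite (w x \<inter> ?H)" by (rule contrapos_nn) (erule finite_subset[rotated], blast)
  qed
  have inj: "inj w"
  proof (rule injI, rule ccontr)
    fix x y assume xy: "w x = w y" "x \<noteq> y"
    define n where "n = (LEAST n. x n \<noteq> y n)"
    have n: "x n \<noteq> y n" unfolding n_def by (rule LeastI_ex) (use xy in auto)
    have "x m = y m" if "m < n" for m using not_less_Least[of m "\<lambda>n. x n \<noteq> y n"] that unfolding n_def by blast
    then have eq: "map x [0..<n] = map y [0..<n]" by simp
    let ?N = "node (map x [0..<n])"
    have "finite (w x - half (x n) ?N)" "finite (w x - half (y n) ?N)"
      using wh[of x n] wh[of y n] unfolding xy(1) eq .
    moreover have "infinite (w x)" using mx(2)[OF a] w(1) unfolding mad_def by blast
    ultimately have "half (x n) ?N = half (y n) ?N" using mad_unique[OF mx(2)[OF al] halfW halfW] by blast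
    then show False using n sp[of ?N] node by (auto simp: half_def split: if_splits)
  qed
  have "|UNIV :: nat set set| \<le>o |{w \<in> mx a. infinite (A \<inter> w)}|"
    unfolding card_of_ordLeq[symmetric]
  proof (intro exI conjI)
    show "inj_on (\<lambda>Z. w (\<lambda>n. n \<in> Z)) UNIV"
      using inj by (auto simp: inj_on_def) (metis Collect_mem_eq)+
    have "infinite (A \<inter> w x)" for x using w(2)[of x] Bx(2)[of x] by (meson Int_mono finite_subset order_refl)
    then show "(\<lambda>Z. w (\<lambda>n. n \<in> Z)) ` UNIV \<subseteq> {w \<in> mx a. infinite (A \<inter> w)}" using w(1) by blast
  qed
  then show ?thesis using a by blast
qed

definition rich :: "'h \<Rightarrow> nat set set" where
  "rich a = {A. A \<subseteq> B0 \<and> infinite A \<and> |UNIV :: nat set set| \<le>o |{w \<in> mx a. infinite (A \<inter> w)}| }"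

text \<open>There are at most continuum many pairs of a set \<open>A\<close> and a label, and
  continuum many members of the level meet \<open>A\<close>. So each pair can reserve a member of
  its own, and from a member both \<open>A\<close> and the label can be recovered.\<close>

lemma ex_pick: "\<exists>f. inj_on f (rich a \<times> UNIV) \<and>
  (\<forall>p\<in>rich a \<times> (UNIV :: nat set set). f p \<in> {w \<in> mx a. infinite (fst p \<inter> w)})"
proof (rule inj_choice)
  have "|rich a \<times> (UNIV :: nat set set)| \<le>o |(UNIV :: nat set set) \<times> (UNIV :: nat set set)|" by (rule card_of_mono1) auto
  also have "|(UNIV :: nat set set) \<times> (UNIV :: nat set set)| =o |UNIV :: nat set set|"
    by (rule card_of_Times_same_infinite) (simp add: Finite_Set.finite_set)
  finally (ordLeq_ordIso_trans) show "|rich a \<times> (UNIV :: nat set set)| \<le>o |UNIV :: nat set set|" .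
  show "|UNIV :: nat set set| \<le>o |{w \<in> mx a. infinite (fst p \<inter> w)}|" if "p \<in> rich a \<times> (UNIV :: nat set set)" for p
    using that by (auto simp: rich_def)
qed

definition pick :: "'h \<Rightarrow> nat set \<times> nat set \<Rightarrow> nat set" where
  "pick a = (SOME f. inj_on f (rich a \<times> UNIV) \<and> (\<forall>p\<in>rich a \<times> (UNIV :: nat set set). f p \<in> {w \<in> mx a. infinite (fst p \<inter> w)}))"

lemma pick: "inj_on (pick a) (rich a \<times> UNIV)" "A \<in> rich a \<Longrightarrow> pick a (A, Z) \<in> mx a"
  "A \<in> rich a \<Longrightarrow> infinite (A \<inter> pick a (A, Z))"
  using someI_ex[OF ex_pick[of a]] unfolding pick_def[symmetric] by auto

text \<open>The enumeration \<open>en\<close> transports the base tree from below \<open>B0\<close> to all infinite sets.\<close>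

definition en :: "nat \<Rightarrow> nat" where "en = enumerate B0"

lemma inj_en: "inj en" and en_B0: "en n \<in> B0"
  using bij_enumerate[OF mx(1)] unfolding en_def bij_betw_def by auto

lemma finite_en_image [simp]: "finite (en ` B) \<longleftrightarrow> finite B"
  by (simp add: finite_image_iff inj_on_subset[OF inj_en])

definition base :: "'h \<Rightarrow> nat set \<Rightarrow> nat set set" where
  "base a Z = {B. infinite B \<and> (\<exists>A\<in>rich a. finite (en ` B - A \<inter> pick a (A, Z)))}"

lemma base_infinite: "B \<in> base a Z \<Longrightarrow> infinite B"
  by (simp add: base_def)

lemma base_down:
  assumes "B \<in> base a Z" "infinite B'" "finite (B' - B)"
  shows "B' \<in> base a Z"
proof -
  obtain A where A: "A \<in> rich a" "finite (en ` B - A \<inter> pick a (A, Z))" using assms unfolding base_def by blast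
  have "finite (en ` B' - en ` B)"
    by (rule finite_subset[of _ "en ` (B' - B)"]) (use assms(3) in auto)
  then have "finite (en ` B' - A \<inter> pick a (A, Z))" using A(2) finite_Diff_trans by blast
  then show ?thesis using A(1) assms(2) unfolding base_def by blast
qed

lemma base_consistent:
  assumes a: "a \<in> Field h" and B: "B \<in> base a Z" "B \<in> base a Z'"
  shows "Z = Z'"
proof -
  obtain A A' where A: "A \<in> rich a" "finite (en ` B - A \<inter> pick a (A, Z))"
    and A': "A' \<in> rich a" "finite (en ` B - A' \<inter> pick a (A', Z'))" using B unfolding base_def by blast
  have "infinite (en ` B)" using base_infinite[OF B(1)] by simp
  moreover have "finite (en ` B - pick a (A, Z))" "finite (en ` B - pick a (A', Z'))"
    using A(2) A'(2) by (auto elim: finite_subset[rotated])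
  ultimately have "pick a (A, Z) = pick a (A', Z')"
    using mad_unique[OF mx(2)[OF a] pick(2)[OF A(1)] pick(2)[OF A'(1)]] by blast
  then show ?thesis using pick(1)[of a] A(1) A'(1) unfolding inj_on_def by blast
qed

lemma base_dense:
  assumes "infinite B"
  shows "\<exists>a\<in>Field h. \<exists>B'\<in>base a Z. B' \<subseteq> B"
proof -
  have eB: "infinite (en ` B)" "en ` B \<subseteq> B0"
    using assms en_B0 by auto
  obtain a where a: "a \<in> Field h" "en ` B \<in> rich a" using continuum_split[OF eB(2,1)] eB unfolding rich_def by blast
  define B' where "B' = {n \<in> B. en n \<in> pick a (en ` B, Z)}"
  have im: "en ` B' = en ` B \<inter> pick a (en ` B, Z)" by (auto simp: B'_def)
  then have "infinite (en ` B')" using pick(3)[OF a(2)] by simp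
  then have "infinite B'" by simp
  then have "B' \<in> base a Z" unfolding base_def using a(2) im by (auto intro!: bexI[of _ "en ` B"])
  moreover have "B' \<subseteq> B" by (auto simp: B'_def)
  ultimately show ?thesis using a(1) by blast
qed

text \<open>The continuum many partitions of \<omega> into a set and its complement have no common
  refinement, since every infinite set is split by a half of itself. The bound ensures that the name
  of the surjection is not too large for \<open>'i\<close>.\<close>

lemma h_le_continuum: "|Field h| \<le>o |UNIV :: nat set set|"
proof (rule ccontr)
  assume "\<not> ?thesis"
  then have lt: "|UNIV :: nat set set| <o |Field h|" using ordLeq_not_ordLess by blast
  then obtain g where g: "inj_on g (UNIV :: nat set set)" "range g \<subseteq> Field h"
    using card_of_ordLeq[of "UNIV :: nat set set" "Field h"] ordLess_imp_ordLeq by blast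
  have "|range g| \<le>o |UNIV :: nat set set|" by (rule card_of_image)
  then have "|range g| <o |Field h|" using lt ordLeq_ordLess_trans by blast
  then have "|range g| <o h" using card_of_Field_ordIso[OF card_h] ordLess_ordIso_trans by blast
  then have "distributive_law TYPE(pow_fin) (Field |range g| )"
    using dn card_of_Card_order unfolding is_distributivity_number_def by blast
  then have law: "distributive_law TYPE(pow_fin) (range g)" by (simp only: Field_card_of)
  define V where "V a = {X \<in> {inv g a, - inv g a}. infinite X}" for a
  have "mad (V a)" for a
    unfolding mad_def
  proof (intro conjI ballI allI impI)
    show "\<exists>B\<in>V a. infinite (A \<inter> B)" if "infinite A" for A
    proof -
      have "A = (A \<inter> inv g a) \<union> (A \<inter> - inv g a)" by blast
      then have "infinite (A \<inter> inv g a) \<or> infinite (A \<inter> - inv g a)" using that by (metis finite_UnI)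
      then show ?thesis unfolding V_def by auto
    qed
  qed (auto simp: V_def)
  then obtain R where R: "mad R" "\<And>a. a \<in> range g \<Longrightarrow> mad_refines R (V a)"
    using distributive_law_mad[OF law, of V] by blast
  obtain A where A: "A \<in> R" "infinite A" using R(1) infinite_UNIV_nat unfolding mad_def by (metis finite_Int)
  define Z where "Z = enumerate A ` {n. even n}"
  have ea: "bij_betw (enumerate A) UNIV A" by (rule bij_enumerate[OF A(2)])
  have ie: "inj (enumerate A)" using ea by (simp add: bij_betw_def)
  have "infinite {n :: nat. even n}" "infinite {n :: nat. odd n}"
    by (auto simp: infinite_nat_iff_unbounded) (metis even_Suc lessI less_SucI)+
  then have "infinite (enumerate A ` {n. even n})" "infinite (enumerate A ` {n. odd n})"
    by (simp_all add: finite_image_iff inj_on_subset[OF ie])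
  moreover have "enumerate A ` {n. even n} \<subseteq> A - - Z" "enumerate A ` {n. odd n} \<subseteq> A - Z"
    using ea ie by (auto simp: Z_def bij_betw_def dest: injD)
  ultimately have "infinite (A - - Z)" "infinite (A - Z)" using finite_subset by blast+
  moreover obtain B where "B \<in> V (g Z)" "finite (A - B)" using R(2)[of "g Z"] A(1) unfolding mad_refines_def by blast
  ultimately show False using g(1) by (auto simp: V_def)
qed

end

section \<open>The collapse\<close>

locale collapse = singular_card \<kappa> + distributivity_number h
  for \<kappa> :: "nat \<Rightarrow> 'k::wellorder" and h :: "'h rel"
begin

definition split_levels :: "'k list set \<Rightarrow> nat set" where
  "split_levels T = {length t | t. t \<in> T \<and> (\<exists>a\<in>sc T t. \<exists>b\<in>sc T t. a \<noteq> b)}"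

lemma split_levels_mono: "S \<subseteq> T \<Longrightarrow> split_levels S \<subseteq> split_levels T"
  unfolding split_levels_def using sc_mono by blast

lemma split_levels_infinite:
  assumes T: "T \<in> PT"
  shows "infinite (split_levels T)"
  unfolding infinite_nat_iff_unbounded_le
proof
  fix n
  obtain t where t: "t \<in> T" "length t = n" using PT_long[OF T PT_Nil[OF T], of n] by auto
  obtain s where s: "s \<in> T" "prefix t s" "|K 0| \<le>o |sc T s|" using PT_big[OF T t(1)] by blast
  have "infinite (sc T s)" using card_of_ordLeq_infinite[OF s(3) infinite_K] .
  then obtain a where a: "a \<in> sc T s" using infinite_imp_nonempty by blast
  obtain b where "b \<in> sc T s" "b \<noteq> a"
    using infinite_remove[OF \<open>infinite (sc T s)\<close>, of a] infinite_imp_nonempty by blast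
  then have "length s \<in> split_levels T" using s a unfolding split_levels_def by blast
  then show "\<exists>m\<ge>n. m \<in> split_levels T" using s(2) t(2) prefix_length_le by blast
qed

text \<open>A labelled set \<open>B\<close> is found among the splitting levels of a uniform tree;
  keeping the splitting on the levels in \<open>B\<close> and nowhere else moves the splitting
  levels into \<open>B\<close> and leaves a perfect tree, because \<open>B\<close> is
  infinite.\<close>

lemma base_level_dense:
  assumes T: "T \<in> PT"
  shows "\<exists>a\<in>Field h. \<exists>S\<in>PT. S \<subseteq> T \<and> split_levels S \<in> base a Z"
proof -
  obtain T1 l where T1: "T1 \<in> PT" "T1 \<subseteq> T" and u: "uniform T1 l" using uniform_ex[OF T] .
  have l: "strict_mono l" using u by (simp add: uniform_def)
  have "infinite (range l)" using range_inj_infinite strict_mono_imp_inj_on[OF l] by blast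
  then obtain a B where a: "a \<in> Field h" and B: "B \<in> base a Z" "B \<subseteq> range l" using base_dense by blast
  define C where "C t = (if length t \<in> B then sc T1 t else {SOME a. a \<in> sc T1 t})" for t
  have some: "(SOME a. a \<in> sc T1 t) \<in> sc T1 t" if "t \<in> T1" for t
    using PT_succ[OF T1(1) that] by (simp add: some_in_eq)
  have S: "thin T1 C \<in> PT"
  proof (rule thin_PT[OF T1(1)])
    show "C t \<noteq> {} \<and> C t \<subseteq> sc T1 t" if "t \<in> T1" for t
      using some[OF that] by (auto simp: C_def)
    fix n k
    obtain j where j: "j \<in> B" "max k (l n) \<le> j"
      using base_infinite[OF B(1)] unfolding infinite_nat_iff_unbounded_le by blast
    then obtain m where m: "j = l m" using B(2) by blast
    then have "n \<le> m" using j l by (simp add: strict_mono_less_eq)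
    then have "|K n| \<le>o |C t|" if "t \<in> T1" "length t = j" for t
      using u that m j(1) K_le ordLeq_transitive unfolding uniform_def C_def by (simp, blast)
    then show "\<exists>j\<ge>k. \<forall>t\<in>T1. length t = j \<longrightarrow> |K n| \<le>o |C t|" using j(2) by (intro exI[of _ j]) auto
  qed
  have "split_levels (thin T1 C) \<subseteq> B"
  proof
    fix j assume "j \<in> split_levels (thin T1 C)"
    then obtain t a b where t: "t \<in> thin T1 C" "j = length t" "a \<in> sc (thin T1 C) t" "b \<in> sc (thin T1 C) t" "a \<noteq> b"
      unfolding split_levels_def by blast
    then have "a \<in> C t" "b \<in> C t" using sc_thin[OF t(1)] by auto
    then show "j \<in> B" using t by (auto simp: C_def split: if_splits)
  qed
  then have "finite (split_levels (thin T1 C) - B)"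
    by (metis Diff_eq_empty_iff finite.emptyI)
  then have "split_levels (thin T1 C) \<in> base a Z"
    by (rule base_down[OF B(1) split_levels_infinite[OF S]])
  moreover have "thin T1 C \<subseteq> T" by (rule order_trans[OF thin_subset T1(2)])
  ultimately show ?thesis using a S by blast
qed

text \<open>The labels of the base tree are subsets of \<omega>, so an index \<open>z\<close> of
  \<open>A2\<close> is represented by its graph.\<close>

definition code :: "(nat \<Rightarrow> nat \<Rightarrow> nat \<Rightarrow> nat) \<Rightarrow> nat set" where
  "code z = range (\<lambda>(a, b, c). to_nat (a, b, c, z a b c))"

lemma inj_code: "inj code"
proof (rule injI, intro ext)
  fix y z a b c assume "code y = code z"
  moreover have "to_nat (a, b, c, y a b c) \<in> code y"
    unfolding code_def by (rule range_eqI[of _ _ "(a, b, c)"]) simp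
  ultimately have "to_nat (a, b, c, y a b c) \<in> code z" by simp
  then show "y a b c = z a b c" by (auto simp: code_def)
qed

definition A3 :: "'h \<Rightarrow> (nat \<Rightarrow> 'k) \<Rightarrow> 'k list set set" where
  "A3 a x = {T \<in> PT. \<exists>z. split_levels T \<in> base a (code z) \<and> T \<in> A2 z x}"

lemmas A2D = label_systemD[OF A2]

lemma A3_down:
  assumes "T \<in> A3 a x" "S \<in> PT" "S \<subseteq> T"
  shows "S \<in> A3 a x"
proof -
  obtain z where z: "split_levels T \<in> base a (code z)" "T \<in> A2 z x" using assms(1) unfolding A3_def by blast
  have "finite (split_levels S - split_levels T)"
    by (rule finite_subset[of _ "{}"]) (use split_levels_mono[OF assms(3)] in auto)
  then have "split_levels S \<in> base a (code z)"
    by (rule base_down[OF z(1) split_levels_infinite[OF assms(2)]])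
  then show ?thesis using A2D(2)[OF z(2) assms(2,3)] assms(2) unfolding A3_def by blast
qed

lemma A3_consistent:
  assumes "a \<in> Field h" "T \<in> A3 a x" "T \<in> A3 a y"
  shows "x = y"
proof -
  obtain z where z: "split_levels T \<in> base a (code z)" "T \<in> A2 z x" using assms(2) unfolding A3_def by blast
  obtain z' where z': "split_levels T \<in> base a (code z')" "T \<in> A2 z' y" using assms(3) unfolding A3_def by blast
  have "z = z'" using base_consistent[OF assms(1) z(1) z'(1)] injD[OF inj_code] by blast
  then show ?thesis using A2D(3) z(2) z'(2) by blast
qed

lemma A3_dense:
  assumes "T \<in> PT"
  shows "\<exists>a\<in>Field h. \<exists>S\<in>A3 a x. S \<subseteq> T"
proof -
  obtain z T1 where T1: "T1 \<in> A2 z x" "T1 \<subseteq> T" using A2D(4)[OF assms] by blast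
  obtain a S where S: "a \<in> Field h" "S \<in> PT" "S \<subseteq> T1" "split_levels S \<in> base a (code z)"
    using base_level_dense[OF A2D(1)[OF T1(1)]] by blast
  have "S \<in> A3 a x" unfolding A3_def using S A2D(2)[OF T1(1) S(2,3)] by blast
  then show ?thesis using S(1) order_trans[OF S(3) T1(2)] by blast
qed

text \<open>A default label for the conditions without labelled extensions makes the generic function total.\<close>

definition A4 :: "'h \<Rightarrow> (nat \<Rightarrow> 'k) \<Rightarrow> 'k list set set" where
  "A4 a x = A3 a x \<union> {T \<in> PT. x = undefined \<and> \<not> (\<exists>y. \<exists>S\<in>A3 a y. S \<subseteq> T)}"

lemma A4_sub: "A4 a x \<subseteq> PT"
  by (auto simp: A4_def A3_def)

lemma A4_down: "T \<in> A4 a x \<Longrightarrow> S \<in> PT \<Longrightarrow> S \<subseteq> T \<Longrightarrow> S \<in> A4 a x"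
  using A3_down[of T a x S] by (auto simp: A4_def dest: order_trans[of _ S T])

lemma A4_total: "T \<in> PT \<Longrightarrow> \<exists>x. \<exists>S\<in>A4 a x. S \<subseteq> T"
  by (cases "\<exists>y. \<exists>S\<in>A3 a y. S \<subseteq> T") (auto simp: A4_def)

lemma A4_consistent: "a \<in> Field h \<Longrightarrow> T \<in> A4 a x \<Longrightarrow> T \<in> A4 a y \<Longrightarrow> x = y"
  using A3_consistent[of a T x y] by (auto simp: A4_def)

lemma A4_dense: "T \<in> PT \<Longrightarrow> \<exists>a\<in>Field h. \<exists>S\<in>A4 a x. S \<subseteq> T"
  using A3_dense[of T x] unfolding A4_def by blast

lemma sizes:
  "|Field h| \<le>o |UNIV :: 'k list set set|"
  "|UNIV :: (nat \<Rightarrow> 'k) set| \<le>o |UNIV :: 'k list set set|"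
  "|Field h \<times> (UNIV :: (nat \<Rightarrow> 'k) set) \<times> PT| \<le>o |UNIV :: 'k list set set|"
proof -
  let ?U = "UNIV :: 'k list set set"
  have inf: "infinite ?U"
  proof -
    have "infinite (UNIV :: 'k list set)" by (rule infinite_UNIV_listI)
    then show ?thesis by (simp add: Finite_Set.finite_set)
  qed
  have "inj ((`) (\<lambda>n. replicate n (undefined :: 'k)))"
  proof (rule injI)
    have inj: "inj (\<lambda>n. replicate n (undefined :: 'k))" by (rule injI) (metis length_replicate)
    show "X = Y" if "(\<lambda>n. replicate n (undefined :: 'k)) ` X = (\<lambda>n. replicate n undefined) ` Y" for X Y
      using that inj_image_eq_iff[OF inj] by blast
  qed
  then have "|UNIV :: nat set set| \<le>o |UNIV :: 'k list set set|"
    by (intro card_of_ordLeq[THEN iffD1] exI conjI subset_UNIV)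
  then show 1: "|Field h| \<le>o |?U|" by (rule ordLeq_transitive[OF h_le_continuum])
  \<comment> \<open>A function is recovered from the set of its restrictions, which contains exactly
    one list of each length.\<close>
  have "inj (\<lambda>f :: nat \<Rightarrow> 'k. range (restr f))"
  proof (rule injI, rule ext)
    fix f g :: "nat \<Rightarrow> 'k" and n assume "range (restr f) = range (restr g)"
    then obtain m where m: "restr f (Suc n) = restr g m" by (metis rangeE rangeI)
    then have "m = Suc n" by (metis diff_zero length_map length_upt restr_def)
    then show "f n = g n" using m by (simp add: restr_def)
  qed
  then show 2: "|UNIV :: (nat \<Rightarrow> 'k) set| \<le>o |?U|" using card_of_ordLeq[of "UNIV :: (nat \<Rightarrow> 'k) set" ?U] by blast
  have 3: "|PT| \<le>o |?U|" by (rule card_of_mono1) simp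
  show "|Field h \<times> (UNIV :: (nat \<Rightarrow> 'k) set) \<times> PT| \<le>o |?U|"
    by (intro card_of_Times_ordLeq_infinite_Field card_of_Card_order 1 2 3) (simp_all only: Field_card_of inf not_False_eq_True)
qed

end

theorem theorem5p8:
  fixes \<kappa> :: "nat \<Rightarrow> 'k::wellorder"
    and h :: "'h rel"
  assumes "Card_order (whole_ord :: 'k rel)"
    and "\<not> regularCard (whole_ord :: 'k rel)"
    and "has_cofinality (whole_ord :: 'k rel) natLeq"
    and "strict_mono \<kappa>"
    and "\<And>n. Card_order (seg_ord (\<kappa> n)) \<and> regularCard (seg_ord (\<kappa> n))"
    and "\<And>n. natLeq <o seg_ord (\<kappa> n)"
    and "\<And>\<alpha>. \<exists>n. \<alpha> < \<kappa> n"
    and "\<And>\<mu> :: 'k. Card_order (seg_ord \<mu>) \<Longrightarrow> seg_ord \<mu> ^c natLeq <o (whole_ord :: 'k rel)"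
    and "is_distributivity_number h"
    and "|UNIV :: 'k list set set| \<le>o |UNIV :: 'i set|"
  shows "holds_in_generic_extensions (perfect_trees \<kappa>)
           (Exi (\<lambda>f. Surjection f
              (check_name (seqs \<kappa>) (vordinal h :: 'i vset))
              (check_name (seqs \<kappa>) (vordinal ((whole_ord :: 'k rel) ^c natLeq) :: 'i vset))))"
proof -
  interpret collapse \<kappa> h
    by unfold_locales (fact assms)+
  let ?c = "(whole_ord :: 'k rel) ^c natLeq"
  have small: "|X| \<le>o |UNIV :: 'k list set set| \<Longrightarrow> |X| \<le>o |UNIV :: 'i set|" for X :: "'x set"
    using assms(10) ordLeq_transitive by blast
  have infi: "infinite (UNIV :: 'i set)"
  proof (rule card_of_ordLeq_infinite[OF assms(10)])
    have "infinite (UNIV :: 'k list set)" by (rule infinite_UNIV_listI)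
    then show "infinite (UNIV :: 'k list set set)" by (simp add: Finite_Set.finite_set)
  qed
  interpret forcing_names PT "seqs \<kappa>" "TYPE('i)"
    by unfold_locales (use one_PT PT_subset_one infi in auto)
  \<comment> \<open>The carrier of this cardinal power consists of the functions from
    \<open>nat\<close> to \<open>'k\<close>, so the labels of \<open>A4\<close> are already its
    elements.\<close>
  have Fc: "Field ?c = UNIV" by (simp add: cexp_def Field_card_of Field_natLeq Func_def)
  have vo: "elems (vordinal r :: 'i vset) = vord_at r ` Field r" if "|Field r| \<le>o |UNIV :: 'i set|" for r :: "'x rel"
    unfolding vordinal_def by (rule elems_vset_of[OF ordLeq_transitive[OF card_of_image that]])
  show ?thesis
    unfolding holds_in_generic_extensions_def
  proof
    fix p assume p: "p \<in> PT"
    show "forces PT p (Exi (\<lambda>f. Surjection f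
              (check_name (seqs \<kappa>) (vordinal h :: 'i vset)) (check_name (seqs \<kappa>) (vordinal ?c :: 'i vset))))"
    proof (rule forces_Surjection[where B = A4, OF vo vo])
      show "|Field h| \<le>o |UNIV :: 'i set|" "|Field ?c| \<le>o |UNIV :: 'i set|" "|Field h \<times> Field ?c \<times> PT| \<le>o |UNIV :: 'i set|"
        using small sizes unfolding Fc by blast+
      show "i = i'" if "i \<in> Field h" "i' \<in> Field h" "q \<in> PT"
        "forces_eq PT q (check_name (seqs \<kappa>) (vord_at h i :: 'i vset)) (check_name (seqs \<kappa>) (vord_at h i'))" for i i' q
        by (rule check_vord_inject[OF wo_h small[OF sizes(1)] that])
    qed (use A4_sub A4_down A4_total A4_consistent A4_dense p Fc in auto)
  qed
qed

end
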